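(* Suppose that the probability measure $F$ on $\mathbb R\cup\{-\infty\}$ satisfies $\inf\{z:F((z,\infty))=0\}=1$. Let $\nu$ be an MGS$(Q_F)$ with driving sequence $w(t)$, $t\in\mathbb Z$, starting from an arbitrary state at an arbitrary, possibly random, time. Then there exists a stationary process $(\bar{\mathfrak m}(t),t\in\mathbb Z)$ such that $$\mathfrak m(\sigma\nu(t-1),w(t))=\bar{\mathfrak m}(t)\quad\text{for all $t$ large enough, a.s.}$$ In particular, $\mathbb E\big(\bar{\mathfrak m}(0)^+\big)=C(F)$.
   Context: $\mathcal N$ is the set of locally finite point measures $\nu$ on $\mathbb R\cup\{-\infty\}$ with $\nu([0,\infty))<\infty$; for $\nu\in\mathcal N$, $\nu_1\ge\nu_2\ge\cdots$ are the locations of its points (with multiplicity) in decreasing order, so $\nu=\sum_{k\ge1}\delta_{\nu_k}$. $\mathcal W$ is the set of sequences $w=(w_1,w_2,\ldots)$ with $w_k\in\mathbb R\cup\{-\infty\}$ and $\sup_kw_k\le1$. For $\nu\ne0$ and $w\in\mathcal W$, $\mathfrak m(\nu,w):=\sup_k(\nu_k+w_k)$ (sup over the indices $k$ of the points of $\nu$) and $\Psi_w\nu:=\nu+\delta_{\mathfrak m(\nu,w)}$. The map $\sigma\nu:=\sum_{k\ge1}\delta_{\nu_k-\nu_1}$ shifts the largest point to $0$ (states are nonzero with $\nu_1>-\infty$ so that this makes sense). The Max Growth System (MGS) starting at time $T$ from state $\nu(T)\in\mathcal N$ with driving sequence $w(t)$, $t>T$, is defined by $\nu(t)=\Psi_{w(t)}\nu(t-1)$,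 $t>T$. MGS$(Q_F)$ means that $w(t)$, $t\in\mathbb Z$, are i.i.d. and the components $w_1(t),w_2(t),\ldots$ of each are i.i.d. with distribution $F$. $C(F)$: assign to each pair of integers $i<j$ an independent charge $w_{i,j}$ with distribution $F$; the charge of an increasing sequence (path) $(i_0,\ldots,i_\ell)$ is $\sum_{k=1}^\ell w_{i_{k-1},i_k}$; $W_{0,n}$ is the maximal charge of all paths from $0$ to $n$; $C(F)$ is the deterministic a.s. limit of $W_{0,n}/n$ as $n\to\infty$ (known to exist). $x^+=\max(x,0)$. *)

theory Defs
  imports "HOL-Probability.Probability"
begin

text \<open>
  The set \<open>\<real> \<union> {-\<infinity>}\<close> is rendered as the type \<^typ>\<open>ereal\<close> with the value \<open>\<infinity>\<close> excluded.
  Sequences indexed by \<open>k \<ge> 1\<close> are indexed from \<open>0\<close> here.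
\<close>

text \<open>
  A measure on \<open>\<real> \<union> {-\<infinity>}\<close> with values in \<open>\<nat> \<union> {\<infinity>}\<close> that is finite on bounded real intervals is
  a sum of Dirac masses. Local finiteness is understood on \<open>\<real>\<close>: points may
  accumulate at \<open>-\<infinity>\<close>, and the mass at \<open>-\<infinity>\<close> itself is unrestricted.
\<close>

definition point_measures :: "ereal measure set" where
  "point_measures =
     {\<nu>. sets \<nu> = sets borel \<and>
          (\<forall>A\<in>sets borel. emeasure \<nu> A \<in> range of_nat \<union> {\<infinity>}) \<and>
          emeasure \<nu> {\<infinity>} = 0 \<and>
          (\<forall>a b::real. emeasure \<nu> {ereal a..ereal b} < \<infinity>) \<and>
          emeasure \<nu> {0..<\<infinity>} < \<infinity>}"

definition indices :: "ereal measure \<Rightarrow> nat set" where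
  "indices \<nu> = {k. of_nat k < emeasure \<nu> UNIV}"

text \<open>
  The location of the \<open>(k+1)\<close>-st largest point; meaningful for \<open>k \<in> indices \<nu>\<close>. If there are infinitely
  many real points, all of these locations are real and the mass at \<open>-\<infinity>\<close> is not listed.
\<close>

definition nth_point :: "ereal measure \<Rightarrow> nat \<Rightarrow> ereal" where
  "nth_point \<nu> k = Sup {x. of_nat (Suc k) \<le> emeasure \<nu> {x..}}"

definition driving_sequences :: "(nat \<Rightarrow> ereal) set" where
  "driving_sequences = {w. (SUP k. w k) \<le> 1}"

definition max_growth :: "ereal measure \<Rightarrow> (nat \<Rightarrow> ereal) \<Rightarrow> ereal" where
  "max_growth \<nu> w = (SUP k\<in>indices \<nu>. nth_point \<nu> k + w k)"

definition add_dirac :: "ereal measure \<Rightarrow> ereal \<Rightarrow> ereal measure" where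
  "add_dirac \<nu> x = measure_of UNIV (sets borel) (\<lambda>A. emeasure \<nu> A + emeasure (return borel x) A)"

lemma sets_add_dirac [simp]: "sets (add_dirac \<nu> x) = sets borel"
  unfolding add_dirac_def by (metis sets.sets_measure_of_eq space_borel)

lemma emeasure_add_dirac:
  assumes "sets \<nu> = sets borel" "A \<in> sets borel"
  shows "emeasure (add_dirac \<nu> x) A = emeasure \<nu> A + indicator A x"
proof -
  have "emeasure (add_dirac \<nu> x) A = emeasure \<nu> A + emeasure (return borel x) A"
  proof (rule emeasure_measure_of[OF add_dirac_def])
    show "countably_additive (sets (add_dirac \<nu> x))
            (\<lambda>A. emeasure \<nu> A + emeasure (return borel x) A)"
    proof (rule countably_additiveI)
      fix B :: "nat \<Rightarrow> ereal set"
      assume B: "range B \<subseteq> sets (add_dirac \<nu> x)" "disjoint_family B"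
      have "(\<Sum>i. emeasure \<nu> (B i) + emeasure (return borel x) (B i))
            = (\<Sum>i. emeasure \<nu> (B i)) + (\<Sum>i. emeasure (return borel x) (B i))"
        by (intro suminf_add[symmetric]) auto
      also have "\<dots> = emeasure \<nu> (\<Union>i. B i) + emeasure (return borel x) (\<Union>i. B i)"
        using B assms by (intro arg_cong2[where f = "(+)"] suminf_emeasure) auto
      finally show "(\<Sum>i. emeasure \<nu> (B i) + emeasure (return borel x) (B i))
            = emeasure \<nu> (\<Union>i. B i) + emeasure (return borel x) (\<Union>i. B i)" .
    qed
  qed (use assms in \<open>auto simp: positive_def\<close>)
  then show ?thesis using assms by simp
qed

definition growth_map :: "(nat \<Rightarrow> ereal) \<Rightarrow> ereal measure \<Rightarrow> ereal measure" where
  "growth_map w \<nu> = add_dirac \<nu> (max_growth \<nu> w)"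

text \<open>The image of counting measure on \<open>I\<close> under \<open>f\<close> is the sum of the Dirac masses at \<open>f k\<close>, \<open>k \<in> I\<close>.\<close>

definition shift_top :: "ereal measure \<Rightarrow> ereal measure" where
  "shift_top \<nu> = distr (count_space (indices \<nu>)) borel (\<lambda>k. nth_point \<nu> k - nth_point \<nu> 0)"

definition is_MGS :: "int \<Rightarrow> (int \<Rightarrow> nat \<Rightarrow> ereal) \<Rightarrow> (int \<Rightarrow> ereal measure) \<Rightarrow> bool" where
  "is_MGS T w \<nu> \<longleftrightarrow>
     \<nu> T \<in> point_measures \<and> emeasure (\<nu> T) UNIV \<noteq> 0 \<and> nth_point (\<nu> T) 0 > -\<infinity> \<and>
     (\<forall>t>T. w t \<in> driving_sequences \<and> \<nu> t = growth_map (w t) (\<nu> (t - 1)))"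

abbreviation seq_space :: "(nat \<Rightarrow> ereal) measure" where
  "seq_space \<equiv> \<Pi>\<^sub>M k\<in>UNIV. borel"

definition iid_law :: "ereal measure \<Rightarrow> (nat \<Rightarrow> ereal) measure" where
  "iid_law F = (\<Pi>\<^sub>M k\<in>UNIV. F)"

definition iid_driving :: "'a measure \<Rightarrow> (nat \<Rightarrow> ereal) measure \<Rightarrow> (int \<Rightarrow> 'a \<Rightarrow> nat \<Rightarrow> ereal) \<Rightarrow> bool" where
  "iid_driving M Q w \<longleftrightarrow>
     prob_space.indep_vars M (\<lambda>_. seq_space) w UNIV \<and> (\<forall>t. distr M seq_space (w t) = Q)"

text \<open>
  A Max Growth System driven by i.i.d. sequences of law \<open>Q\<close>, started at a random time \<open>T\<close> from a
  random state. Random states are measurable for the \<open>\<sigma>\<close>-algebra generated by the maps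
  \<open>\<nu> \<mapsto> \<nu>(A)\<close>; no independence of \<open>T\<close>, the initial state and \<open>w\<close> is imposed. The value \<open>\<nu> \<omega> t\<close> is
  irrelevant for \<open>t < T \<omega>\<close>.
\<close>

definition random_MGS ::
  "'a measure \<Rightarrow> (nat \<Rightarrow> ereal) measure \<Rightarrow> (int \<Rightarrow> 'a \<Rightarrow> nat \<Rightarrow> ereal) \<Rightarrow> ('a \<Rightarrow> int) \<Rightarrow>
   ('a \<Rightarrow> int \<Rightarrow> ereal measure) \<Rightarrow> bool" where
  "random_MGS M Q w T \<nu> \<longleftrightarrow>
     iid_driving M Q w \<and>
     T \<in> measurable M (count_space UNIV) \<and>
     (\<forall>A\<in>sets borel. (\<lambda>\<omega>. emeasure (\<nu> \<omega> (T \<omega>)) A) \<in> borel_measurable M) \<and>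
     (AE \<omega> in M. is_MGS (T \<omega>) (\<lambda>t. w t \<omega>) (\<nu> \<omega>))"

definition stationary_process :: "'a measure \<Rightarrow> (int \<Rightarrow> 'a \<Rightarrow> 'b::topological_space) \<Rightarrow> bool" where
  "stationary_process M X \<longleftrightarrow>
     (\<forall>t. X t \<in> borel_measurable M) \<and>
     (\<forall>s. distr M (\<Pi>\<^sub>M t\<in>UNIV. borel) (\<lambda>\<omega> t. X (t + s) \<omega>)
        = distr M (\<Pi>\<^sub>M t\<in>UNIV. borel) (\<lambda>\<omega> t. X t \<omega>))"

definition increasing_paths :: "int \<Rightarrow> int \<Rightarrow> int list set" where
  "increasing_paths i j = {p. p \<noteq> [] \<and> sorted_wrt (<) p \<and> hd p = i \<and> last p = j}"

definition path_charge :: "(int \<times> int \<Rightarrow> ereal) \<Rightarrow> int list \<Rightarrow> ereal" where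
  "path_charge c p = (\<Sum>k<length p - 1. c (p ! k, p ! Suc k))"

definition max_charge :: "(int \<times> int \<Rightarrow> ereal) \<Rightarrow> int \<Rightarrow> int \<Rightarrow> ereal" where
  "max_charge c i j = Max (path_charge c ` increasing_paths i j)"

definition charge_law :: "ereal measure \<Rightarrow> (int \<times> int \<Rightarrow> ereal) measure" where
  "charge_law F = (\<Pi>\<^sub>M e\<in>{(i, j). i < j}. F)"

definition lpp_constant :: "ereal measure \<Rightarrow> real" where
  "lpp_constant F =
     (THE c. AE q in charge_law F. (\<lambda>n. max_charge q 0 (int n) / ereal (real n)) \<longlonglongrightarrow> ereal c)"

end

theory Submission
  imports Defs
begin

text \<open>
  Let \<open>X\<^sub>0\<close> be the front at time \<open>t\<close>. If \<open>w\<^sub>1(t + 1) > 1/2\<close> and, for every \<open>n \<ge> 1\<close>, one of the first \<open>n\<close> entries of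
  \<open>w(t + 1 + n)\<close> exceeds \<open>1/2\<close>, then the point \<open>X\<^sub>1\<close> added at time \<open>t + 1\<close> satisfies \<open>X\<^sub>1 > X\<^sub>0 + 1/2\<close>, and
  inductively every later point lies above \<open>X\<^sub>1 + 1/2\<close>, because one of the new points already beats the
  bound \<open>X\<^sub>0 + 1\<close> on the contributions of the points present at time \<open>t\<close>. Relative to \<open>X\<^sub>1\<close> the process
  is then an MGS started from a single point, whatever the state at time \<open>t\<close> was. With
  \<open>p = F((1/2, \<infinity>))\<close> such a renovation has probability \<open>p \<Prod>\<^sub>n (1 - (1 - p)\<^sup>n) > 0\<close>, so by the zero-one
  law and stationarity renovations occur in the arbitrarily remote past and future, and the growth at time \<open>t\<close> seen from any
  renovation before \<open>t\<close> is the stationary process.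

  The front advances by the positive parts of these increments, so its speed is their mean \<open>\<gamma>\<close>; here the
  limsup of the averages is controlled by the zero-one law and compared with the mean by the covering
  argument of Katznelson and Weiss. The marks of an MGS started from a point, permuted according
  to the ranking of the points, are i.i.d. edge charges whose maximal path charges are the
  positions of the points; hence \<open>\<gamma> = C(F)\<close>.
\<close>

section \<open>Ranking of points\<close>

text \<open>The threshold 1/2 serves two needs. Two gains of more than 1/2 pass the reach 1 of an
  old point, and values above 1/2 keep positive probability because the essential supremum of F is
  1. What follows a renovation is deterministic; probability only supplies renovations, so the
  starting time and state may depend on the driving sequences in any way. Renovations in the remote
  past make the increment a function of the two-sided driving sequence, hence stationary.

  The identification with C(F) hides an obstacle. The front is the largest charge over all endpoints
  up to n, while C(F) concerns the endpoint n itself, and a single point may land far below the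
  front, even at \<open>-\<infinity>\<close>. Positive speed puts linearly many points above a
  slightly older record, and for all large n one of linearly many marks exceeds 1/2, so the n-th
  point cannot stay far behind. The marks may be permuted because the ranking at time n depends only
  on earlier driving sequences.\<close>

definition ranking :: "(nat \<Rightarrow> 'a::linorder) \<Rightarrow> nat \<Rightarrow> nat list" where
  "ranking y n = rev (sort_key y [0..<n])"

lemma length_ranking [simp]: "length (ranking y n) = n"
  by (simp add: ranking_def)

lemma set_ranking [simp]: "set (ranking y n) = {..<n}"
  by (auto simp: ranking_def)

lemma distinct_ranking [simp]: "distinct (ranking y n)"
  by (simp add: ranking_def)

lemma ranking_less: "k < n \<Longrightarrow> ranking y n ! k < n"
  by (metis length_ranking lessThan_iff nth_mem set_ranking)

lemma bij_betw_ranking: "bij_betw ((!) (ranking y n)) {..<n} {..<n}"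
  by (rule bij_betw_nth) auto

lemma ranking_surj:
  assumes "i < n" obtains k where "k < n" "i = ranking y n ! k"
  using assms by (metis in_set_conv_nth length_ranking lessThan_iff set_ranking)

lemma ranking_antimono: "j \<le> k \<Longrightarrow> k < n \<Longrightarrow> y (ranking y n ! k) \<le> y (ranking y n ! j)"
proof -
  assume jk: "j \<le> k" "k < n"
  have s: "sorted (map y (sort_key y [0..<n]))" by simp
  have "map y (sort_key y [0..<n]) ! (n - Suc k) \<le> map y (sort_key y [0..<n]) ! (n - Suc j)"
    by (rule sorted_nth_mono[OF s]) (use jk in auto)
  then show ?thesis using jk by (simp add: ranking_def rev_nth)
qed

text \<open>Insertion sort consults the keys only through comparisons, and ties are resolved by the
  order of the list. Order equivalent keys therefore give the same permutation, ties
  included.\<close>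

lemma sort_key_cong_order:
  assumes "\<And>a b. a \<in> set xs \<Longrightarrow> b \<in> set xs \<Longrightarrow> f a \<le> f b \<longleftrightarrow> g a \<le> g b"
  shows "sort_key f xs = sort_key g xs"
proof -
  have ins: "insort_key f a ys = insort_key g a ys"
    if "\<And>b. b \<in> set ys \<Longrightarrow> f a \<le> f b \<longleftrightarrow> g a \<le> g b" for a ys
    using that by (induction ys) auto
  show ?thesis using assms
  proof (induction xs)
    case (Cons a xs)
    then have "sort_key f xs = sort_key g xs" by simp
    moreover have "insort_key f a (sort_key g xs) = insort_key g a (sort_key g xs)"
      by (rule ins) (use Cons.prems in auto)
    ultimately show ?case by simp
  qed simp
qed

lemma ranking_cong_order:
  "(\<And>i j. i < n \<Longrightarrow> j < n \<Longrightarrow> f i \<le> f j \<longleftrightarrow> g i \<le> g j) \<Longrightarrow> ranking f n = ranking g n"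
  unfolding ranking_def by (intro arg_cong[where f = rev] sort_key_cong_order) auto

lemma ranking_cong: "(\<And>i. i < n \<Longrightarrow> f i = g i) \<Longrightarrow> ranking f n = ranking g n"
  by (rule ranking_cong_order) auto

lemma Max_ranking_0:
  assumes "0 < n" shows "y (ranking y n ! 0) = Max (y ` {..<n})"
proof (rule Max_eqI[symmetric])
  fix a assume "a \<in> y ` {..<n}"
  then obtain i where "i < n" "a = y i" by blast
  then obtain k where "k < n" "a = y (ranking y n ! k)" using ranking_surj[of i n y] by blast
  then show "a \<le> y (ranking y n ! 0)" using ranking_antimono[of 0 k n y] by simp
qed (use assms ranking_less in auto)

lemma card_ranking:
  "card {i. i < n \<and> P (y i)} = card {k. k < n \<and> P (y (ranking y n ! k))}"
proof (rule bij_betw_same_card[symmetric, of "(!) (ranking y n)"])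
  have "bij_betw ((!) (ranking y n)) {k. k < n \<and> P (y (ranking y n ! k))}
     ((!) (ranking y n) ` {k. k < n \<and> P (y (ranking y n ! k))})"
    by (rule bij_betw_subset[OF bij_betw_ranking]) auto
  moreover have "(!) (ranking y n) ` {k. k < n \<and> P (y (ranking y n ! k))} = {i. i < n \<and> P (y i)}"
  proof (intro equalityI subsetI)
    fix i assume "i \<in> {i. i < n \<and> P (y i)}"
    then obtain k where "k < n" "i = ranking y n ! k" "P (y i)" using ranking_surj[of i n y] by blast
    then show "i \<in> (!) (ranking y n) ` {k. k < n \<and> P (y (ranking y n ! k))}" by blast
  qed (auto simp: ranking_less)
  ultimately show "bij_betw ((!) (ranking y n)) {k. k < n \<and> P (y (ranking y n ! k))} {i. i < n \<and> P (y i)}"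
    by simp
qed

text \<open>Heights decrease with rank, so the ranks with height at least \<open>a\<close> form an
  initial segment, whose length is the number of points at or above \<open>a\<close>. This
  translates between counts, in which states are described, and order statistics.\<close>

lemma le_ranking_iff:
  assumes "k < n"
  shows "a \<le> y (ranking y n ! k) \<longleftrightarrow> k < card {i. i < n \<and> a \<le> y i}"
proof -
  let ?S = "{j. j < n \<and> a \<le> y (ranking y n ! j)}"
  have c: "card {i. i < n \<and> a \<le> y i} = card ?S" by (rule card_ranking)
  show ?thesis
  proof
    assume "a \<le> y (ranking y n ! k)"
    then have "{..k} \<subseteq> ?S" using assms ranking_antimono[of _ k n y] by (auto intro: order_trans)
    then have "card {..k} \<le> card ?S" by (intro card_mono) auto
    then show "k < card {i. i < n \<and> a \<le> y i}" using c by simp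
  next
    assume *: "k < card {i. i < n \<and> a \<le> y i}"
    show "a \<le> y (ranking y n ! k)"
    proof (rule ccontr)
      assume "\<not> ?thesis"
      then have "?S \<subseteq> {..<k}" using ranking_antimono[of k _ n y]
        by auto (metis linorder_not_le order_trans)
      then have "card ?S \<le> card {..<k}" by (intro card_mono) auto
      then show False using * c by simp
    qed
  qed
qed

section \<open>The system started from a single point\<close>

definition new_point :: "(nat \<Rightarrow> ereal) \<Rightarrow> nat \<Rightarrow> (nat \<Rightarrow> ereal) \<Rightarrow> ereal" where
  "new_point y n v = Max ((\<lambda>k. y (ranking y n ! k) + v k) ` {..<n})"

text \<open>The next point depends on all earlier positions through their ranking, so the recursion
  carries the whole function of positions found so far; \<open>pos\<close> is its diagonal.\<close>

primrec history :: "(nat \<Rightarrow> nat \<Rightarrow> ereal) \<Rightarrow> nat \<Rightarrow> nat \<Rightarrow> ereal" where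
  "history x 0 = (\<lambda>_. 0)"
| "history x (Suc n) = (history x n)(Suc n := new_point (history x n) (Suc n) (x (Suc n)))"

text \<open>The location of the point added at time \<open>n\<close> by the MGS started at time \<open>0\<close> from a single
  point at \<open>0\<close>; the driving sequence \<open>x 0\<close> plays no role.\<close>
definition pos :: "(nat \<Rightarrow> nat \<Rightarrow> ereal) \<Rightarrow> nat \<Rightarrow> ereal" where
  "pos x n = history x n n"

lemma history_eq_pos: "i \<le> n \<Longrightarrow> history x n i = pos x i"
  by (induction n) (auto simp: pos_def le_Suc_eq)

lemma new_point_cong: "(\<And>i. i < n \<Longrightarrow> y i = y' i) \<Longrightarrow> new_point y n v = new_point y' n v"
  unfolding new_point_def using ranking_cong[of n y y']
  by (intro arg_cong[where f = Max] image_cong) (auto simp: ranking_less)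

lemma pos_0 [simp]: "pos x 0 = 0"
  by (simp add: pos_def)

lemma pos_rec: "0 < n \<Longrightarrow> pos x n = new_point (pos x) n (x n)"
proof -
  assume "0 < n"
  then obtain m where n: "n = Suc m" by (cases n) auto
  have "pos x n = new_point (history x m) n (x n)" by (simp add: pos_def n)
  also have "\<dots> = new_point (pos x) n (x n)"
    by (rule new_point_cong) (simp add: history_eq_pos n)
  finally show ?thesis .
qed

text \<open>Subtracting the previous front turns the location of the new point into the quantity
  m(\<sigma>\<nu>(n-1), w(n)); it is negative when the front stays put.\<close>

definition incr :: "(nat \<Rightarrow> nat \<Rightarrow> ereal) \<Rightarrow> nat \<Rightarrow> ereal" where
  "incr x n = pos x n - Max (pos x ` {..<n})"

section \<open>Points of a state\<close>

lemma nth_point_antimono: "j \<le> k \<Longrightarrow> nth_point \<nu> k \<le> nth_point \<nu> j"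
  unfolding nth_point_def
proof (rule Sup_subset_mono, safe)
  fix x assume "j \<le> k" "of_nat (Suc k) \<le> emeasure \<nu> {x..}"
  then show "of_nat (Suc j) \<le> emeasure \<nu> {x..}"
    by (meson Suc_le_mono of_nat_mono order_trans)
qed

text \<open>A description of a state from level \<open>c\<close> upwards by a finite list, silent
  about what lies below. Strictly above \<open>c\<close> the counts are exact. At \<open>c\<close>
  only a lower bound on the mass is recorded, so that listed points may sit at \<open>c\<close> next
  to unlisted ones. After a renovation \<open>c\<close> is the old front; for a start from one point
  \<open>c\<close> is \<open>-\<infinity>\<close>, where later points may land.\<close>

definition tops :: "ereal measure \<Rightarrow> ereal \<Rightarrow> (nat \<Rightarrow> ereal) \<Rightarrow> nat \<Rightarrow> bool" where
  "tops \<nu> c y n \<longleftrightarrow> sets \<nu> = sets borel \<and>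
     (\<forall>a>c. emeasure \<nu> {a..} = of_nat (card {i. i < n \<and> a \<le> y i})) \<and>
     (\<forall>i<n. c \<le> y i) \<and> of_nat n \<le> emeasure \<nu> {c..}"

lemma tops_nth_point:
  assumes "tops \<nu> c y n" "k < n"
  shows "nth_point \<nu> k = y (ranking y n ! k)"
  unfolding nth_point_def
proof (rule Sup_eqI)
  let ?t = "y (ranking y n ! k)"
  fix a assume "a \<in> {x. of_nat (Suc k) \<le> emeasure \<nu> {x..}}"
  then have a: "of_nat (Suc k) \<le> emeasure \<nu> {a..}" by simp
  show "a \<le> ?t"
  proof (cases "a > c")
    case True
    then have "(of_nat (Suc k) :: ennreal) \<le> of_nat (card {i. i < n \<and> a \<le> y i})"
      using assms(1) a unfolding tops_def by simp
    then have "Suc k \<le> card {i. i < n \<and> a \<le> y i}"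
      by (simp only: of_nat_le_iff)
    then show ?thesis using le_ranking_iff[OF assms(2), of a y] by simp
  next
    case False
    then show ?thesis using assms ranking_less[OF assms(2), of y] unfolding tops_def by (auto intro: order_trans)
  qed
next
  let ?t = "y (ranking y n ! k)"
  fix b assume b: "\<And>x. x \<in> {x. of_nat (Suc k) \<le> emeasure \<nu> {x..}} \<Longrightarrow> x \<le> b"
  have "of_nat (Suc k) \<le> emeasure \<nu> {?t..}"
  proof (cases "?t > c")
    case True
    have "Suc k \<le> card {i. i < n \<and> ?t \<le> y i}"
      using le_ranking_iff[OF assms(2), of ?t y] by simp
    then show ?thesis using assms(1) True unfolding tops_def
      by (simp only: of_nat_le_iff)
  next
    \<comment> \<open>The point sits at \<open>c\<close> itself, where exact counts say nothing and
      the mass bound in \<open>tops\<close> takes over.\<close>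
    case False
    have "c \<le> ?t" using assms ranking_less[OF assms(2), of y] unfolding tops_def by auto
    with False have "?t = c" by auto
    moreover have "(of_nat (Suc k) :: ennreal) \<le> of_nat n" using assms(2) by (simp only: of_nat_le_iff)
    ultimately show ?thesis using assms(1) unfolding tops_def by (metis order_trans)
  qed
  then show "?t \<le> b" using b by simp
qed

lemma tops_nth_point_le:
  assumes "tops \<nu> c y n" "n \<le> k"
  shows "nth_point \<nu> k \<le> c"
  unfolding nth_point_def
proof (rule Sup_least, rule ccontr)
  fix a assume a: "a \<in> {x. of_nat (Suc k) \<le> emeasure \<nu> {x..}}" "\<not> a \<le> c"
  then have "(of_nat (Suc k) :: ennreal) \<le> of_nat (card {i. i < n \<and> a \<le> y i})"
    using assms(1) unfolding tops_def by simp
  then have "Suc k \<le> card {i. i < n \<and> a \<le> y i}" by (simp only: of_nat_le_iff)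
  also have "\<dots> \<le> card {..<n}" by (intro card_mono) auto
  finally show False using assms(2) by simp
qed

lemma tops_add_dirac:
  assumes "tops \<nu> c y n" "c \<le> y n"
  shows "tops (add_dirac \<nu> (y n)) c y (Suc n)"
proof -
  have e: "emeasure (add_dirac \<nu> (y n)) {a..} = emeasure \<nu> {a..} + indicator {a..} (y n)" for a
    by (rule emeasure_add_dirac) (use assms in \<open>auto simp: tops_def\<close>)
  have "card {i. i < Suc n \<and> a \<le> y i} = card {i. i < n \<and> a \<le> y i} + (if a \<le> y n then 1 else 0)" for a
  proof (cases "a \<le> y n")
    case True
    then have "{i. i < Suc n \<and> a \<le> y i} = insert n {i. i < n \<and> a \<le> y i}" by auto
    then show ?thesis using True by simp
  next
    case False
    then have "{i. i < Suc n \<and> a \<le> y i} = {i. i < n \<and> a \<le> y i}" using less_Suc_eq by auto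
    then show ?thesis using False by simp
  qed
  then show ?thesis using assms unfolding tops_def
    by (auto simp: e less_Suc_eq add.commute indicator_def intro: add_mono)
qed

lemma tops_indices:
  assumes "tops \<nu> c y n"
  shows "{..<n} \<subseteq> indices \<nu>"
proof
  fix k assume "k \<in> {..<n}"
  then have "(of_nat k :: ennreal) < of_nat n" by (simp only: lessThan_iff of_nat_less_iff)
  also have "\<dots> \<le> emeasure \<nu> {c..}" using assms by (simp add: tops_def)
  also have "\<dots> \<le> emeasure \<nu> UNIV" by (rule emeasure_mono) (use assms sets_eq_imp_space_eq[of \<nu> borel] in \<open>auto simp: tops_def\<close>)
  finally show "k \<in> indices \<nu>" by (simp add: indices_def)
qed

lemma driving_le: "w \<in> driving_sequences \<Longrightarrow> w k \<le> 1"
  unfolding driving_sequences_def using SUP_upper[of k UNIV w] by (auto intro: order_trans)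

text \<open>An unlisted point lies at or below \<open>c\<close> and its mark is at most 1, so it
  contributes at most \<open>c + 1\<close>. The supremum is then decided by the listed points if
  there are no others, as for a start from one point, or if they reach \<open>c + 1\<close>, as
  after a renovation.\<close>

lemma tops_max_growth:
  assumes "tops \<nu> c y n" "0 < n" 
    and "w \<in> driving_sequences"
    and "indices \<nu> = {..<n} \<or> c + 1 \<le> new_point y n w"
  shows "max_growth \<nu> w = new_point y n w"
  unfolding max_growth_def
proof (rule antisym)
  show "(SUP k\<in>indices \<nu>. nth_point \<nu> k + w k) \<le> new_point y n w"
  proof (rule SUP_least)
    fix k assume k: "k \<in> indices \<nu>"
    show "nth_point \<nu> k + w k \<le> new_point y n w"
    proof (cases "k < n")
      case True
      then show ?thesis unfolding new_point_def using tops_nth_point[OF assms(1) True]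
        by (intro Max_ge) auto
    next
      case False
      then have "nth_point \<nu> k + w k \<le> c + 1"
        using tops_nth_point_le[OF assms(1)] driving_le[OF assms(3)] by (intro add_mono) auto
      then show ?thesis using False k assms(4) by auto
    qed
  qed
  have "new_point y n w \<in> (\<lambda>k. y (ranking y n ! k) + w k) ` {..<n}"
    unfolding new_point_def using assms(2) by (intro Max_in) auto
  then obtain k where k: "k < n" "new_point y n w = y (ranking y n ! k) + w k" by auto
  have "nth_point \<nu> k + w k \<le> (SUP k\<in>indices \<nu>. nth_point \<nu> k + w k)"
    by (rule SUP_upper) (use k tops_indices[OF assms(1)] in auto)
  then show "new_point y n w \<le> (SUP k\<in>indices \<nu>. nth_point \<nu> k + w k)"
    using k tops_nth_point[OF assms(1)] by simp
qed

lemma indices_downward: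
  assumes "k \<in> indices \<nu>" "j \<le> k" shows "j \<in> indices \<nu>"
proof -
  have "(of_nat j :: ennreal) \<le> of_nat k" by (rule of_nat_mono) fact
  then show ?thesis using assms(1) unfolding indices_def mem_Collect_eq by (rule le_less_trans)
qed

lemma emeasure_shift_top:
  assumes "A \<in> sets borel"
  shows "emeasure (shift_top \<nu>) A = emeasure (count_space UNIV) {k \<in> indices \<nu>. nth_point \<nu> k - nth_point \<nu> 0 \<in> A}"
proof -
  let ?f = "\<lambda>k. nth_point \<nu> k - nth_point \<nu> 0"
  have "emeasure (shift_top \<nu>) A = emeasure (count_space (indices \<nu>)) (?f -` A \<inter> indices \<nu>)"
    unfolding shift_top_def using assms by (subst emeasure_distr) auto
  also have "\<dots> = emeasure (count_space UNIV) (?f -` A \<inter> indices \<nu>)"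
    by (simp add: emeasure_count_space)
  also have "?f -` A \<inter> indices \<nu> = {k \<in> indices \<nu>. ?f k \<in> A}" by blast
  finally show ?thesis .
qed

lemma of_nat_less_count_space:
  assumes "\<And>j k. k \<in> S \<Longrightarrow> j \<le> k \<Longrightarrow> j \<in> S"
  shows "of_nat k < emeasure (count_space UNIV) S \<longleftrightarrow> (k::nat) \<in> S"
proof (cases "finite S")
  case True
  have "k \<in> S \<longleftrightarrow> k < card S"
  proof
    assume "k \<in> S"
    then have "{..k} \<subseteq> S" using assms by auto
    then have "card {..k} \<le> card S" using True by (intro card_mono)
    then show "k < card S" by simp
  next
    assume k: "k < card S"
    show "k \<in> S"
    proof (rule ccontr)
      assume "k \<notin> S"
      then have "S \<subseteq> {..<k}" using assms by (metis lessThan_iff linorder_not_le subsetI)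
      then have "card S \<le> card {..<k}" by (intro card_mono) auto
      then show False using k by simp
    qed
  qed
  then show ?thesis using True by (simp add: emeasure_count_space)
next
  case False
  then obtain m where "m \<in> S" "k \<le> m" by (meson finite_nat_set_iff_bounded_le nle_le)
  then show ?thesis using False assms by (auto simp: emeasure_count_space of_nat_less_top)
qed

text \<open>The shifted points are already listed in decreasing order, so taking order statistics of
  the image measure returns the same list. As the front is real, subtracting it passes through the
  supremum.\<close>

lemma max_growth_shift_top:
  assumes front: "\<bar>nth_point \<nu> 0\<bar> \<noteq> \<infinity>" and ne: "indices \<nu> \<noteq> {}"
  shows "max_growth (shift_top \<nu>) w = max_growth \<nu> w - nth_point \<nu> 0"
proof -
  obtain r where r: "nth_point \<nu> 0 = ereal r" using front by auto
  let ?a = "\<lambda>k. nth_point \<nu> k - nth_point \<nu> 0"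
  have mono: "?a k \<le> ?a j" if "j \<le> k" for j k
    using nth_point_antimono[OF that] by (intro ereal_minus_mono) auto
  have less: "of_nat k < emeasure (shift_top \<nu>) {x..} \<longleftrightarrow> k \<in> indices \<nu> \<and> x \<le> ?a k" for k x
  proof -
    have "emeasure (shift_top \<nu>) {x..} = emeasure (count_space UNIV) {k \<in> indices \<nu>. x \<le> ?a k}"
      by (subst emeasure_shift_top) auto
    moreover have "of_nat k < emeasure (count_space UNIV) {k \<in> indices \<nu>. x \<le> ?a k} \<longleftrightarrow> k \<in> {k \<in> indices \<nu>. x \<le> ?a k}"
      by (rule of_nat_less_count_space) (auto intro: indices_downward order_trans[OF _ mono])
    ultimately show ?thesis by simp
  qed
  have ind: "indices (shift_top \<nu>) = indices \<nu>"
  proof -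
    have "UNIV = {-\<infinity>::ereal..}" by auto
    then show ?thesis unfolding indices_def[of "shift_top \<nu>"] using less[of _ "-\<infinity>"] by auto
  qed
  have Suc_le: "of_nat (Suc k) \<le> emeasure (shift_top \<nu>) {x..} \<longleftrightarrow> of_nat k < emeasure (shift_top \<nu>) {x..}" for k x
  proof -
    have "emeasure (shift_top \<nu>) {x..} = emeasure (count_space UNIV) {k \<in> indices \<nu>. x \<le> ?a k}"
      by (subst emeasure_shift_top) auto
    then show ?thesis by (auto simp: emeasure_count_space of_nat_less_top simp del: of_nat_Suc)
  qed
  have nth: "nth_point (shift_top \<nu>) k = ?a k" if "k \<in> indices \<nu>" for k
    unfolding nth_point_def[of "shift_top \<nu>"] Suc_le less using that by (intro Sup_eqI) auto
  have "max_growth (shift_top \<nu>) w = (SUP k\<in>indices \<nu>. (nth_point \<nu> k + w k) + - nth_point \<nu> 0)"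
    unfolding max_growth_def ind by (intro SUP_cong refl) (simp add: nth r minus_ereal_def ac_simps)
  also have "\<dots> = (SUP k\<in>indices \<nu>. nth_point \<nu> k + w k) + - nth_point \<nu> 0"
    using ne by (intro SUP_ereal_add_left) (auto simp: r)
  finally show ?thesis by (simp add: max_growth_def minus_ereal_def)
qed

section \<open>Renovation\<close>

text \<open>The invariant carried along the system: integer masses make a mass below 1 vanish, and a
  real front can be subtracted.\<close>

definition proper_state :: "ereal measure \<Rightarrow> bool" where
  "proper_state \<nu> \<longleftrightarrow> sets \<nu> = sets borel \<and> (\<forall>A\<in>sets borel. emeasure \<nu> A \<in> range of_nat \<union> {\<infinity>}) \<and>
     emeasure \<nu> UNIV \<noteq> 0 \<and> \<bar>nth_point \<nu> 0\<bar> \<noteq> \<infinity>"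

lemma nth_point_0_above:
  assumes "\<And>A. A \<in> sets borel \<Longrightarrow> emeasure \<nu> A \<in> range of_nat \<union> {\<infinity>}" and "nth_point \<nu> 0 < x"
  shows "emeasure \<nu> {x..} = 0"
proof -
  have "\<not> of_nat (Suc 0) \<le> emeasure \<nu> {x..}"
  proof
    assume "of_nat (Suc 0) \<le> emeasure \<nu> {x..}"
    then have "x \<le> nth_point \<nu> 0" unfolding nth_point_def by (intro Sup_upper) simp
    then show False using assms(2) by simp
  qed
  moreover have "emeasure \<nu> {x..} \<in> range of_nat \<union> {\<infinity>}" by (rule assms(1)) simp
  ultimately show ?thesis
  proof (elim UnE)
    assume n: "\<not> of_nat (Suc 0) \<le> emeasure \<nu> {x..}" and "emeasure \<nu> {x..} \<in> range of_nat"
    then obtain m where m: "emeasure \<nu> {x..} = of_nat m" by blast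
    then show ?thesis using n by (cases m) auto
  qed auto
qed

text \<open>If the front were \<open>\<infinity>\<close>, every half-line from n upwards would have
  mass at least 1. These masses are finite, so continuity from above would leave mass at least 1 at
  \<open>\<infinity>\<close>, where a point measure has none.\<close>

lemma proper_state_initial:
  assumes "\<nu> \<in> point_measures" "emeasure \<nu> UNIV \<noteq> 0" "nth_point \<nu> 0 > -\<infinity>"
  shows "proper_state \<nu>"
proof -
  have s: "sets \<nu> = sets borel" "emeasure \<nu> {\<infinity>} = 0" "emeasure \<nu> {0..<\<infinity>} < \<infinity>"
    using assms(1) by (auto simp: point_measures_def)
  have "nth_point \<nu> 0 \<noteq> \<infinity>"
  proof
    assume *: "nth_point \<nu> 0 = \<infinity>"
    have ge: "1 \<le> emeasure \<nu> {ereal (real n)..}" for n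
    proof -
      have "ereal (real n) < nth_point \<nu> 0" using * by simp
      then obtain x where "ereal (real n) < x" "of_nat (Suc 0) \<le> emeasure \<nu> {x..}"
        unfolding nth_point_def less_Sup_iff by blast
      moreover then have "emeasure \<nu> {x..} \<le> emeasure \<nu> {ereal (real n)..}"
        by (intro emeasure_mono) (auto simp: s)
      ultimately show ?thesis by (metis (no_types) of_nat_1 One_nat_def order.trans)
    qed
    have "emeasure \<nu> {0..} = emeasure \<nu> ({0..<\<infinity>} \<union> {\<infinity>})"
      by (rule arg_cong[where f = "emeasure \<nu>"]) (auto simp: less_le)
    also have "\<dots> \<le> emeasure \<nu> {0..<\<infinity>} + emeasure \<nu> {\<infinity>}"
      by (rule emeasure_subadditive) (auto simp: s)
    also have "\<dots> < \<infinity>" using s by simp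
    finally have fin: "emeasure \<nu> {0..} < \<infinity>" .
    have "(INF n. emeasure \<nu> {ereal (real n)..}) = emeasure \<nu> (\<Inter>n. {ereal (real n)..})"
    proof (rule INF_emeasure_decseq)
      show "emeasure \<nu> {ereal (real n)..} \<noteq> \<infinity>" for n
      proof -
        have "emeasure \<nu> {ereal (real n)..} \<le> emeasure \<nu> {0..}"
          by (intro emeasure_mono) (auto simp: s intro: order_trans[of 0 "ereal (real n)"])
        then show ?thesis using fin by auto
      qed
      show "decseq (\<lambda>n. {ereal (real n)..})"
        by (auto simp: decseq_def intro: order_trans[rotated])
    qed (auto simp: s)
    also have "(\<Inter>n. {ereal (real n)..}) = {\<infinity>}"
    proof -
      have "x = \<infinity>" if "\<And>n. ereal (real n) \<le> x" for x
      proof (cases x)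
        case (real r)
        obtain n where "r < real n" using reals_Archimedean2 by blast
        then show ?thesis using that[of n] real by simp
      qed (use that[of 0] in auto)
      then show ?thesis by auto
    qed
    also have "emeasure \<nu> {\<infinity>} = 0" by fact
    finally have "(INF n. emeasure \<nu> {ereal (real n)..}) = 0" .
    moreover have "1 \<le> (INF n. emeasure \<nu> {ereal (real n)..})" by (intro INF_greatest ge)
    ultimately show False by simp
  qed
  then show ?thesis using assms by (auto simp: proper_state_def point_measures_def)
qed

lemma proper_state_indices: "proper_state \<nu> \<Longrightarrow> 0 \<in> indices \<nu>"
  by (auto simp: proper_state_def indices_def zero_less_iff_neq_zero)

lemma max_growth_le:
  assumes "w \<in> driving_sequences" shows "max_growth \<nu> w \<le> nth_point \<nu> 0 + 1"
  unfolding max_growth_def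
  by (intro SUP_least add_mono nth_point_antimono driving_le[OF assms]) simp

lemma max_growth_ge: "0 \<in> indices \<nu> \<Longrightarrow> nth_point \<nu> 0 + w 0 \<le> max_growth \<nu> w"
  unfolding max_growth_def by (rule SUP_upper)

lemma proper_state_growth:
  assumes "proper_state \<nu>" "w \<in> driving_sequences"
  shows "proper_state (growth_map w \<nu>)"
proof -
  let ?m = "max_growth \<nu> w" and ?\<nu> = "growth_map w \<nu>"
  have s: "sets \<nu> = sets borel" "\<And>A. A \<in> sets borel \<Longrightarrow> emeasure \<nu> A \<in> range of_nat \<union> {\<infinity>}"
    "emeasure \<nu> UNIV \<noteq> 0" "\<bar>nth_point \<nu> 0\<bar> \<noteq> \<infinity>"
    using assms by (auto simp: proper_state_def)
  have e: "emeasure ?\<nu> A = emeasure \<nu> A + indicator A ?m" if "A \<in> sets borel" for A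
    unfolding growth_map_def by (rule emeasure_add_dirac[OF s(1) that])
  have int: "emeasure ?\<nu> A \<in> range of_nat \<union> {\<infinity>}" if "A \<in> sets borel" for A
  proof -
    have "x + indicator A ?m \<in> range of_nat \<union> {\<infinity>}" if x: "x \<in> range of_nat \<union> {\<infinity>}" for x :: ennreal
    proof (cases "x = \<infinity>")
      case False
      then obtain k where "x = of_nat k" using x by blast
      then have "x + indicator A ?m = of_nat (if ?m \<in> A then Suc k else k)"
        by (auto simp: indicator_def add.commute)
      then show ?thesis by blast
    qed simp
    then show ?thesis unfolding e[OF that] using s(2)[OF that] by blast
  qed
  have "nth_point \<nu> 0 \<le> nth_point ?\<nu> 0"
    unfolding nth_point_def
  proof (rule Sup_subset_mono, safe)
    fix x assume "of_nat (Suc 0) \<le> emeasure \<nu> {x..}"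
    also have "\<dots> \<le> emeasure ?\<nu> {x..}" by (subst e) auto
    finally show "of_nat (Suc 0) \<le> emeasure ?\<nu> {x..}" .
  qed
  moreover have "nth_point ?\<nu> 0 \<le> max (nth_point \<nu> 0) ?m"
  proof (subst nth_point_def, rule Sup_least, rule ccontr)
    fix x assume x: "x \<in> {x. of_nat (Suc 0) \<le> emeasure ?\<nu> {x..}}" "\<not> x \<le> max (nth_point \<nu> 0) ?m"
    then have "nth_point \<nu> 0 < x" "\<not> x \<le> ?m" by (simp_all add: le_max_iff_disj not_le)
    then have "emeasure ?\<nu> {x..} = 0"
      by (subst e) (auto simp: nth_point_0_above[OF s(2)])
    then show False using x by simp
  qed
  moreover have "?m < \<infinity>"
    using max_growth_le[OF assms(2), of \<nu>] s(4) by (cases "nth_point \<nu> 0") (auto simp: one_ereal_def)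
  ultimately have "\<bar>nth_point ?\<nu> 0\<bar> \<noteq> \<infinity>" using s(4)
    by (cases "nth_point ?\<nu> 0"; cases "nth_point \<nu> 0"; cases ?m) (auto simp: max_def split: if_splits)
  moreover have "emeasure ?\<nu> UNIV \<noteq> 0" using s(3) by (subst e) auto
  ultimately show ?thesis using int by (simp add: proper_state_def growth_map_def)
qed

lemma is_MGS_driving: "is_MGS T z \<nu> \<Longrightarrow> T < t \<Longrightarrow> z t \<in> driving_sequences"
  by (simp add: is_MGS_def)

lemma is_MGS_step: "is_MGS T z \<nu> \<Longrightarrow> T < t \<Longrightarrow> \<nu> t = add_dirac (\<nu> (t - 1)) (max_growth (\<nu> (t - 1)) (z t))"
  by (simp add: is_MGS_def growth_map_def)

lemma is_MGS_proper:
  assumes "is_MGS T z \<nu>" "T \<le> t" shows "proper_state (\<nu> t)"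
  using assms(2)
proof (induction t rule: int_ge_induct)
  case base
  then show ?case using assms(1) by (auto simp: is_MGS_def intro: proper_state_initial)
next
  case (step t)
  then have "z (t + 1) \<in> driving_sequences" "\<nu> (t + 1) = growth_map (z (t + 1)) (\<nu> t)"
    using assms(1) unfolding is_MGS_def by (auto dest!: spec[of _ "t + 1"])
  then show ?case using proper_state_growth[OF step.IH] by simp
qed

text \<open>A real translation keeps the ranking and commutes with the maximum. Hence the points
  added after a renovation move like \<open>pos\<close>, up to the location of the first of
  them.\<close>

lemma new_point_shift:
  assumes "0 < n"
  shows "new_point (\<lambda>i. ereal r + p i) n v = ereal r + new_point p n v"
proof -
  have "ranking (\<lambda>i. ereal r + p i) n = ranking p n"
    by (rule ranking_cong_order) (auto simp: ereal_add_le_add_iff)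
  then have "new_point (\<lambda>i. ereal r + p i) n v
      = Max ((\<lambda>a. ereal r + a) ` (\<lambda>k. p (ranking p n ! k) + v k) ` {..<n})"
    unfolding new_point_def by (simp add: image_image add.assoc)
  also have "\<dots> = ereal r + new_point p n v"
    unfolding new_point_def using assms
    by (intro mono_Max_commute[symmetric]) (auto simp: mono_def intro: add_left_mono)
  finally show ?thesis .
qed

lemma pos_le:
  assumes "\<And>m. 0 < m \<Longrightarrow> x m \<in> driving_sequences"
  shows "pos x n \<le> ereal (real n)"
proof (induction n rule: less_induct)
  case (less n)
  show ?case
  proof (cases "n = 0")
    case False
    then obtain m where n: "n = Suc m" by (cases n) auto
    have "pos x n \<le> ereal (real m) + 1"
      unfolding pos_rec[OF False[unfolded neq0_conv]] new_point_def
    proof (rule Max.boundedI)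
      fix a assume "a \<in> (\<lambda>k. pos x (ranking (pos x) n ! k) + x n k) ` {..<n}"
      then obtain k where k: "k < n" "a = pos x (ranking (pos x) n ! k) + x n k" by auto
      have r: "ranking (pos x) n ! k < n" by (rule ranking_less) (rule k)
      have "pos x (ranking (pos x) n ! k) \<le> ereal (real (ranking (pos x) n ! k))" by (rule less.IH[OF r])
      also have "\<dots> \<le> ereal (real m)" using r n by simp
      finally show "a \<le> ereal (real m) + 1" unfolding k(2)
        using driving_le[OF assms] False by (intro add_mono) auto
    qed (use False in auto)
    then show ?thesis by (simp add: n one_ereal_def add.commute)
  qed simp
qed

lemma Max_pos_ge: "0 < n \<Longrightarrow> 0 \<le> Max (pos x ` {..<n})"
  by (rule Max_ge) (auto intro!: image_eqI[of _ _ 0])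

text \<open>Single positions may be \<open>-\<infinity>\<close>, but the initial point at 0 always
  competes for the maximum, and \<open>pos_le\<close> bounds it above. Subtracting the front is
  therefore harmless.\<close>

lemma Max_pos_finite:
  assumes "\<And>m. 0 < m \<Longrightarrow> x m \<in> driving_sequences" "0 < n"
  shows "\<bar>Max (pos x ` {..<n})\<bar> \<noteq> \<infinity>"
proof -
  have "Max (pos x ` {..<n}) \<in> pos x ` {..<n}" using assms(2) by (intro Max_in) auto
  then obtain i where "Max (pos x ` {..<n}) = pos x i" by blast
  then show ?thesis using pos_le[of x i, OF assms(1)] Max_pos_ge[OF assms(2), of x] by (cases "pos x i") auto
qed

text \<open>The renovation event: with \<open>x n = w (t + 1 + n)\<close>, the point added at time \<open>t + 1\<close> is by
  more than \<open>1/2\<close> above all previous ones, and each later point is by more than \<open>1/2\<close>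
  above that one, hence out of reach of the points present at time \<open>t\<close>.\<close>
definition renovation :: "(nat \<Rightarrow> nat \<Rightarrow> ereal) \<Rightarrow> bool" where
  "renovation x \<longleftrightarrow> (\<forall>n. \<exists>k < max 1 n. ereal (1/2) < x n k)"

text \<open>At step n exactly n points are present, and by induction all have height at least 0. The
  good mark has index k < n, so it is added to one of them. The \<open>max 1 n\<close> in
  \<open>renovation\<close> matters at n = 0, where the first mark is added to the old
  front.\<close>

lemma renovation_pos:
  assumes "renovation x"
  shows "0 < n \<Longrightarrow> ereal (1/2) < pos x n"
proof (induction n rule: less_induct)
  case (less n)
  obtain k where k: "k < max 1 n" "ereal (1/2) < x n k" using assms unfolding renovation_def by blast
  then have kn: "k < n" using less.prems by simp
  let ?j = "ranking (pos x) n ! k"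
  have "0 \<le> pos x ?j"
    using less.IH[of ?j] ranking_less[OF kn, of "pos x"] by (cases "?j = 0"; cases "pos x ?j") auto
  then have "ereal (1/2) < pos x ?j + x n k"
    using k(2) by (cases "pos x ?j"; cases "x n k") auto
  also have "\<dots> \<le> new_point (pos x) n (x n)"
    unfolding new_point_def using kn by (intro Max_ge) auto
  finally show ?case using less.prems by (simp add: pos_rec)
qed

text \<open>Old points reach at most \<open>X0 + 1\<close>, which every new point exceeds. The old
  state thus survives only in the additive constant \<open>X1\<close>, and shifting the front to 0
  cancels it.\<close>

lemma MGS_after_renovation:
  assumes mgs: "is_MGS T z \<nu>" and t: "T \<le> t" and ren: "renovation (\<lambda>m. z (t + 1 + int m))" and "0 < n"
  shows "max_growth (shift_top (\<nu> (t + int n))) (z (t + 1 + int n)) = incr (\<lambda>m. z (t + 1 + int m)) n"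
proof -
  let ?x = "\<lambda>m. z (t + 1 + int m)"
  have dr: "?x m \<in> driving_sequences" for m using is_MGS_driving[OF mgs] t by simp
  have pr: "proper_state (\<nu> (t + int n))" for n using is_MGS_proper[OF mgs] t by simp
  let ?X0 = "nth_point (\<nu> t) 0" and ?X1 = "max_growth (\<nu> t) (z (t + 1))"
  have pt: "proper_state (\<nu> t)" using pr[of 0] by simp
  have w: "ereal (1/2) < z (t + 1) 0" using ren unfolding renovation_def by (auto dest: spec[of _ 0])
  have lo: "?X0 + z (t + 1) 0 \<le> ?X1" by (rule max_growth_ge[OF proper_state_indices[OF pt]])
  have hi: "?X1 \<le> ?X0 + 1" using max_growth_le dr[of 0] by simp
  obtain X0 where X0: "?X0 = ereal X0" using pt by (auto simp: proper_state_def)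
  obtain X1 where X1: "?X1 = ereal X1" using lo hi w X0 by (cases ?X1; cases "z (t + 1) 0") (auto simp: one_ereal_def)
  have X01: "X0 + 1/2 < X1" using lo w X0 X1 by (cases "z (t + 1) 0") auto
  define y where "y i = ereal X1 + pos ?x i" for i
  have step: "\<nu> (t + int (Suc n)) = add_dirac (\<nu> (t + int n)) (max_growth (\<nu> (t + int n)) (?x n))" for n
    using is_MGS_step[OF mgs, of "t + 1 + int n"] t by (simp add: algebra_simps)
  have y_ge: "ereal X0 + 1 \<le> y n" if "0 < n" for n
  proof -
    have "ereal (1/2) < pos ?x n" by (rule renovation_pos[OF ren that])
    then show ?thesis using X01 unfolding y_def by (cases "pos ?x n") (auto simp: one_ereal_def)
  qed
  have y_ge': "ereal X0 \<le> y n" for n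
    using y_ge[of n] X01 by (cases "n = 0"; cases "y n") (auto simp: y_def one_ereal_def)
  \<comment> \<open>The two claims need each other: the description of the state at step n yields
    the next location, and adding that location extends the description. At n = 0 the list is empty,
    since nothing lies above the front \<open>X0\<close>, and the growth is \<open>X1\<close> by
    definition.\<close>
  have main: "tops (\<nu> (t + int n)) (ereal X0) y n \<and> max_growth (\<nu> (t + int n)) (?x n) = y n" for n
  proof (induction n)
    case 0
    have "tops (\<nu> t) (ereal X0) y 0"
      using pt nth_point_0_above[of "\<nu> t"] X0 by (auto simp: tops_def proper_state_def)
    moreover have "y 0 = ereal X1" by (simp add: y_def)
    ultimately show ?case using X1 by simp
  next
    case (Suc n)
    then have tp: "tops (\<nu> (t + int (Suc n))) (ereal X0) y (Suc n)"
      unfolding step using tops_add_dirac[of _ _ y n] y_ge' by simp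
    have np: "new_point y (Suc n) (?x (Suc n)) = y (Suc n)"
      unfolding y_def by (subst new_point_shift) (auto simp: pos_rec[of "Suc n"])
    have "max_growth (\<nu> (t + int (Suc n))) (?x (Suc n)) = new_point y (Suc n) (?x (Suc n))"
      by (rule tops_max_growth[OF tp _ dr]) (use y_ge[of "Suc n"] np in auto)
    with np tp show ?case by simp
  qed
  have "nth_point (\<nu> (t + int n)) 0 = Max (y ` {..<n})"
    using tops_nth_point[OF conjunct1[OF main] \<open>0 < n\<close>] Max_ranking_0[OF \<open>0 < n\<close>, of y] by simp
  also have "y ` {..<n} = (\<lambda>a. ereal X1 + a) ` pos ?x ` {..<n}" by (auto simp: y_def)
  also have "Max \<dots> = ereal X1 + Max (pos ?x ` {..<n})"
    using \<open>0 < n\<close> by (intro mono_Max_commute[symmetric]) (auto simp: mono_def intro: add_left_mono)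
  finally have front: "nth_point (\<nu> (t + int n)) 0 = ereal X1 + Max (pos ?x ` {..<n})" .
  have "max_growth (shift_top (\<nu> (t + int n))) (?x n) = y n - (ereal X1 + Max (pos ?x ` {..<n}))"
    using max_growth_shift_top[of "\<nu> (t + int n)" "?x n"] pr[of n] proper_state_indices[OF pr[of n]] main[of n] front
    by (auto simp: proper_state_def)
  also have "\<dots> = pos ?x n - Max (pos ?x ` {..<n})"
    using Max_pos_finite[of ?x n] dr \<open>0 < n\<close> unfolding y_def
    by (cases "pos ?x n"; cases "Max (pos ?x ` {..<n})") auto
  finally show ?thesis by (simp add: incr_def)
qed

text \<open>Here \<open>tops\<close> is used with level \<open>-\<infinity>\<close>. The total mass
  is tracked as well, so the index set is exactly the set of listed ranks and every point, even one
  at \<open>-\<infinity>\<close>, is accounted for.\<close>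

lemma MGS_from_dirac:
  assumes mgs: "is_MGS T z \<nu>" and init: "\<nu> T = return borel 0" and "0 < n"
  shows "max_growth (shift_top (\<nu> (T + int n - 1))) (z (T + int n)) = incr (\<lambda>m. z (T + int m)) n"
proof -
  let ?x = "\<lambda>m. z (T + int m)"
  have dr: "?x m \<in> driving_sequences" if "0 < m" for m using is_MGS_driving[OF mgs] that by simp
  have pr: "proper_state (\<nu> (T + int n))" for n using is_MGS_proper[OF mgs] by simp
  have step: "\<nu> (T + int (Suc n)) = add_dirac (\<nu> (T + int n)) (max_growth (\<nu> (T + int n)) (?x (Suc n)))" for n
    using is_MGS_step[OF mgs, of "T + int (Suc n)"] by simp
  have main: "tops (\<nu> (T + int n)) (-\<infinity>) (pos ?x) (Suc n) \<and> emeasure (\<nu> (T + int n)) UNIV = of_nat (Suc n) \<and>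
    max_growth (\<nu> (T + int n)) (?x (Suc n)) = pos ?x (Suc n)" for n
  proof (induction n)
    case 0
    have "{..<1} = {0::nat}" by auto
    moreover have "card {i. i < Suc 0 \<and> a \<le> pos ?x i} = (if a \<le> 0 then 1 else 0)" for a
    proof -
      have "{i. i < Suc 0 \<and> a \<le> pos ?x i} = (if a \<le> 0 then {0} else {})" by auto
      then show ?thesis by simp
    qed
    ultimately have tp: "tops (\<nu> T) (-\<infinity>) (pos ?x) (Suc 0)"
      unfolding tops_def init by (auto simp: indicator_def)
    have u: "emeasure (\<nu> T) UNIV = 1" by (simp add: init)
    then have u': "emeasure (\<nu> T) UNIV = of_nat (Suc 0)" by simp
    then have "indices (\<nu> T) = {..<Suc 0}" unfolding indices_def by (simp only: of_nat_less_iff) auto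
    then have "max_growth (\<nu> T) (?x 1) = new_point (pos ?x) (Suc 0) (?x 1)"
      by (intro tops_max_growth[OF tp _ dr]) auto
    then show ?case using tp u by (simp add: pos_rec[of "Suc 0"])
  next
    case (Suc n)
    then have tp: "tops (\<nu> (T + int (Suc n))) (-\<infinity>) (pos ?x) (Suc (Suc n))"
      unfolding step using tops_add_dirac[of _ "-\<infinity>" "pos ?x" "Suc n"] by simp
    have "sets (\<nu> (T + int n)) = sets borel" using pr[of n] by (simp add: proper_state_def)
    then have u: "emeasure (\<nu> (T + int (Suc n))) UNIV = of_nat (Suc (Suc n))"
      unfolding step using Suc by (subst emeasure_add_dirac) (auto simp: add.commute)
    then have "indices (\<nu> (T + int (Suc n))) = {..<Suc (Suc n)}"
      by (auto simp: indices_def simp del: of_nat_Suc)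
    then have "max_growth (\<nu> (T + int (Suc n))) (?x (Suc (Suc n))) = new_point (pos ?x) (Suc (Suc n)) (?x (Suc (Suc n)))"
      by (intro tops_max_growth[OF tp _ dr]) auto
    then show ?case using tp u by (simp add: pos_rec[of "Suc (Suc n)"])
  qed
  obtain m where n: "n = Suc m" using \<open>0 < n\<close> by (cases n) auto
  have "nth_point (\<nu> (T + int m)) 0 = Max (pos ?x ` {..<n})"
    using tops_nth_point[OF conjunct1[OF main[of m]], of 0] Max_ranking_0[OF \<open>0 < n\<close>, of "pos ?x"] n by simp
  then have "max_growth (shift_top (\<nu> (T + int m))) (?x n) = incr ?x n"
    using max_growth_shift_top[of "\<nu> (T + int m)" "?x n"] pr[of m] proper_state_indices[OF pr[of m]] main[of m] n
    by (auto simp: proper_state_def incr_def)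
  then show ?thesis by (simp add: n)
qed

text \<open>Realizes \<open>pos\<close> by an actual system, to which
  \<open>MGS_after_renovation\<close> can then be applied.\<close>

lemma MGS_from_dirac_exists:
  assumes "\<And>t. T < t \<Longrightarrow> z t \<in> driving_sequences"
  obtains \<nu> where "is_MGS T z \<nu>" "\<nu> T = return borel 0"
proof -
  define a where "a = rec_nat (return borel (0::ereal)) (\<lambda>n \<mu>. growth_map (z (T + int (Suc n))) \<mu>)"
  define \<nu> where "\<nu> t = a (nat (t - T))" for t
  have init: "\<nu> T = return borel 0" by (simp add: \<nu>_def a_def)
  have "indicator A (0::ereal) \<in> range of_nat \<union> {\<infinity>::ennreal}" for A
    by (auto simp: indicator_def intro: range_eqI[of _ _ 0] range_eqI[of _ _ 1])
  then have pm: "return borel (0::ereal) \<in> point_measures"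
    by (auto simp: point_measures_def indicator_def)
  have "nth_point (return borel (0::ereal)) 0 \<ge> 0"
    unfolding nth_point_def by (intro Sup_upper) simp
  then have "nth_point (return borel (0::ereal)) 0 > -\<infinity>" by auto
  moreover have "\<nu> t = growth_map (z t) (\<nu> (t - 1))" if "T < t" for t
  proof -
    have a_Suc: "a (Suc n) = growth_map (z (T + int (Suc n))) (a n)" for n by (simp add: a_def)
    have "nat (t - T) = Suc (nat (t - 1 - T))" and "T + int (Suc (nat (t - 1 - T))) = t"
      using that by simp_all
    then show ?thesis unfolding \<nu>_def by (simp only: a_Suc)
  qed
  ultimately have "is_MGS T z \<nu>" using pm assms by (simp add: is_MGS_def init)
  then show ?thesis using init by (rule that)
qed

text \<open>Both sides are the growth of one and the same system at time \<open>s\<close>: once seen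
  from its start in a single point at time \<open>T\<close>, once from the renovation at
  \<open>t + 1\<close>.\<close>

lemma incr_after_renovation:
  assumes dr: "\<And>s. T < s \<Longrightarrow> z s \<in> driving_sequences"
    and "T \<le> t" "renovation (\<lambda>m. z (t + 1 + int m))" "t + 1 < s"
  shows "incr (\<lambda>m. z (T + int m)) (nat (s - T)) = incr (\<lambda>m. z (t + 1 + int m)) (nat (s - (t + 1)))"
proof -
  obtain \<nu> where \<nu>: "is_MGS T z \<nu>" "\<nu> T = return borel 0" by (rule MGS_from_dirac_exists[OF dr])
  show ?thesis
    using MGS_from_dirac[OF \<nu>, of "nat (s - T)"] MGS_after_renovation[OF \<nu>(1) assms(2,3), of "nat (s - (t + 1))"] assms(2,4)
    by (simp add: algebra_simps)
qed

section \<open>Measurability and the zero-one law for shifts\<close>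

lemma measurable_insort_key:
  assumes "\<And>b. b \<in> insert a (set ys) \<Longrightarrow> (\<lambda>\<omega>. y \<omega> b :: ereal) \<in> borel_measurable N"
  shows "(\<lambda>\<omega>. insort_key (y \<omega>) a ys) \<in> measurable N (count_space UNIV)"
  using assms
proof (induction ys)
  case (Cons b ys)
  have [measurable]: "(\<lambda>\<omega>. y \<omega> a) \<in> borel_measurable N" "(\<lambda>\<omega>. y \<omega> b) \<in> borel_measurable N"
    "(\<lambda>\<omega>. insort_key (y \<omega>) a ys) \<in> measurable N (count_space UNIV)"
    using Cons by auto
  have "(\<lambda>\<omega>. if y \<omega> a \<le> y \<omega> b then a # b # ys else b # insort_key (y \<omega>) a ys) \<in> measurable N (count_space UNIV)"
    by (intro measurable_If measurable_compose[where g = "(#) b" and f = "\<lambda>\<omega>. insort_key (y \<omega>) a ys"]) measurable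
  then show ?case by simp
qed simp

lemma measurable_ranking:
  assumes "\<And>i. i < n \<Longrightarrow> (\<lambda>\<omega>. y \<omega> i :: ereal) \<in> borel_measurable N"
  shows "(\<lambda>\<omega>. ranking (y \<omega>) n) \<in> measurable N (count_space UNIV)"
proof -
  have "(\<lambda>\<omega>. sort_key (y \<omega>) xs) \<in> measurable N (count_space UNIV)" if "set xs \<subseteq> {..<n}" for xs
    using that
  proof (induction xs)
    case (Cons a xs)
    \<comment> \<open>Composition over countably many values asks for measurability for every list
      \<open>ys\<close>, while \<open>y\<close> is controlled only below \<open>n\<close>. The guard
      supplies it and always holds for the lists that actually occur.\<close>
    have "(\<lambda>\<omega>. if set ys \<subseteq> {..<n} then insort_key (y \<omega>) a ys else []) \<in> measurable N (count_space UNIV)" for ys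
      using assms Cons.prems by (cases "set ys \<subseteq> {..<n}") (auto intro!: measurable_insort_key)
    moreover have "(\<lambda>\<omega>. sort_key (y \<omega>) xs) \<in> measurable N (count_space UNIV)"
      using Cons by simp
    ultimately have "(\<lambda>\<omega>. if set (sort_key (y \<omega>) xs) \<subseteq> {..<n} then insort_key (y \<omega>) a (sort_key (y \<omega>) xs) else [])
        \<in> measurable N (count_space UNIV)"
      by (rule measurable_compose_countable)
    then show ?case using Cons.prems by simp
  qed simp
  from this[of "[0..<n]"] have "(\<lambda>\<omega>. sort_key (y \<omega>) [0..<n]) \<in> measurable N (count_space UNIV)"
    by (simp add: atLeast0LessThan)
  then show ?thesis unfolding ranking_def by (rule measurable_compose) simp
qed

lemma borel_measurable_new_point:
  assumes y: "\<And>i. i < n \<Longrightarrow> (\<lambda>\<omega>. y \<omega> i) \<in> borel_measurable N"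
    and v: "\<And>k. (\<lambda>\<omega>. v \<omega> k) \<in> borel_measurable N"
  shows "(\<lambda>\<omega>. new_point (y \<omega>) n (v \<omega>)) \<in> borel_measurable N"
proof -
  have "(\<lambda>\<omega>. y \<omega> (ranking (y \<omega>) n ! k)) \<in> borel_measurable N" if "k < n" for k
  proof -
    have "(\<lambda>\<omega>. if i < n then y \<omega> i else 0) \<in> borel_measurable N" for i
      using y by (cases "i < n") auto
    moreover have "(\<lambda>\<omega>. ranking (y \<omega>) n ! k) \<in> measurable N (count_space UNIV)"
      by (rule measurable_compose[OF measurable_ranking[OF y]]) auto
    ultimately have "(\<lambda>\<omega>. if ranking (y \<omega>) n ! k < n then y \<omega> (ranking (y \<omega>) n ! k) else 0) \<in> borel_measurable N"
      by (rule measurable_compose_countable)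
    then show ?thesis using that by (simp add: ranking_less)
  qed
  then show ?thesis unfolding new_point_def using v by (intro borel_measurable_Max) auto
qed

abbreviation driving_space :: "(nat \<Rightarrow> nat \<Rightarrow> ereal) measure" where
  "driving_space \<equiv> \<Pi>\<^sub>M n\<in>UNIV. seq_space"

lemma measurable_driving_component: "(\<lambda>x. x m k) \<in> borel_measurable driving_space"
  by (rule measurable_compose[where f = "\<lambda>x. x m" and N = seq_space and g = "\<lambda>v. v k"]) auto

lemma borel_measurable_pos [measurable]: "(\<lambda>x. pos x n) \<in> borel_measurable driving_space"
proof (induction n rule: less_induct)
  case (less n)
  show ?case
  proof (cases "n = 0")
    case False
    have "(\<lambda>x. new_point (pos x) n (x n)) \<in> borel_measurable driving_space"
      by (intro borel_measurable_new_point less measurable_driving_component)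
    then show ?thesis using False by (simp add: pos_rec)
  qed simp
qed

lemma borel_measurable_Max_pos [measurable]:
  "(\<lambda>x. Max (pos x ` {..<n})) \<in> borel_measurable driving_space"
  by (rule borel_measurable_Max) auto

lemma borel_measurable_incr [measurable]: "(\<lambda>x. incr x n) \<in> borel_measurable driving_space"
  unfolding incr_def by measurable

lemma measurable_renovation [measurable]: "Measurable.pred driving_space renovation"
proof -
  note measurable_driving_component[measurable]
  have "Measurable.pred driving_space (\<lambda>x. \<forall>n. \<exists>k\<in>{..<max 1 n}. ereal (1/2) < x n k)"
    by measurable
  then show ?thesis unfolding renovation_def[abs_def] by (simp add: Bex_def)
qed

text \<open>The Weierstrass product inequality; it keeps the tail of the product in the renovation
  probability away from 0.\<close>

lemma one_minus_sum_le_prod: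
  fixes a :: "'i \<Rightarrow> real"
  assumes "finite S" "\<And>i. i \<in> S \<Longrightarrow> 0 \<le> a i \<and> a i \<le> 1"
  shows "1 - sum a S \<le> (\<Prod>i\<in>S. 1 - a i)"
  using assms
proof (induction S rule: finite_induct)
  case (insert i S)
  have "(\<Prod>i\<in>S. 1 - a i) \<le> 1" using insert.prems by (intro prod_le_1) auto
  then have "a i * (\<Prod>i\<in>S. 1 - a i) \<le> a i" using insert.prems by (simp add: mult_left_le)
  then show ?case using insert by (simp add: algebra_simps)
qed simp

lemma measure_PiM_Collect:
  assumes "prob_space Q" "finite J" "\<And>i. i \<in> J \<Longrightarrow> X i \<in> sets Q"
  shows "measure (PiM UNIV (\<lambda>_. Q)) {x \<in> space (PiM UNIV (\<lambda>_. Q)). \<forall>i\<in>J. x i \<in> X i} = (\<Prod>i\<in>J. measure Q (X i))"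
proof -
  interpret Q: prob_space Q by fact
  interpret P: product_prob_space "\<lambda>_. Q" UNIV ..
  have "emeasure (PiM UNIV (\<lambda>_. Q)) {x \<in> space (PiM UNIV (\<lambda>_. Q)). \<forall>i\<in>J. x i \<in> X i} = (\<Prod>i\<in>J. emeasure Q (X i))"
    by (rule P.emeasure_PiM_Collect) (use assms in auto)
  then show ?thesis
    by (simp add: P.emeasure_eq_measure Q.emeasure_eq_measure prod_ennreal prod_nonneg)
qed

text \<open>Infinitely many visits to \<open>D\<close> are a tail event, so Kolmogorov's law leaves
  probability 0 or 1. By shift invariance a visit after time n has probability at least that of
  \<open>D\<close>, and this bound passes to the decreasing limit, which excludes 0.\<close>

lemma sequence_zero_one:
  assumes Q: "prob_space Q" and D: "D \<in> sets (PiM (UNIV :: nat set) (\<lambda>_. Q))"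
    and pos: "0 < measure (PiM (UNIV :: nat set) (\<lambda>_. Q)) D"
  shows "AE x in PiM UNIV (\<lambda>_. Q). \<exists>\<^sub>\<infinity>n. (\<lambda>m. x (n + m)) \<in> D"
proof -
  define P where "P = PiM (UNIV :: nat set) (\<lambda>_. Q)"
  interpret Q: prob_space Q by fact
  interpret PP: product_prob_space "\<lambda>_. Q" UNIV ..
  interpret P: prob_space P unfolding P_def by (rule prob_space_PiM) (rule Q)
  have sh[measurable]: "(\<lambda>x m. x (n + m)) \<in> measurable P P" for n
    unfolding P_def by (rule measurable_PiM_single') (auto simp: space_PiM)
  have [measurable]: "D \<in> sets P" using D by (simp add: P_def)
  have dist: "distr P P (\<lambda>x m. x (n + m)) = P" for n
    using distr_PiM_reindex[of UNIV "\<lambda>_. Q" "\<lambda>m. n + m" UNIV] Q by (simp add: P_def restrict_UNIV inj_on_def)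
  define E where "E = {x \<in> space P. \<exists>\<^sub>\<infinity>n. (\<lambda>m. x (n + m)) \<in> D}"
  have E[measurable]: "E \<in> sets P" unfolding E_def INFM_nat_le by measurable
  define A where "A i = {(\<lambda>x. x i) -` B \<inter> space P | B. B \<in> sets Q}" for i :: nat
  have comp: "(\<lambda>x. x i) \<in> measurable P Q" for i unfolding P_def by simp
  have A_sets: "A i = sets (vimage_algebra (space P) (\<lambda>x. x i) Q)" for i
    unfolding A_def using measurable_space[OF comp[of i]] by (subst sets_vimage_algebra2) auto
  have sub: "A i \<subseteq> Pow (space P)" for i by (auto simp: A_def)
  have "P.indep_vars (\<lambda>_. Q) (\<lambda>i x. x i) UNIV"
  proof (subst P.indep_vars_iff_distr_eq_PiM)
    have "distr P (PiM UNIV (\<lambda>_. Q)) (\<lambda>x. restrict x UNIV) = P"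
      by (simp add: P_def restrict_UNIV distr_id)
    also have "P = (\<Pi>\<^sub>M i\<in>UNIV. distr P Q (\<lambda>x. x i))"
      by (simp add: P_def PP.PiM_component)
    finally show "distr P (PiM UNIV (\<lambda>_. Q)) (\<lambda>x. \<lambda>i\<in>UNIV. x i) = (\<Pi>\<^sub>M i\<in>UNIV. distr P Q (\<lambda>x. x i))" .
  qed (auto intro: comp)
  then have ind: "P.indep_sets A UNIV"
    unfolding P.indep_vars_def2 A_def by simp
  have "P.prob E = 0 \<or> P.prob E = 1"
  proof (rule P.kolmogorov_0_1_law[OF _ ind])
    show "sigma_algebra (space P) (A i)" for i
      unfolding A_sets using sets.sigma_algebra_axioms[of "vimage_algebra (space P) (\<lambda>x. x i) Q"] by simp
    show "E \<in> P.tail_events A"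
      unfolding P.tail_events_def
    proof
      fix n :: nat
      \<comment> \<open>The event is its own preimage under the shift by \<open>n\<close>, and that
        shift is measurable for the coordinates from \<open>n\<close> on.\<close>
      let ?N = "sigma (space P) (\<Union> (A ` {n..}))"
      have sN: "sets ?N = sigma_sets (space P) (\<Union> (A ` {n..}))"
        using sub by (intro sets_measure_of) blast
      have spN: "space ?N = space P"
        using sub by (intro space_measure_of) blast
      have memb: "x i \<in> space Q" if "x \<in> space ?N" for x i
        using that unfolding spN by (auto simp: P_def space_PiM)
      have "(\<lambda>x m. x (n + m)) \<in> measurable ?N (PiM UNIV (\<lambda>_. Q))"
      proof (rule measurable_PiM_single')
        fix m :: nat
        show "(\<lambda>x. x (n + m)) \<in> measurable ?N Q"
        proof (rule measurableI)
          fix B assume B: "B \<in> sets Q"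
          have "(\<lambda>x. x (n + m)) -` B \<inter> space P \<in> A (n + m)" using B by (auto simp: A_def)
          then have "(\<lambda>x. x (n + m)) -` B \<inter> space P \<in> sigma_sets (space P) (\<Union> (A ` {n..}))"
            by (intro sigma_sets.Basic) auto
          then show "(\<lambda>x. x (n + m)) -` B \<inter> space ?N \<in> sets ?N"
            unfolding sN spN .
        qed (rule memb)
      qed (use memb in \<open>auto simp: space_PiM\<close>)
      then have "(\<lambda>x m. x (n + m)) \<in> measurable ?N P" by (simp only: P_def)
      then have "(\<lambda>x m. x (n + m)) -` E \<inter> space ?N \<in> sets ?N" by (rule measurable_sets) (rule E)
      also have "(\<lambda>x m. x (n + m)) -` E \<inter> space ?N = E"
      proof -
        have "(\<exists>\<^sub>\<infinity>k. (\<lambda>m. x (n + (k + m))) \<in> D) \<longleftrightarrow> (\<exists>\<^sub>\<infinity>k. (\<lambda>m. x (k + m)) \<in> D)" for x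
        proof -
          let ?R = "\<lambda>k. (\<lambda>m. x (k + m)) \<in> D"
          have "(\<exists>\<^sub>\<infinity>k. ?R (n + k)) \<longleftrightarrow> (\<exists>\<^sub>\<infinity>k. ?R k)"
            unfolding INFM_nat_le
          proof (intro iffI allI)
            fix m assume "\<forall>m. \<exists>k\<ge>m. ?R (n + k)"
            then obtain k where "m \<le> k" "?R (n + k)" by blast
            then show "\<exists>k\<ge>m. ?R k" by (intro exI[of _ "n + k"]) auto
          next
            fix m assume "\<forall>m. \<exists>k\<ge>m. ?R k"
            then obtain k where "n + m \<le> k" "?R k" by blast
            then show "\<exists>k\<ge>m. ?R (n + k)" by (intro exI[of _ "k - n"]) auto
          qed
          then show ?thesis by (simp add: add.assoc)
        qed
        moreover have "(\<lambda>m. x (n + m)) \<in> space P" if "x \<in> space P" for x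
          using measurable_space[OF sh that] .
        ultimately show ?thesis unfolding E_def spN by auto
      qed
      finally show "E \<in> sigma_sets (space P) (\<Union> (A ` {n..}))" unfolding sN .
    qed
  qed
  moreover have "P.prob D \<le> P.prob E"
  proof (rule LIMSEQ_le_const)
    let ?U = "\<lambda>n. {x \<in> space P. \<exists>k\<ge>n. (\<lambda>m. x (k + m)) \<in> D}"
    have "(\<Inter>n. ?U n) = E" unfolding E_def INFM_nat_le by auto
    moreover have "(\<lambda>n. P.prob (?U n)) \<longlonglongrightarrow> P.prob (\<Inter>n. ?U n)"
    proof (rule P.finite_Lim_measure_decseq)
      show "decseq ?U" unfolding decseq_def by (blast intro: order_trans)
    qed auto
    ultimately show "(\<lambda>n. P.prob (?U n)) \<longlonglongrightarrow> P.prob E" by simp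
    have "P.prob D \<le> P.prob (?U n)" for n
    proof -
      have "P.prob D = measure (distr P P (\<lambda>x m. x (n + m))) D" by (simp add: dist)
      also have "\<dots> = P.prob ((\<lambda>x m. x (n + m)) -` D \<inter> space P)" by (rule measure_distr) auto
      also have "\<dots> \<le> P.prob (?U n)" by (rule P.finite_measure_mono) auto
      finally show ?thesis .
    qed
    then show "\<exists>N. \<forall>n\<ge>N. P.prob D \<le> P.prob (?U n)" by blast
  qed
  ultimately have "P.prob E = 1" using pos by (simp add: P_def[symmetric])
  then have "AE x in P. x \<in> E" by (subst P.AE_in_set_eq_1) auto
  then show ?thesis unfolding P_def[symmetric] E_def by auto
qed

section \<open>The stationary increments\<close>

text \<open>The front after step n, taken in the reals so that averages can be formed;
  \<open>ereal_max_pos\<close> justifies the conversion for admissible driving sequences.\<close>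

definition max_pos :: "(nat \<Rightarrow> nat \<Rightarrow> ereal) \<Rightarrow> nat \<Rightarrow> real" where
  "max_pos x n = real_of_ereal (Max (pos x ` {..n}))"

lemma borel_measurable_max_pos [measurable]: "(\<lambda>x. max_pos x n) \<in> borel_measurable driving_space"
proof -
  have "(\<lambda>x. real_of_ereal (Max (pos x ` {..<Suc n}))) \<in> borel_measurable driving_space"
    by measurable
  then show ?thesis by (simp add: max_pos_def lessThan_Suc_atMost)
qed

lemma max_pos_0 [simp]: "max_pos x 0 = 0"
  by (simp add: max_pos_def)

lemma ereal_max_pos:
  assumes "\<And>m. 0 < m \<Longrightarrow> x m \<in> driving_sequences"
  shows "ereal (max_pos x n) = Max (pos x ` {..n})"
  using Max_pos_finite[of x "Suc n"] assms unfolding max_pos_def lessThan_Suc_atMost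
  by (simp add: ereal_real)

lemma pos_le_max_pos:
  assumes "\<And>m. 0 < m \<Longrightarrow> x m \<in> driving_sequences" "i \<le> n"
  shows "pos x i \<le> ereal (max_pos x n)"
  using assms(2) by (auto simp: ereal_max_pos[of x, OF assms(1)])

lemma pos_Suc_le:
  assumes "\<And>m. 0 < m \<Longrightarrow> x m \<in> driving_sequences"
  shows "pos x (Suc n) \<le> ereal (max_pos x n) + 1"
proof -
  have "new_point (pos x) (Suc n) (x (Suc n)) \<le> ereal (max_pos x n) + 1"
    unfolding new_point_def
  proof (rule Max.boundedI)
    fix a assume "a \<in> (\<lambda>k. pos x (ranking (pos x) (Suc n) ! k) + x (Suc n) k) ` {..<Suc n}"
    then obtain k where k: "k < Suc n" "a = pos x (ranking (pos x) (Suc n) ! k) + x (Suc n) k" by auto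
    have "ranking (pos x) (Suc n) ! k \<le> n" using ranking_less[OF k(1), of "pos x"] by simp
    then show "a \<le> ereal (max_pos x n) + 1"
      unfolding k(2) using driving_le[OF assms, of "Suc n" k] by (intro add_mono pos_le_max_pos[of x, OF assms]) auto
  qed auto
  then show ?thesis by (simp add: pos_rec)
qed

lemma incr_eq:
  assumes "\<And>m. 0 < m \<Longrightarrow> x m \<in> driving_sequences"
  shows "incr x (Suc n) = pos x (Suc n) - ereal (max_pos x n)"
  by (simp add: incr_def ereal_max_pos[of x, OF assms] lessThan_Suc_atMost)

lemma incr_le:
  assumes "\<And>m. 0 < m \<Longrightarrow> x m \<in> driving_sequences"
  shows "incr x (Suc n) \<le> 1"
proof -
  have "pos x (Suc n) \<le> ereal (max_pos x n) + 1" by (rule pos_Suc_le) (rule assms)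
  moreover have "incr x (Suc n) = pos x (Suc n) - ereal (max_pos x n)" by (rule incr_eq) (rule assms)
  ultimately show ?thesis by (cases "pos x (Suc n)") (auto simp: one_ereal_def)
qed

text \<open>The front moves only if the new point overtakes it, and then by exactly the increment.
  This is where the positive part in the final expectation comes from.\<close>

lemma max_pos_Suc:
  assumes "\<And>m. 0 < m \<Longrightarrow> x m \<in> driving_sequences"
  shows "max_pos x (Suc n) = max_pos x n + real_of_ereal (max (incr x (Suc n)) 0)"
proof -
  have "ereal (max_pos x (Suc n)) = max (pos x (Suc n)) (ereal (max_pos x n))"
    by (simp add: ereal_max_pos[of x, OF assms] atMost_Suc)
  moreover have "incr x (Suc n) = pos x (Suc n) - ereal (max_pos x n)" by (rule incr_eq) (rule assms)
  ultimately show ?thesis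
    by (cases "pos x (Suc n)") (auto simp: max_def split: if_splits)
qed

abbreviation (input) time_shift :: "int \<Rightarrow> (int \<Rightarrow> nat \<Rightarrow> ereal) \<Rightarrow> int \<Rightarrow> nat \<Rightarrow> ereal" where
  "time_shift s z \<equiv> \<lambda>t. z (t + s)"

abbreviation (input) future :: "int \<Rightarrow> (int \<Rightarrow> nat \<Rightarrow> ereal) \<Rightarrow> nat \<Rightarrow> nat \<Rightarrow> ereal" where
  "future u z \<equiv> \<lambda>m. z (u + int m)"

abbreviation bi_driving_space :: "(int \<Rightarrow> nat \<Rightarrow> ereal) measure" where
  "bi_driving_space \<equiv> \<Pi>\<^sub>M t\<in>UNIV. seq_space"

lemma measurable_future [measurable]: "future u \<in> measurable bi_driving_space driving_space"
  by (rule measurable_PiM_single') (auto simp: space_PiM)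

lemma measurable_shift [measurable]: "time_shift s \<in> measurable bi_driving_space bi_driving_space"
  by (rule measurable_PiM_single') (auto simp: space_PiM)

text \<open>A renovation at time \<open>u\<close> determines the growth only at times after
  \<open>u\<close>, so counting backwards begins at time -1, and time 0 is step \<open>j + 1\<close>
  seen from -(j + 1). Taking the least \<open>j\<close> is a measurable choice;
  \<open>stat_growth_eq\<close> shows that other choices give the same value.\<close>

definition last_renovation :: "(int \<Rightarrow> nat \<Rightarrow> ereal) \<Rightarrow> nat" where
  "last_renovation z = (LEAST j. renovation (future (- int (Suc j)) z))"

text \<open>The stationary value at time \<open>0\<close>. The truncation at \<open>1\<close> and the default value only
  matter outside the almost sure event \<open>recurrent\<close>.\<close>
definition stat_growth :: "(int \<Rightarrow> nat \<Rightarrow> ereal) \<Rightarrow> ereal" where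
  "stat_growth z =
    (if \<exists>j. renovation (future (- int (Suc j)) z)
     then min 1 (incr (future (- int (Suc (last_renovation z))) z) (Suc (last_renovation z))) else 0)"

lemma stat_growth_le: "stat_growth z \<le> 1"
  by (auto simp: stat_growth_def)

lemma borel_measurable_stat_growth [measurable]: "stat_growth \<in> borel_measurable bi_driving_space"
proof -
  have [measurable]: "Measurable.pred bi_driving_space (\<lambda>z. renovation (future u z))" for u
    by (rule measurable_compose[OF measurable_future measurable_renovation])
  have last: "last_renovation \<in> measurable bi_driving_space (count_space UNIV)"
    unfolding last_renovation_def[abs_def] by measurable
  have "(\<lambda>z. incr (future (- int (Suc j)) z) (Suc j)) \<in> borel_measurable bi_driving_space" for j
    by (rule measurable_compose[OF measurable_future borel_measurable_incr])
  then have inc: "(\<lambda>z. incr (future (- int (Suc (last_renovation z))) z) (Suc (last_renovation z))) \<in> borel_measurable bi_driving_space"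
    by (rule measurable_compose_countable[where f = "\<lambda>j z. incr (future (- int (Suc j)) z) (Suc j)" and g = last_renovation])
      (rule last)
  have "{z \<in> space bi_driving_space. \<exists>j. renovation (future (- int (Suc j)) z)} \<in> sets bi_driving_space"
    by measurable
  then have ex: "Measurable.pred bi_driving_space (\<lambda>z. \<exists>j. renovation (future (- int (Suc j)) z))"
    by (simp add: pred_def)
  have "(\<lambda>z. min 1 (incr (future (- int (Suc (last_renovation z))) z) (Suc (last_renovation z))))
      \<in> borel_measurable bi_driving_space"
    by (rule borel_measurable_min[OF inc borel_measurable_const])
  then show ?thesis unfolding stat_growth_def[abs_def]
    by (rule measurable_If[OF _ borel_measurable_const ex[unfolded pred_def]])
qed

text \<open>The event that carries the pathwise arguments. Past renovations define the stationary
  value; future ones make a system started at any time merge with it.\<close>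

definition recurrent :: "(int \<Rightarrow> nat \<Rightarrow> ereal) \<Rightarrow> bool" where
  "recurrent z \<longleftrightarrow> (\<forall>t. z t \<in> driving_sequences) \<and>
     (\<forall>N. \<exists>u\<ge>N. renovation (future u z)) \<and> (\<forall>N. \<exists>u\<le>N. renovation (future u z))"

text \<open>Two renovations before \<open>s\<close> are compared through a system started from one
  point before both: seen from either of them it has the same growth at \<open>s\<close>.\<close>

lemma stat_growth_eq:
  assumes "recurrent z" "renovation (future u z)" "u < s"
  shows "stat_growth (time_shift s z) = incr (future u z) (nat (s - u))"
proof -
  have dr: "z t \<in> driving_sequences" for t using assms(1) by (simp add: recurrent_def)
  have fut: "future v (time_shift s z) = future (v + s) z" for v by (simp add: ac_simps)
  define j where "j = last_renovation (time_shift s z)"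
  have ex: "\<exists>j. renovation (future (- int (Suc j)) (time_shift s z))"
  proof
    have "- int (Suc (nat (s - u - 1))) + s = u" using assms(3) by simp
    then show "renovation (future (- int (Suc (nat (s - u - 1)))) (time_shift s z))"
      using assms(2) unfolding fut by simp
  qed
  define u' where "u' = s - int (Suc j)"
  have fj: "future (- int (Suc j)) (time_shift s z) = future u' z" unfolding fut u'_def by (simp add: algebra_simps)
  have "renovation (future (- int (Suc j)) (time_shift s z))"
    unfolding j_def last_renovation_def by (rule LeastI_ex[OF ex])
  then have r': "renovation (future u' z)" unfolding fj .
  have "incr (future u' z) (Suc j) \<le> 1" by (rule incr_le) (rule dr)
  then have "stat_growth (time_shift s z) = incr (future u' z) (Suc j)"
    unfolding stat_growth_def j_def[symmetric] fj using ex by (simp add: min_def)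
  also have "\<dots> = incr (future u' z) (nat (s - u'))"
  proof -
    have "nat (s - u') = Suc j" unfolding u'_def by linarith
    then show ?thesis by simp
  qed
  also have "\<dots> = incr (future u z) (nat (s - u))"
  proof -
    \<comment> \<open>A renovation at \<open>u\<close> concerns the state at \<open>u - 1\<close>,
      so the common system has to exist one step before the earlier of the two.\<close>
    define T where "T = min u u' - 1"
    have "incr (future T z) (nat (s - T)) = incr (future v z) (nat (s - v))"
      if "renovation (future v z)" "T < v" "v < s" for v
      using incr_after_renovation[of T z "v - 1" s] dr that by simp
    from this[OF r'] this[OF assms(2)] assms(3) show ?thesis by (auto simp: T_def u'_def)
  qed
  finally show ?thesis .
qed

lemma incr_eventually_stat_growth:
  assumes "recurrent z"
  shows "\<forall>\<^sub>F n in sequentially. incr (future T z) n = stat_growth (time_shift (T + int n) z)"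
proof -
  have dr: "z t \<in> driving_sequences" for t using assms by (simp add: recurrent_def)
  obtain u where u: "T < u" "renovation (future u z)" using assms unfolding recurrent_def by (meson zless_add1_eq less_le_trans add1_zle_eq)
  show ?thesis unfolding eventually_sequentially
  proof (intro exI allI impI)
    fix n assume "nat (u - T) + 1 \<le> n"
    then have n: "u < T + int n" using u by linarith
    have "stat_growth (time_shift (T + int n) z) = incr (future u z) (nat (T + int n - u))"
      by (rule stat_growth_eq[OF assms u(2) n])
    also have "\<dots> = incr (future T z) n"
      using incr_after_renovation[of T z "u - 1" "T + int n"] dr u n by simp
    finally show "incr (future T z) n = stat_growth (time_shift (T + int n) z)" ..
  qed
qed

text \<open>A statement about a single trajectory: the first renovation after the start erases the
  initial state, so random starting times and states are covered without any condition on their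
  joint law with the driving sequences.\<close>

lemma MGS_eventually_stat_growth:
  assumes "recurrent z" "is_MGS T z \<nu>"
  shows "\<forall>\<^sub>F t in at_top. max_growth (shift_top (\<nu> (t - 1))) (z t) = stat_growth (time_shift t z)"
proof -
  obtain u where u: "T < u" "renovation (future u z)" using assms unfolding recurrent_def by (meson zless_add1_eq less_le_trans add1_zle_eq)
  show ?thesis unfolding eventually_at_top_linorder
  proof (intro exI allI impI)
    fix t assume t: "u + 1 \<le> t"
    have "max_growth (shift_top (\<nu> (t - 1))) (z t) = incr (future u z) (nat (t - u))"
      using MGS_after_renovation[OF assms(2), of "u - 1" "nat (t - u)"] u t by simp
    also have "\<dots> = stat_growth (time_shift t z)"
      by (rule stat_growth_eq[symmetric, OF assms(1) u(2)]) (use t in simp)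
    finally show "max_growth (shift_top (\<nu> (t - 1))) (z t) = stat_growth (time_shift t z)" .
  qed
qed

section \<open>Laws of the marks and driving sequences; almost sure recurrence\<close>

locale charge_distribution = prob_space F for F :: "ereal measure" +
  assumes sets_F: "sets F = sets borel"
    and Inf_tail: "Inf {z. emeasure F {z<..<\<infinity>} = 0} = 1"
    and infinity_null: "emeasure F {\<infinity>} = 0"
begin

lemma space_F [simp]: "space F = UNIV"
  using sets_eq_imp_space_eq[OF sets_F] by simp

definition half_prob :: real where
  "half_prob = prob {ereal (1/2)<..}"

lemma half_prob_pos: "0 < half_prob"
proof (rule ccontr)
  assume "\<not> ?thesis"
  then have "prob {ereal (1/2)<..} = 0"
    using measure_nonneg[of F "{ereal (1/2)<..}"] unfolding half_prob_def by linarith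
  then have "emeasure F {ereal (1/2)<..} = 0" by (simp add: emeasure_eq_measure)
  moreover have "emeasure F {ereal (1/2)<..<\<infinity>} \<le> emeasure F {ereal (1/2)<..}"
    by (rule emeasure_mono) (auto simp: sets_F)
  ultimately have "emeasure F {ereal (1/2)<..<\<infinity>} = 0" by simp
  then have "Inf {z. emeasure F {z<..<\<infinity>} = 0} \<le> ereal (1/2)" by (intro Inf_lower) simp
  then show False unfolding Inf_tail by (simp add: one_ereal_def)
qed

lemma half_prob_le: "half_prob \<le> 1"
  by (simp add: half_prob_def)

lemma AE_le_1: "AE x in F. x \<le> 1"
proof -
  have "AE x in F. x \<le> 1 + ereal (1 / real (Suc n))" for n
  proof -
    have "Inf {z. emeasure F {z<..<\<infinity>} = 0} < 1 + ereal (1 / real (Suc n))"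
      unfolding Inf_tail by (simp add: one_ereal_def)
    then obtain a where a: "emeasure F {a<..<\<infinity>} = 0" "a < 1 + ereal (1 / real (Suc n))"
      unfolding Inf_less_iff by blast
    have "{a<..<\<infinity>} \<in> null_sets F" "{\<infinity>} \<in> null_sets F"
      using a infinity_null by (auto simp: null_sets_def sets_F)
    then have "AE x in F. x \<notin> {a<..<\<infinity>}" "AE x in F. x \<notin> {\<infinity>}" by (auto dest: AE_not_in)
    then show ?thesis
    proof eventually_elim
      case (elim x)
      then have "x \<le> a" by auto
      then show ?case using a(2) by (meson less_imp_le order_trans)
    qed
  qed
  then have "AE x in F. \<forall>n. x \<le> 1 + ereal (1 / real (Suc n))" by (subst AE_all_countable) auto
  then show ?thesis
  proof eventually_elim
    case (elim x)
    show ?case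
    proof (rule ereal_le_epsilon2)
      fix e :: real assume "0 < e"
      then obtain n where "1 / real (Suc n) < e" by (metis nat_approx_posE inverse_eq_divide of_nat_Suc)
      then have "1 + ereal (1 / real (Suc n)) \<le> 1 + ereal e" by (intro add_left_mono) simp
      then show "x \<le> 1 + ereal e" using elim by (meson order_trans)
    qed
  qed
qed

abbreviation Q :: "(nat \<Rightarrow> ereal) measure" where "Q \<equiv> iid_law F"

abbreviation P1 :: "(nat \<Rightarrow> nat \<Rightarrow> ereal) measure" where "P1 \<equiv> PiM UNIV (\<lambda>_. Q)"

abbreviation P :: "(int \<Rightarrow> nat \<Rightarrow> ereal) measure" where "P \<equiv> PiM UNIV (\<lambda>_. Q)"

lemma prob_space_Q: "prob_space Q"
  unfolding iid_law_def by (intro prob_space_PiM) (rule prob_space_axioms)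

lemma prob_space_P1: "prob_space P1"
  by (intro prob_space_PiM) (rule prob_space_Q)

lemma prob_space_P: "prob_space P"
  by (intro prob_space_PiM) (rule prob_space_Q)

lemma sets_Q [measurable_cong]: "sets Q = sets seq_space"
  unfolding iid_law_def by (intro sets_PiM_cong sets_F refl)

lemma sets_P1 [measurable_cong]: "sets P1 = sets driving_space"
  by (intro sets_PiM_cong sets_Q refl)

lemma sets_P [measurable_cong]: "sets P = sets bi_driving_space"
  by (intro sets_PiM_cong sets_Q refl)

lemma space_Q [simp]: "space Q = UNIV"
  using sets_eq_imp_space_eq[OF sets_Q] by (simp add: space_PiM)

lemma space_P1 [simp]: "space P1 = UNIV"
  by (simp add: space_PiM)

lemma space_P [simp]: "space P = UNIV"
  by (simp add: space_PiM)

lemma measurable_P1_iff: "f \<in> measurable P1 N \<longleftrightarrow> f \<in> measurable driving_space N"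
  by (simp add: measurable_cong_sets[OF sets_P1 refl])

lemma measurable_P_iff: "f \<in> measurable P N \<longleftrightarrow> f \<in> measurable bi_driving_space N"
  by (simp add: measurable_cong_sets[OF sets_P refl])

lemma distr_shift: "distr P P (time_shift s) = P"
  using distr_PiM_reindex[of UNIV "\<lambda>_. Q" "\<lambda>t. t + s" UNIV] prob_space_Q
  by (simp add: restrict_UNIV inj_on_def)

lemma distr_future: "distr P P1 (future u) = P1"
  using distr_PiM_reindex[of UNIV "\<lambda>_. Q" "\<lambda>m. u + int m" UNIV] prob_space_Q
  by (simp add: restrict_UNIV inj_on_def)

lemma measurable_future_P [measurable]: "future u \<in> measurable P P1"
  by (simp add: measurable_P_iff measurable_cong_sets[OF refl sets_P1])

lemma measurable_shift_P [measurable]: "time_shift s \<in> measurable P P"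
  by (simp add: measurable_P_iff measurable_cong_sets[OF refl sets_P])

lemma AE_future: "AE x in P1. R x \<Longrightarrow> AE z in P. R (future u z)"
  by (rule AE_distrD[OF measurable_future_P]) (simp only: distr_future)

lemma AE_Q_driving: "AE v in Q. v \<in> driving_sequences"
proof -
  have "AE v in Q. v k \<le> 1" for k
    unfolding iid_law_def by (rule AE_PiM_component) (auto intro: prob_space_axioms AE_le_1)
  then have "AE v in Q. \<forall>k. v k \<le> 1" by (subst AE_all_countable) auto
  then show ?thesis by (simp add: driving_sequences_def SUP_le_iff)
qed

lemma AE_driving: "AE z in P. \<forall>t. z t \<in> driving_sequences"
proof -
  have "AE z in P. z t \<in> driving_sequences" for t
    by (rule AE_PiM_component[where P = "\<lambda>v. v \<in> driving_sequences"]) (auto intro: prob_space_Q AE_Q_driving)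
  then show ?thesis by (subst AE_all_countable) auto
qed

lemma sets_all_le_half: "{v. \<forall>k<n. v k \<le> ereal (1/2)} \<in> sets Q"
proof -
  have "{v \<in> space seq_space. \<forall>k\<in>{..<n}. v k \<le> ereal (1/2)} \<in> sets seq_space" by measurable
  then show ?thesis unfolding sets_Q by (simp add: Ball_def space_PiM)
qed

lemma prob_all_le_half: "measure Q {v. \<forall>k<n. v k \<le> ereal (1/2)} = (1 - half_prob) ^ n"
proof -
  have s: "{..ereal (1/2)} \<in> events" by (simp add: sets_F)
  have "measure Q {v. \<forall>k<n. v k \<le> ereal (1/2)} = (\<Prod>k<n. prob {..ereal (1/2)})"
    using measure_PiM_Collect[of F "{..<n}" "\<lambda>_. {..ereal (1/2)}"] prob_space_axioms s
    unfolding iid_law_def by (simp add: space_PiM Ball_def)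
  moreover have "prob {..ereal (1/2)} = 1 - half_prob"
  proof -
    have "prob (space F - {ereal (1/2)<..}) = 1 - prob {ereal (1/2)<..}"
      by (rule prob_compl) (simp add: sets_F)
    moreover have "space F - {ereal (1/2)<..} = {..ereal (1/2)}" by auto
    ultimately show ?thesis by (simp add: half_prob_def)
  qed
  ultimately show ?thesis by simp
qed

text \<open>The conditions for different n concern different driving sequences, hence are
  independent, and the n-th fails with probability \<open>q ^ max 1 n\<close>. A finite head of the
  product is positive, and the tail is at least 1/2 because the geometric series converges.\<close>

lemma renovation_prob_pos: "0 < measure P1 {x. renovation x}"
proof -
  interpret Q: prob_space Q by (rule prob_space_Q)
  interpret P1: prob_space P1 by (rule prob_space_P1)
  define q where "q = 1 - half_prob"
  have q: "0 \<le> q" "q < 1" using half_prob_pos half_prob_le by (auto simp: q_def)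
  have qn: "0 \<le> q ^ n" "q ^ n \<le> 1" for n using q by (auto intro: power_le_one)
  define B where "B n = {v :: nat \<Rightarrow> ereal. \<exists>k<max 1 n. ereal (1/2) < v k}" for n :: nat
  have B_compl: "B n = space Q - {v. \<forall>k<max 1 n. v k \<le> ereal (1/2)}" for n
    by (auto simp: B_def not_le)
  then have B_sets: "B n \<in> sets Q" for n unfolding B_compl by (intro sets.Diff sets.top sets_all_le_half)
  have B_prob: "measure Q (B n) = 1 - q ^ max 1 n" for n
    unfolding B_compl using Q.prob_compl[OF sets_all_le_half] prob_all_le_half[of "max 1 n"] by (simp add: q_def)
  define R where "R N = {x \<in> space P1. \<forall>n\<in>{..<N}. x n \<in> B n}" for N
  have R_sets: "R N \<in> sets P1" for N
  proof -
    note B_sets[measurable]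
    show ?thesis unfolding R_def by measurable
  qed
  have R_prob: "measure P1 (R N) = (\<Prod>n<N. 1 - q ^ max 1 n)" for N
    unfolding R_def using B_sets by (subst measure_PiM_Collect[OF prob_space_Q]) (auto simp: B_prob)
  have sm: "summable (\<lambda>n. q ^ n)" using q by (intro summable_geometric) auto
  obtain N0 where N0: "\<And>m n. m \<ge> N0 \<Longrightarrow> norm (\<Sum>k\<in>{m..<n}. q ^ k) < 1/2"
    using sm[unfolded summable_Cauchy, rule_format, of "1/2"] by auto
  \<comment> \<open>The successor makes \<open>max 1 n\<close> equal to \<open>n\<close> on the
    whole tail.\<close>
  define N1 where "N1 = Suc N0"
  define c where "c = (\<Prod>n<N1. 1 - q ^ max 1 n) / 2"
  have f_pos: "0 < 1 - q ^ max 1 n" for n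
  proof -
    have "q ^ max 1 n \<le> q ^ 1" using q by (intro power_decreasing) auto
    then show ?thesis using q by simp
  qed
  have c: "0 < c" unfolding c_def using f_pos by (intro divide_pos_pos prod_pos) auto
  have lower: "c \<le> measure P1 (R (N1 + N))" for N
  proof -
    have "{..<N1 + N} = {..<N1} \<union> {N1..<N1 + N}" by auto
    then have "measure P1 (R (N1 + N)) = (\<Prod>n<N1. 1 - q ^ max 1 n) * (\<Prod>n\<in>{N1..<N1 + N}. 1 - q ^ max 1 n)"
      unfolding R_prob by (simp add: prod.union_disjoint ivl_disj_int)
    also have "(\<Prod>n\<in>{N1..<N1 + N}. 1 - q ^ max 1 n) = (\<Prod>n\<in>{N1..<N1 + N}. 1 - q ^ n)"
      by (intro prod.cong) (auto simp: N1_def max_def)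
    also have "(\<Prod>n<N1. 1 - q ^ max 1 n) * \<dots> \<ge> (\<Prod>n<N1. 1 - q ^ max 1 n) * (1/2)"
    proof (rule mult_left_mono)
      have "1 - (\<Sum>n\<in>{N1..<N1 + N}. q ^ n) \<le> (\<Prod>n\<in>{N1..<N1 + N}. 1 - q ^ n)"
        by (rule one_minus_sum_le_prod) (use qn in auto)
      moreover have "(\<Sum>n\<in>{N1..<N1 + N}. q ^ n) < 1/2" using N0[of N1 "N1 + N"] by (auto simp: N1_def)
      ultimately show "1/2 \<le> (\<Prod>n\<in>{N1..<N1 + N}. 1 - q ^ n)" by simp
    qed (use f_pos in \<open>auto intro!: prod_nonneg simp: less_imp_le\<close>)
    finally show ?thesis by (simp add: c_def)
  qed
  have "renovation x" if "\<And>N. x \<in> R (N1 + N)" for x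
    unfolding renovation_def
  proof
    fix n
    have "n \<in> {..<N1 + Suc n}" by simp
    then show "\<exists>k<max 1 n. ereal (1/2) < x n k" using that[of "Suc n"] unfolding R_def B_def by blast
  qed
  then have "(\<Inter>N. R (N1 + N)) = {x. renovation x}"
    by (auto simp: R_def B_def renovation_def)
  moreover have "(\<lambda>N. measure P1 (R (N1 + N))) \<longlonglongrightarrow> measure P1 (\<Inter>N. R (N1 + N))"
    using R_sets by (intro P1.finite_Lim_measure_decseq) (auto simp: decseq_def R_def)
  ultimately have "c \<le> measure P1 {x. renovation x}"
    using lower by (auto intro: LIMSEQ_le_const)
  then show ?thesis using c by simp
qed

text \<open>The zero-one law looks forward only. The past is reached by stationarity: a long window
  contains an occurrence with probability near 1, and so does the same window moved to end just
  before \<open>N\<close>.\<close>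

lemma AE_recurrent:
  assumes D: "Measurable.pred driving_space D" and pos: "0 < measure P1 {x. D x}"
  shows "AE z in P. \<forall>N. \<exists>u\<ge>N. D (future u z)" "AE z in P. \<forall>N. \<exists>u\<le>N. D (future u z)"
proof -
  interpret P: prob_space P by (rule prob_space_P)
  have D_sets: "{x. D x} \<in> sets P1"
    using D unfolding sets_P1 pred_def by (simp add: space_PiM)
  have Df[measurable]: "Measurable.pred P (\<lambda>z. D (future u z))" for u
    by (rule measurable_compose[OF measurable_future_P]) (simp add: measurable_P1_iff D)
  have "AE x in P1. \<exists>\<^sub>\<infinity>n. D (\<lambda>m. x (n + m))"
    using sequence_zero_one[OF prob_space_Q D_sets pos] by simp
  then have "AE z in P. \<exists>\<^sub>\<infinity>n. D (\<lambda>m. future 0 z (n + m))" by (rule AE_future)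
  then have fwd: "AE z in P. \<forall>N. \<exists>n\<ge>N. D (future (int n) z)"
    by (simp add: INFM_nat_le)
  then show "AE z in P. \<forall>N. \<exists>u\<ge>N. D (future u z)"
  proof eventually_elim
    case (elim z)
    show ?case
    proof
      fix N :: int
      obtain n where "nat N \<le> n" "D (future (int n) z)" using elim by blast
      then show "\<exists>u\<ge>N. D (future u z)" by (intro exI[of _ "int n"]) auto
    qed
  qed
  \<comment> \<open>An occurrence in the window from 0 to k - 1; its probability tends to 1, and
    shifting by \<open>N - int k\<close> moves the window below \<open>N\<close>.\<close>
  define U where "U k = {z \<in> space P. \<exists>n\<in>{..<k}. D (future (int n) z)}" for k :: nat
  have U_sets: "U k \<in> sets P" for k unfolding U_def by measurable
  have "(\<lambda>k. P.prob (U k)) \<longlonglongrightarrow> P.prob (\<Union>k. U k)"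
    using U_sets by (intro P.finite_Lim_measure_incseq) (auto simp: incseq_def U_def)
  moreover have "P.prob (\<Union>k. U k) = 1"
  proof (rule P.prob_eq_1[THEN iffD2])
    show "(\<Union>k. U k) \<in> P.events" using U_sets by auto
    show "AE z in P. z \<in> (\<Union>k. U k)" using fwd
    proof eventually_elim
      case (elim z)
      then obtain n where "D (future (int n) z)" by blast
      then have "z \<in> U (Suc n)" by (auto simp: U_def)
      then show ?case by blast
    qed
  qed
  ultimately have lim: "(\<lambda>k. P.prob (U k)) \<longlonglongrightarrow> 1" by simp
  have "AE z in P. \<exists>u\<le>N. D (future u z)" for N
  proof -
    define V where "V = {z \<in> space P. \<exists>u\<in>{..N}. D (future u z)}"
    have V_sets: "V \<in> sets P" unfolding V_def by measurable
    have "P.prob (U k) \<le> P.prob V" for k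
    proof -
      have "P.prob (U k) = measure (distr P P (time_shift (N - int k))) (U k)" by (simp add: distr_shift)
      also have "\<dots> = P.prob (time_shift (N - int k) -` U k \<inter> space P)"
        by (rule measure_distr) (auto simp: U_sets measurable_shift_P)
      also have "\<dots> \<le> P.prob V"
      proof (rule P.finite_measure_mono)
        show "time_shift (N - int k) -` U k \<inter> space P \<subseteq> V"
        proof
          fix z assume "z \<in> time_shift (N - int k) -` U k \<inter> space P"
          then obtain n where n: "n < k" "D (future (int n) (time_shift (N - int k) z))" by (auto simp: U_def)
          have "future (int n) (time_shift (N - int k) z) = future (int n + N - int k) z"
            by (simp add: algebra_simps)
          then show "z \<in> V" using n by (auto simp: V_def intro!: bexI[of _ "int n + N - int k"])
        qed
      qed (rule V_sets)
      finally show ?thesis .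
    qed
    then have "1 \<le> P.prob V" by (intro LIMSEQ_le_const2[OF lim]) auto
    then have "P.prob V = 1" using P.prob_le_1[of V] by linarith
    then have "AE z in P. z \<in> V" by (subst P.AE_in_set_eq_1) (auto simp: V_sets)
    then show ?thesis by eventually_elim (auto simp: V_def)
  qed
  then show "AE z in P. \<forall>N. \<exists>u\<le>N. D (future u z)" by (subst AE_all_countable) auto
qed

lemma AE_recurrent_driving: "AE z in P. recurrent z"
  using AE_driving AE_recurrent[OF measurable_renovation renovation_prob_pos]
  by eventually_elim (auto simp: recurrent_def)

end

section \<open>Averages along orbits and positions of the points\<close>

text \<open>The covering argument of Katznelson and Weiss: cut an orbit into blocks along which the average
  of \<open>f\<close> is at least \<open>c\<close>; only points where no such block of length at most \<open>K\<close> starts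
  have to be paid for.\<close>
lemma average_bound_imp_integral_bound:
  fixes f :: "'b \<Rightarrow> real"
  assumes N: "prob_space N" and \<theta>: "\<theta> \<in> measurable N N" and inv: "distr N N \<theta> = N"
    and f: "f \<in> borel_measurable N" and f01: "\<And>z. 0 \<le> f z" "\<And>z. f z \<le> 1"
    and ex: "AE z in N. \<exists>n\<ge>1. real n * c \<le> (\<Sum>s<n. f ((\<theta> ^^ s) z))"
  shows "c \<le> (\<integral>z. f z \<partial>N)"
proof (cases "c \<le> 0")
  case True
  also have "0 \<le> (\<integral>z. f z \<partial>N)" by (rule Bochner_Integration.integral_nonneg) (rule f01)
  finally show ?thesis .
next
  case False
  then have c: "0 < c" by simp
  interpret N: prob_space N by (rule N)
  have \<theta>n: "(\<theta> ^^ s) \<in> measurable N N" for s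
    by (induction s) (auto simp: comp_def intro: measurable_compose[OF _ \<theta>])
  have inv_n: "distr N N (\<theta> ^^ s) = N" for s
  proof (induction s)
    case (Suc s)
    have "distr N N (\<theta> ^^ Suc s) = distr (distr N N (\<theta> ^^ s)) N \<theta>"
      by (simp add: distr_distr[OF \<theta> \<theta>n])
    then show ?case by (simp only: Suc inv)
  qed (simp add: id_def distr_id)
  have f\<theta>: "(\<lambda>z. f ((\<theta> ^^ s) z)) \<in> borel_measurable N" for s
    by (rule measurable_compose[OF \<theta>n f])
  define bad where "bad K = {z \<in> space N. \<forall>n\<in>{1..K}. (\<Sum>s<n. f ((\<theta> ^^ s) z)) < real n * c}" for K
  have bad_sets: "bad K \<in> sets N" for K
  proof -
    have "(\<lambda>z. \<Sum>s<n. f ((\<theta> ^^ s) z)) \<in> borel_measurable N" for n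
      using f\<theta> by (rule borel_measurable_sum)
    then show ?thesis unfolding bad_def by measurable
  qed
  have "(\<lambda>K. N.prob (bad K)) \<longlonglongrightarrow> N.prob (\<Inter>K. bad K)"
    using bad_sets by (intro N.finite_Lim_measure_decseq) (auto simp: decseq_def bad_def)
  moreover have "N.prob (\<Inter>K. bad K) = 0"
  proof -
    have "AE z in N. z \<notin> (\<Inter>K. bad K)" using ex
    proof eventually_elim
      case (elim z)
      then obtain n where "n \<ge> 1" "real n * c \<le> (\<Sum>s<n. f ((\<theta> ^^ s) z))" by blast
      then have "z \<notin> bad n" by (auto simp: bad_def not_less)
      then show ?case by blast
    qed
    then show ?thesis using bad_sets by (subst N.prob_eq_0) auto
  qed
  ultimately have bad_lim: "(\<lambda>K. N.prob (bad K)) \<longlonglongrightarrow> 0" by simp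
  have "c \<le> (\<integral>z. f z \<partial>N) + c * N.prob (bad K)" for K
  proof -
    \<comment> \<open>A bad starting point is paid the amount \<open>c\<close> directly, which makes
      it a block of length 1 with average at least \<open>c\<close>.\<close>
    define h where "h z = f z + c * indicator (bad K) z" for z
    have h_meas: "h \<in> borel_measurable N"
      unfolding h_def using f bad_sets by measurable
    have h0: "0 \<le> h z" for z using f01 c by (simp add: h_def)
    have int_f: "integrable N f"
      by (rule N.integrable_const_bound[of _ 1]) (use f f01 in auto)
    have int_b: "integrable N (\<lambda>z. c * indicator (bad K) z :: real)"
      using bad_sets by (simp add: integrable_indicator_iff N.emeasure_eq_measure)
    have int_h: "integrable N h" unfolding h_def using int_f int_b by (rule Bochner_Integration.integrable_add)
    have eh: "(\<integral>z. h z \<partial>N) = (\<integral>z. f z \<partial>N) + c * N.prob (bad K)"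
      unfolding h_def using int_f int_b bad_sets by (simp add: Bochner_Integration.integral_add)
    \<comment> \<open>The loss of \<open>K\<close> covers the unfinished block at the end, which has
      length at most \<open>K\<close> and contributes a nonnegative sum.\<close>
    have step: "(real L - real K) * c \<le> (\<Sum>s<L. h ((\<theta> ^^ s) z))" if "z \<in> space N" for z L
      using that
    proof (induction L arbitrary: z rule: less_induct)
      case (less L)
      show ?case
      proof (cases "L \<le> K")
        case True
        have "(real L - real K) * c \<le> 0" using True c by (intro mult_nonpos_nonneg) auto
        also have "\<dots> \<le> (\<Sum>s<L. h ((\<theta> ^^ s) z))" by (intro sum_nonneg h0)
        finally show ?thesis .
      next
        case False
        have "\<exists>n\<ge>1. n \<le> L \<and> real n * c \<le> (\<Sum>s<n. h ((\<theta> ^^ s) z))"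
        proof (cases "z \<in> bad K")
          case True
          then show ?thesis using False f01(1)[of z] by (intro exI[of _ 1]) (auto simp: h_def)
        next
          case notbad: False
          then obtain n where n: "n \<in> {1..K}" "real n * c \<le> (\<Sum>s<n. f ((\<theta> ^^ s) z))"
            using less.prems by (auto simp: bad_def not_less)
          have "(\<Sum>s<n. f ((\<theta> ^^ s) z)) \<le> (\<Sum>s<n. h ((\<theta> ^^ s) z))"
            using c by (intro sum_mono) (simp add: h_def)
          then show ?thesis using n False by (intro exI[of _ n]) auto
        qed
        then obtain n where n: "1 \<le> n" "n \<le> L" "real n * c \<le> (\<Sum>s<n. h ((\<theta> ^^ s) z))" by blast
        have "(\<Sum>s<L. h ((\<theta> ^^ s) z)) = (\<Sum>s<n. h ((\<theta> ^^ s) z)) + (\<Sum>s\<in>{n..<L}. h ((\<theta> ^^ s) z))"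
          using n(2) by (simp add: lessThan_atLeast0 sum.atLeastLessThan_concat)
        also have "(\<Sum>s\<in>{n..<L}. h ((\<theta> ^^ s) z)) = (\<Sum>s<L - n. h ((\<theta> ^^ s) ((\<theta> ^^ n) z)))"
          using sum.shift_bounds_nat_ivl[of "\<lambda>s. h ((\<theta> ^^ s) z)" 0 n "L - n"] n(2)
          by (simp add: lessThan_atLeast0 funpow_add)
        finally have split: "(\<Sum>s<L. h ((\<theta> ^^ s) z)) =
          (\<Sum>s<n. h ((\<theta> ^^ s) z)) + (\<Sum>s<L - n. h ((\<theta> ^^ s) ((\<theta> ^^ n) z)))" .
        have "(real (L - n) - real K) * c \<le> (\<Sum>s<L - n. h ((\<theta> ^^ s) ((\<theta> ^^ n) z)))"
          by (rule less.IH) (use n less.prems measurable_space[OF \<theta>n] in auto)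
        then show ?thesis unfolding split using n by (simp add: algebra_simps of_nat_diff)
      qed
    qed
    have "(real L - real K) * c \<le> real L * (\<integral>z. h z \<partial>N)" for L
    proof -
      have ih: "integrable N (\<lambda>z. h ((\<theta> ^^ s) z))" for s
        using int_h integrable_distr_eq[OF \<theta>n h_meas, of s] by (simp add: inv_n)
      have "(real L - real K) * c = (\<integral>z. (real L - real K) * c \<partial>N)" by (simp add: N.prob_space)
      also have "\<dots> \<le> (\<integral>z. (\<Sum>s<L. h ((\<theta> ^^ s) z)) \<partial>N)"
        using step ih by (intro integral_mono) auto
      also have "\<dots> = (\<Sum>s<L. \<integral>z. h ((\<theta> ^^ s) z) \<partial>N)"
        using ih by (rule Bochner_Integration.integral_sum)
      also have "\<dots> = (\<Sum>s<L. \<integral>z. h z \<partial>N)"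
        using integral_distr[OF \<theta>n h_meas] by (simp add: inv_n)
      finally show ?thesis by simp
    qed
    note bound = this
    have "c \<le> (\<integral>z. h z \<partial>N)"
    proof (rule ccontr)
      assume "\<not> ?thesis"
      then have d: "0 < c - (\<integral>z. h z \<partial>N)" by simp
      obtain L :: nat where "real K * c / (c - (\<integral>z. h z \<partial>N)) < real L" using reals_Archimedean2 by blast
      then have "real K * c < real L * (c - (\<integral>z. h z \<partial>N))" using d by (simp add: field_simps)
      then show False using bound[of L] by (simp add: algebra_simps)
    qed
    then show ?thesis unfolding eh .
  qed
  moreover have "(\<lambda>K. (\<integral>z. f z \<partial>N) + c * N.prob (bad K)) \<longlonglongrightarrow> (\<integral>z. f z \<partial>N) + c * 0"
    by (intro tendsto_intros bad_lim)
  ultimately show ?thesis using LIMSEQ_le_const by fastforce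
qed

section \<open>From the front to the individual points\<close>

lemma incr_ge:
  assumes "\<And>m. 0 < m \<Longrightarrow> x m \<in> driving_sequences" "0 < n"
  shows "x n 0 \<le> incr x n"
proof -
  have fin: "\<bar>Max (pos x ` {..<n})\<bar> \<noteq> \<infinity>" by (rule Max_pos_finite) (use assms in auto)
  have "Max (pos x ` {..<n}) + x n 0 = pos x (ranking (pos x) n ! 0) + x n 0"
    using Max_ranking_0[OF assms(2), of "pos x"] by simp
  also have "\<dots> \<le> new_point (pos x) n (x n)"
    unfolding new_point_def using assms(2) by (intro Max_ge) auto
  also have "\<dots> = pos x n" using assms(2) by (simp add: pos_rec)
  finally show ?thesis unfolding incr_def using fin
    by (cases "Max (pos x ` {..<n})"; cases "pos x n"; cases "x n 0") auto
qed

lemma max_pos_mono: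
  assumes "\<And>m. 0 < m \<Longrightarrow> x m \<in> driving_sequences" "m \<le> n"
  shows "max_pos x m \<le> max_pos x n"
  using assms(2)
proof (induction n rule: dec_induct)
  case (step n)
  have "max_pos x (Suc n) = max_pos x n + real_of_ereal (max (incr x (Suc n)) 0)"
    by (rule max_pos_Suc) (rule assms(1))
  moreover have "0 \<le> real_of_ereal (max (incr x (Suc n)) 0)" by (rule real_of_ereal_pos) simp
  ultimately show ?case using step by simp
qed simp

text \<open>Whenever the front advances, it advances by at most 1 and leaves one more point above
  the record at time \<open>m\<close>. The total advance is therefore at most the number of such
  points.\<close>

lemma card_pos_ge:
  assumes dr: "\<And>m. 0 < m \<Longrightarrow> x m \<in> driving_sequences" and "m \<le> n"
  shows "max_pos x n - max_pos x m \<le> real (card {i. i < Suc n \<and> ereal (max_pos x m) \<le> pos x i})"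
  using assms(2)
proof (induction n rule: dec_induct)
  case (step n)
  let ?A = "\<lambda>n. {i. i < Suc n \<and> ereal (max_pos x m) \<le> pos x i}"
  have eq: "max_pos x (Suc n) = max_pos x n + real_of_ereal (max (incr x (Suc n)) 0)"
    by (rule max_pos_Suc) (rule dr)
  have le1: "incr x (Suc n) \<le> 1" by (rule incr_le) (rule dr)
  show ?case
  proof (cases "incr x (Suc n) \<le> 0")
    case True
    then have "max_pos x (Suc n) = max_pos x n" using eq by (simp add: max_def)
    moreover have "card (?A n) \<le> card (?A (Suc n))" by (intro card_mono) auto
    ultimately show ?thesis using step.IH by simp
  next
    case False
    have "real_of_ereal (max (incr x (Suc n)) 0) \<le> 1"
      using le1 False by (cases "incr x (Suc n)") (auto simp: max_def one_ereal_def)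
    moreover have "card (?A (Suc n)) = Suc (card (?A n))"
    proof -
      have "incr x (Suc n) = pos x (Suc n) - ereal (max_pos x n)" by (rule incr_eq) (rule dr)
      then have "ereal (max_pos x n) \<le> pos x (Suc n)"
        using False by (cases "pos x (Suc n)") auto
      moreover have "max_pos x m \<le> max_pos x n" by (rule max_pos_mono) (use dr step in auto)
      ultimately have "ereal (max_pos x m) \<le> pos x (Suc n)" by (meson ereal_less_eq(3) order_trans)
      then have "?A (Suc n) = insert (Suc n) (?A n)" by (auto simp: less_Suc_eq)
      then show ?thesis by simp
    qed
    ultimately show ?thesis using step.IH eq by simp
  qed
qed simp

text \<open>By \<open>card_pos_ge\<close> more than \<open>k\<close> points lie at or above the old
  record, so the point of rank \<open>k\<close> does. Adding its positive mark gives a competitor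
  for the new point.\<close>

lemma pos_ge_max_pos:
  assumes dr: "\<And>m. 0 < m \<Longrightarrow> x m \<in> driving_sequences" and mn: "m < n"
    and k: "real k < max_pos x (n - 1) - max_pos x m" "ereal (1/2) < x n k"
  shows "ereal (max_pos x m) \<le> pos x n"
proof -
  have "max_pos x (n - 1) - max_pos x m \<le> real (card {i. i < n \<and> ereal (max_pos x m) \<le> pos x i})"
    using card_pos_ge[of x m "n - 1"] dr mn by simp
  then have c: "k < card {i. i < n \<and> ereal (max_pos x m) \<le> pos x i}" using k by linarith
  have "card {i. i < n \<and> ereal (max_pos x m) \<le> pos x i} \<le> card {..<n}" by (intro card_mono) auto
  then have kn: "k < n" using c by simp
  have "ereal (max_pos x m) \<le> pos x (ranking (pos x) n ! k)"
    using c by (subst le_ranking_iff[OF kn])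
  then have "ereal (max_pos x m) \<le> pos x (ranking (pos x) n ! k) + x n k"
    using k(2) by (cases "pos x (ranking (pos x) n ! k)"; cases "x n k") auto
  also have "\<dots> \<le> new_point (pos x) n (x n)"
    unfolding new_point_def using kn by (intro Max_ge) auto
  also have "\<dots> = pos x n" using mn by (simp add: pos_rec)
  finally show ?thesis .
qed

lemma real_div_bounds:
  "real n / real j - 1 \<le> real (n div j)" "real (n div j) \<le> real n / real j"
  using floor_divide_of_nat_eq[of n j, where 'a = real] by linarith+

lemma tendsto_div_over:
  assumes "0 < j" shows "(\<lambda>n. real (n div j) / real n) \<longlonglongrightarrow> 1 / real j"
proof (rule tendsto_sandwich)
  show "\<forall>\<^sub>F n in sequentially. 1 / real j - 1 / real n \<le> real (n div j) / real n"
    using eventually_gt_at_top[of 0]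
  proof eventually_elim
    case (elim n)
    have "(real n / real j - 1) / real n \<le> real (n div j) / real n" by (intro divide_right_mono real_div_bounds) simp
    then show ?case using elim by (simp add: diff_divide_distrib)
  qed
  show "\<forall>\<^sub>F n in sequentially. real (n div j) / real n \<le> 1 / real j"
    using eventually_gt_at_top[of 0]
  proof eventually_elim
    case (elim n)
    have "real (n div j) / real n \<le> (real n / real j) / real n" by (intro divide_right_mono real_div_bounds) simp
    then show ?case using elim by simp
  qed
  show "(\<lambda>n. 1 / real j - 1 / real n) \<longlonglongrightarrow> 1 / real j"
    using tendsto_diff[OF tendsto_const lim_1_over_n, of "1 / real j"] by simp
qed simp

text \<open>The points above the record \<open>max_pos x m\<close> with \<open>m = n - 1 - n div j\<close> number about
  \<open>\<gamma> n / j\<close>, and one of their marks at time \<open>n\<close> is positive.\<close>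
lemma pos_tendsto:
  assumes dr: "\<And>m. 0 < m \<Longrightarrow> x m \<in> driving_sequences" and "0 < \<gamma>"
    and lim: "(\<lambda>n. max_pos x n / real n) \<longlonglongrightarrow> \<gamma>"
    and marks: "\<And>j. 0 < j \<Longrightarrow> \<forall>\<^sub>F n in sequentially. \<exists>k<n div j. ereal (1/2) < x n k"
  shows "(\<lambda>n. pos x n / ereal (real n)) \<longlonglongrightarrow> ereal \<gamma>"
proof (rule order_tendstoI)
  fix a assume a: "ereal \<gamma> < a"
  have "(\<lambda>n. ereal (max_pos x n / real n)) \<longlonglongrightarrow> ereal \<gamma>" using lim by simp
  then have "\<forall>\<^sub>F n in sequentially. ereal (max_pos x n / real n) < a" using a by (rule order_tendstoD)
  then show "\<forall>\<^sub>F n in sequentially. pos x n / ereal (real n) < a"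
    using eventually_gt_at_top[of 0]
  proof eventually_elim
    case (elim n)
    have "pos x n \<le> ereal (max_pos x n)" by (rule pos_le_max_pos) (use dr in auto)
    then have "pos x n / ereal (real n) \<le> ereal (max_pos x n) / ereal (real n)"
      using elim(2) by (intro ereal_divide_right_mono) auto
    also have "\<dots> = ereal (max_pos x n / real n)" using elim(2) by simp
    finally show ?case using elim(1) by simp
  qed
next
  fix a assume a: "a < ereal \<gamma>"
  then obtain b where b: "a < ereal b" "b < \<gamma>"
    using ereal_dense2[OF a] by auto
  \<comment> \<open>Nonnegativity of \<open>b'\<close> forces the denominator \<open>j\<close>
    chosen next to exceed 1.\<close>
  define b' where "b' = max b 0"
  have b': "b \<le> b'" "0 \<le> b'" "b' < \<gamma>" using b \<open>0 < \<gamma>\<close> by (auto simp: b'_def)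
  \<comment> \<open>This choice says \<open>b' < \<gamma> * (1 - 1 / real j)\<close>: a record older
    by the fraction 1/j of the time is still above \<open>b' * real n\<close>.\<close>
  obtain j :: nat where j: "\<gamma> / (\<gamma> - b') < real j" using reals_Archimedean2 by blast
  have j_ge: "1 < real j"
  proof -
    have "1 \<le> \<gamma> / (\<gamma> - b')" using b' by (simp add: le_divide_eq)
    then show ?thesis using j by simp
  qed
  then have j0: "0 < j" by (cases j) auto
  have bj: "b' < \<gamma> * (1 - 1 / real j)"
    using j b' j_ge by (simp add: field_simps)
  define m where "m n = n - 1 - n div j" for n
  have m_over: "(\<lambda>n. real (m n) / real n) \<longlonglongrightarrow> 1 - 1 / real j"
  proof -
    have "(\<lambda>n. 1 - 1 / real n - real (n div j) / real n) \<longlonglongrightarrow> 1 - 0 - 1 / real j"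
      by (intro tendsto_diff tendsto_const lim_1_over_n tendsto_div_over j0)
    moreover have "\<forall>\<^sub>F n in sequentially. 1 - 1 / real n - real (n div j) / real n = real (m n) / real n"
      using eventually_gt_at_top[of 0]
    proof eventually_elim
      case (elim n)
      have "n div j < n" using j_ge elim by (intro div_less_dividend) auto
      then have "real (m n) = real n - 1 - real (n div j)" unfolding m_def by (simp add: of_nat_diff)
      then show ?case using elim by (simp add: diff_divide_distrib)
    qed
    ultimately show ?thesis by (auto elim: Lim_transform_eventually)
  qed
  have m_inf: "filterlim m at_top sequentially"
  proof -
    have "filterlim (\<lambda>n. real (m n) / real n * real n) at_top sequentially"
      using m_over j_ge by (intro filterlim_tendsto_pos_mult_at_top[OF m_over] filterlim_real_sequentially) auto
    moreover have "(\<lambda>n. real (m n) / real n * real n) = (\<lambda>n. real (m n))" by (auto simp: fun_eq_iff m_def)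
    ultimately show ?thesis by (simp add: filterlim_sequentially_iff_filterlim_real)
  qed
  have am: "(\<lambda>n. max_pos x (m n) / real n) \<longlonglongrightarrow> \<gamma> * (1 - 1 / real j)"
  proof -
    have "(\<lambda>n. max_pos x (m n) / real (m n) * (real (m n) / real n)) \<longlonglongrightarrow> \<gamma> * (1 - 1 / real j)"
      by (intro tendsto_mult m_over filterlim_compose[OF lim m_inf])
    moreover have "max_pos x (m n) / real (m n) * (real (m n) / real n) = max_pos x (m n) / real n" for n
      by (cases "m n = 0") auto
    ultimately show ?thesis by (simp only:)
  qed
  have a1: "(\<lambda>n. max_pos x (n - 1) / real n) \<longlonglongrightarrow> \<gamma>"
  proof (rule LIMSEQ_imp_Suc)
    have "(\<lambda>n. max_pos x n / real n * (real n / real (Suc n))) \<longlonglongrightarrow> \<gamma> * 1"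
      by (intro tendsto_mult lim LIMSEQ_n_over_Suc_n)
    moreover have "max_pos x n / real n * (real n / real (Suc n)) = max_pos x n / real (Suc n)" for n
      by (cases "n = 0") auto
    ultimately show "(\<lambda>n. max_pos x (Suc n - 1) / real (Suc n)) \<longlonglongrightarrow> \<gamma>" by simp
  qed
  \<comment> \<open>Since 1/i is below the limiting advance \<open>\<gamma> / real j\<close> per
    unit of time, the ranks below \<open>n div i\<close> are eventually among the points above the
    old record.\<close>
  obtain i :: nat where i: "real j / \<gamma> < real i" using reals_Archimedean2 by blast
  have i0: "0 < real i" using i \<open>0 < \<gamma>\<close> j_ge by (intro less_trans[OF _ i]) simp
  have "1 / real i < \<gamma> - \<gamma> * (1 - 1 / real j)"
    using i i0 j_ge \<open>0 < \<gamma>\<close> by (simp add: field_simps)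
  moreover have "(\<lambda>n. max_pos x (n - 1) / real n - max_pos x (m n) / real n) \<longlonglongrightarrow> \<gamma> - \<gamma> * (1 - 1 / real j)"
    by (intro tendsto_diff a1 am)
  ultimately have "\<forall>\<^sub>F n in sequentially. 1 / real i < max_pos x (n - 1) / real n - max_pos x (m n) / real n"
    by (rule order_tendstoD(1)[rotated])
  moreover have "\<forall>\<^sub>F n in sequentially. b' < max_pos x (m n) / real n"
    by (rule order_tendstoD(1)[OF am bj])
  moreover have "\<forall>\<^sub>F n in sequentially. \<exists>k<n div i. ereal (1/2) < x n k"
    by (rule marks) (use i0 in simp)
  ultimately show "\<forall>\<^sub>F n in sequentially. a < pos x n / ereal (real n)"
    using eventually_gt_at_top[of 0]
  proof eventually_elim
    case (elim n)
    then obtain k where k: "k < n div i" "ereal (1/2) < x n k" by blast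
    have "real k < real (n div i)" using k by simp
    also have "\<dots> \<le> real n / real i" by (rule real_div_bounds)
    also have "\<dots> < max_pos x (n - 1) - max_pos x (m n)"
      using elim(1,4) by (simp add: field_simps)
    finally have "ereal (max_pos x (m n)) \<le> pos x n"
      using dr elim(4) k(2) by (intro pos_ge_max_pos[where k = k]) (auto simp: m_def)
    then have "ereal (max_pos x (m n)) / ereal (real n) \<le> pos x n / ereal (real n)"
      using elim(4) by (intro ereal_divide_right_mono) auto
    then have le: "ereal (max_pos x (m n) / real n) \<le> pos x n / ereal (real n)" using elim(4) by simp
    have "a < ereal (max_pos x (m n) / real n)"
      by (rule less_trans[OF b(1)]) (use elim(2) b' in simp)
    then show ?case using le by (rule less_le_trans)
  qed
qed

lemma summable_power_div:
  fixes q :: real assumes "0 \<le> q" "q < 1" "0 < j"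
  shows "summable (\<lambda>n. q ^ (n div j))"
proof (rule summable_comparison_test_ev)
  \<comment> \<open>A base bounded away from 0 allows real powers and division by \<open>r\<close>,
    also when \<open>q\<close> is 0.\<close>
  define r where "r = max q (1/2)"
  have r: "0 < r" "r < 1" "q \<le> r" using assms by (auto simp: r_def)
  define s where "s = r powr (1 / real j)"
  have s: "0 \<le> s" "s < 1" unfolding s_def using r assms(3) powr_less_mono2[of "1 / real j" r 1] by auto
  have "norm (q ^ (n div j)) \<le> s ^ n / r" for n
  proof -
    have "norm (q ^ (n div j)) = q ^ (n div j)" using assms by simp
    also have "\<dots> \<le> r ^ (n div j)" by (intro power_mono r assms)
    also have "\<dots> = r powr real (n div j)" using r by (simp add: powr_realpow)
    also have "\<dots> \<le> r powr (real n / real j - 1)"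
      by (rule powr_mono'[OF real_div_bounds(1)]) (use r in auto)
    also have "\<dots> = s ^ n / r"
      using r by (simp add: s_def powr_diff powr_realpow[symmetric] powr_powr)
    finally show ?thesis .
  qed
  then show "\<forall>\<^sub>F n in sequentially. norm (q ^ (n div j)) \<le> s ^ n / r" by simp
  show "summable (\<lambda>n. s ^ n / r)" using s by (intro summable_divide summable_geometric) simp
qed

section \<open>The speed of the front\<close>

definition growth_plus :: "(int \<Rightarrow> nat \<Rightarrow> ereal) \<Rightarrow> real" where
  "growth_plus z = real_of_ereal (max (stat_growth z) 0)"

lemma growth_plus_nonneg: "0 \<le> growth_plus z"
  unfolding growth_plus_def by (rule real_of_ereal_pos) simp

lemma growth_plus_le: "growth_plus z \<le> 1"
  unfolding growth_plus_def using stat_growth_le[of z]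
  by (cases "stat_growth z") (auto simp: max_def one_ereal_def)

lemma borel_measurable_growth_plus: "growth_plus \<in> borel_measurable bi_driving_space"
  unfolding growth_plus_def[abs_def]
  by (intro borel_measurable_real_of_ereal borel_measurable_max borel_measurable_stat_growth borel_measurable_const)

lemma funpow_shift: "(time_shift 1 ^^ s) z = time_shift (int s) z"
  by (induction s) (auto simp: algebra_simps)

text \<open>After the merging time the steps of the front are the stationary ones; all earlier
  discrepancies go into \<open>C\<close>. The sum starts at time 0 for every \<open>T\<close>, so it
  is an orbit sum at \<open>z\<close> itself.\<close>

lemma max_pos_eventually_sum:
  assumes "recurrent z"
  shows "\<exists>C. \<forall>\<^sub>F n in sequentially.
    max_pos (future (int T) z) n = C + (\<Sum>s<T + Suc n. growth_plus ((time_shift 1 ^^ s) z))"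
proof -
  let ?x = "future (int T) z" and ?S = "\<lambda>m. \<Sum>s<m. growth_plus ((time_shift 1 ^^ s) z)"
  have dr: "?x m \<in> driving_sequences" for m using assms by (simp add: recurrent_def)
  obtain N where N: "\<And>n. N \<le> n \<Longrightarrow> incr ?x n = stat_growth (time_shift (int T + int n) z)"
    using incr_eventually_stat_growth[OF assms, of "int T"] unfolding eventually_sequentially by blast
  have "max_pos ?x n = (max_pos ?x N - ?S (T + Suc N)) + ?S (T + Suc n)" if "N \<le> n" for n
    using that
  proof (induction n rule: dec_induct)
    case (step n)
    have "max_pos ?x (Suc n) = max_pos ?x n + real_of_ereal (max (incr ?x (Suc n)) 0)"
      by (rule max_pos_Suc) (rule dr)
    also have "incr ?x (Suc n) = stat_growth (time_shift (int T + int (Suc n)) z)" by (rule N) (use step in simp)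
    also have "real_of_ereal (max \<dots> 0) = growth_plus ((time_shift 1 ^^ (T + Suc n)) z)"
      by (simp only: growth_plus_def funpow_shift of_nat_add)
    finally show ?case using step.IH by simp
  qed simp
  then show ?thesis unfolding eventually_sequentially by blast
qed

text \<open>Passing from \<open>c\<close> to the smaller \<open>c'\<close> gains an amount growing
  linearly in n, which absorbs both the constant \<open>C\<close> and the time offset
  \<open>T + 1\<close>.\<close>

lemma frequently_ge_imp_average_ge:
  fixes a :: "nat \<Rightarrow> real"
  assumes ev: "\<forall>\<^sub>F n in sequentially. a n = C + S (T + Suc n)"
    and inf: "\<exists>\<^sub>\<infinity>n. c * real n \<le> a n" and "c' < c"
  shows "\<exists>n\<ge>1. real n * c' \<le> S n"
proof -
  obtain N where N: "\<And>n. N \<le> n \<Longrightarrow> a n = C + S (T + Suc n)"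
    using ev unfolding eventually_sequentially by blast
  obtain K :: nat where K: "(c' * real (Suc T) + C) / (c - c') < real K" using reals_Archimedean2 by blast
  obtain n where n: "max N K \<le> n" "c * real n \<le> a n" using inf unfolding INFM_nat_le by blast
  have "(c' * real (Suc T) + C) / (c - c') < real n" using K n(1) by simp
  then have "c' * real (Suc T) + C < real n * (c - c')" using \<open>c' < c\<close> by (simp add: field_simps)
  moreover have "c * real n \<le> C + S (T + Suc n)" using n N[of n] by simp
  ultimately have "real (T + Suc n) * c' \<le> S (T + Suc n)" by (simp add: algebra_simps)
  then show ?thesis by (intro exI[of _ "T + Suc n"]) simp
qed

section \<open>Almost sure limits of the front and of the points\<close>

context charge_distribution
begin

definition speed :: real where
  "speed = (\<integral>z. growth_plus z \<partial>P)"

lemma growth_plus_measurable [measurable]: "growth_plus \<in> borel_measurable P"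
  by (simp add: measurable_P_iff borel_measurable_growth_plus)

lemma integrable_growth_plus: "integrable P growth_plus"
proof -
  interpret P: prob_space P by (rule prob_space_P)
  show ?thesis
    by (rule P.integrable_const_bound[of _ 1]) (auto simp: growth_plus_nonneg growth_plus_le)
qed

lemma pred_frequently [measurable]:
  assumes [measurable]: "\<And>n :: nat. Measurable.pred driving_space (R n)"
  shows "Measurable.pred driving_space (\<lambda>x. \<exists>\<^sub>\<infinity>n. R n x)"
  unfolding INFM_nat_le by measurable

text \<open>If the front reached \<open>c * real n\<close> infinitely often with positive
  probability, recurrence would give almost every trajectory a time from which the system started
  there does so. Merging transfers this to orbit sums of \<open>growth_plus\<close>, and the
  covering argument would force \<open>c' \<le> speed\<close>.\<close>

lemma AE_eventually_less:
  assumes "speed < c"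
  shows "AE x in P1. \<forall>\<^sub>F n in sequentially. max_pos x n < c * real n"
proof -
  interpret P1: prob_space P1 by (rule prob_space_P1)
  obtain c' where c': "speed < c'" "c' < c" using dense[OF assms] by blast
  let ?D = "\<lambda>x. \<exists>\<^sub>\<infinity>n. c * real n \<le> max_pos x n"
  have D: "Measurable.pred driving_space ?D" by (rule pred_frequently) measurable
  have "\<not> 0 < P1.prob {x. ?D x}"
  proof
    assume "0 < P1.prob {x. ?D x}"
    from AE_recurrent(1)[OF D this] AE_recurrent_driving
    have "AE z in P. \<exists>n\<ge>1. real n * c' \<le> (\<Sum>s<n. growth_plus ((time_shift 1 ^^ s) z))"
    proof eventually_elim
      case (elim z)
      then obtain u where u: "0 \<le> u" "?D (future u z)" by blast
      define T where "T = nat u"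
      have T: "?D (future (int T) z)" using u by (simp add: T_def)
      obtain C where "\<forall>\<^sub>F n in sequentially.
          max_pos (future (int T) z) n = C + (\<Sum>s<T + Suc n. growth_plus ((time_shift 1 ^^ s) z))"
        using max_pos_eventually_sum[OF elim(2), of T] by blast
      then show ?case using T c'(2) by (rule frequently_ge_imp_average_ge)
    qed
    then have "c' \<le> speed"
      unfolding speed_def
      by (intro average_bound_imp_integral_bound[OF prob_space_P measurable_shift_P distr_shift growth_plus_measurable])
        (auto simp: growth_plus_nonneg growth_plus_le)
    then show False using c' by simp
  qed
  then have z: "P1.prob {x. ?D x} = 0" using measure_nonneg[of P1 "{x. ?D x}"] by linarith
  have "{x. ?D x} \<in> P1.events" using D unfolding sets_P1 pred_def by (simp add: space_PiM)
  then have "AE x in P1. x \<notin> {x. ?D x}" using z P1.prob_eq_0 by blast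
  then show ?thesis
    by eventually_elim (simp add: not_INFM MOST_iff_cofinite cofinite_eq_sequentially not_le frequently_def)
qed

text \<open>The same argument for \<open>1 - growth_plus\<close>, which again takes values between 0
  and 1.\<close>

lemma AE_eventually_greater:
  assumes "c < speed"
  shows "AE x in P1. \<forall>\<^sub>F n in sequentially. c * real n < max_pos x n"
proof -
  interpret P1: prob_space P1 by (rule prob_space_P1)
  interpret P: prob_space P by (rule prob_space_P)
  obtain c' where c': "c < c'" "c' < speed" using dense[OF assms] by blast
  let ?D = "\<lambda>x. \<exists>\<^sub>\<infinity>n. (1 - c) * real n \<le> real n - max_pos x n"
  have D: "Measurable.pred driving_space ?D" by (rule pred_frequently) measurable
  have "\<not> 0 < P1.prob {x. ?D x}"
  proof
    assume "0 < P1.prob {x. ?D x}"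
    from AE_recurrent(1)[OF D this] AE_recurrent_driving
    have "AE z in P. \<exists>n\<ge>1. real n * (1 - c') \<le> (\<Sum>s<n. 1 - growth_plus ((time_shift 1 ^^ s) z))"
    proof eventually_elim
      case (elim z)
      then obtain u where u: "0 \<le> u" "?D (future u z)" by blast
      define T where "T = nat u"
      have T: "?D (future (int T) z)" using u by (simp add: T_def)
      obtain C where "\<forall>\<^sub>F n in sequentially.
          max_pos (future (int T) z) n = C + (\<Sum>s<T + Suc n. growth_plus ((time_shift 1 ^^ s) z))"
        using max_pos_eventually_sum[OF elim(2), of T] by blast
      then have "\<forall>\<^sub>F n in sequentially. real n - max_pos (future (int T) z) n
          = (- C - real (Suc T)) + (\<Sum>s<T + Suc n. 1 - growth_plus ((time_shift 1 ^^ s) z))"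
        by eventually_elim (simp add: sum_subtractf)
      then show ?case using T by (rule frequently_ge_imp_average_ge) (use c'(1) in simp)
    qed
    then have "1 - c' \<le> (\<integral>z. 1 - growth_plus z \<partial>P)"
      by (intro average_bound_imp_integral_bound[OF prob_space_P measurable_shift_P distr_shift])
        (auto simp: growth_plus_nonneg growth_plus_le)
    also have "\<dots> = 1 - speed"
      unfolding speed_def using integrable_growth_plus P.prob_space by simp
    finally show False using c' by simp
  qed
  then have z: "P1.prob {x. ?D x} = 0" using measure_nonneg[of P1 "{x. ?D x}"] by linarith
  have "{x. ?D x} \<in> P1.events" using D unfolding sets_P1 pred_def by (simp add: space_PiM)
  then have "AE x in P1. x \<notin> {x. ?D x}" using z P1.prob_eq_0 by blast
  then show ?thesis
    by eventually_elim (simp add: not_INFM MOST_iff_cofinite cofinite_eq_sequentially not_le frequently_def algebra_simps)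
qed

lemma AE_max_pos_limit: "AE x in P1. (\<lambda>n. max_pos x n / real n) \<longlonglongrightarrow> speed"
proof -
  have e: "0 < 1 / real (Suc k)" for k by simp
  have "AE x in P1. \<forall>k. \<forall>\<^sub>F n in sequentially. max_pos x n < (speed + 1 / real (Suc k)) * real n"
    unfolding AE_all_countable by (intro allI AE_eventually_less) (simp add: e)
  moreover have "AE x in P1. \<forall>k. \<forall>\<^sub>F n in sequentially. (speed - 1 / real (Suc k)) * real n < max_pos x n"
    unfolding AE_all_countable by (intro allI AE_eventually_greater) (simp add: e)
  ultimately show ?thesis
  proof eventually_elim
    case (elim x)
    show ?case
    proof (rule tendstoI)
      fix \<epsilon> :: real assume "0 < \<epsilon>"
      then obtain k where k: "1 / real (Suc k) < \<epsilon>" by (metis nat_approx_posE inverse_eq_divide of_nat_Suc)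
      from spec[OF elim(1), of k] spec[OF elim(2), of k] eventually_gt_at_top[of 0]
      show "\<forall>\<^sub>F n in sequentially. dist (max_pos x n / real n) speed < \<epsilon>"
      proof eventually_elim
        case (elim n)
        then have "max_pos x n / real n < speed + 1 / real (Suc k)" "speed - 1 / real (Suc k) < max_pos x n / real n"
          by (simp_all add: pos_divide_less_eq pos_less_divide_eq)
        then show ?case using k by (simp add: dist_real_def abs_less_iff)
      qed
    qed
  qed
qed

lemma AE_P1_driving: "AE x in P1. \<forall>n. x n \<in> driving_sequences"
proof -
  have "AE x in P1. x n \<in> driving_sequences" for n
    by (rule AE_PiM_component[where P = "\<lambda>v. v \<in> driving_sequences"]) (auto intro: prob_space_Q AE_Q_driving)
  then show ?thesis by (subst AE_all_countable) auto
qed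

text \<open>Borel-Cantelli: failure at n has probability \<open>(1 - half_prob) ^ (n div j)\<close>,
  which is summable.\<close>

lemma AE_marks: "AE x in P1. \<forall>j>0. \<forall>\<^sub>F n in sequentially. \<exists>k<n div j. ereal (1/2) < x n k"
proof -
  interpret P1: prob_space P1 by (rule prob_space_P1)
  have "AE x in P1. \<forall>\<^sub>F n in sequentially. \<exists>k<n div j. ereal (1/2) < x n k" if "0 < j" for j
  proof -
    define A where "A n = {x \<in> space P1. \<forall>i\<in>{n}. x i \<in> {v. \<forall>k<n div j. v k \<le> ereal (1/2)}}" for n
    have A_prob: "P1.prob (A n) = (1 - half_prob) ^ (n div j)" for n
      unfolding A_def by (subst measure_PiM_Collect[OF prob_space_Q]) (auto simp: sets_all_le_half prob_all_le_half)
    have A_sets: "A n \<in> P1.events" for n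
    proof -
      have "{v. \<forall>k<n div j. v k \<le> ereal (1/2)} \<in> sets Q" by (rule sets_all_le_half)
      then have "(\<lambda>x. x n) -` {v. \<forall>k<n div j. v k \<le> ereal (1/2)} \<inter> space P1 \<in> P1.events"
        by (intro measurable_sets[OF measurable_component_singleton]) auto
      also have "(\<lambda>x. x n) -` {v. \<forall>k<n div j. v k \<le> ereal (1/2)} \<inter> space P1 = A n" by (auto simp: A_def)
      finally show ?thesis .
    qed
    have "AE x in P1. eventually (\<lambda>n. x \<in> space P1 - A n) sequentially"
    proof (rule borel_cantelli_AE1[OF A_sets])
      show "summable (\<lambda>n. P1.prob (A n))"
        unfolding A_prob using half_prob_pos half_prob_le that by (intro summable_power_div) auto
    qed (simp add: P1.emeasure_eq_measure)
    then show ?thesis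
    proof eventually_elim
      case (elim x)
      then show ?case by eventually_elim (auto simp: A_def not_le)
    qed
  qed
  then have "AE x in P1. 0 < j \<longrightarrow> (\<forall>\<^sub>F n in sequentially. \<exists>k<n div j. ereal (1/2) < x n k)" for j by auto
  then show ?thesis unfolding AE_all_countable by blast
qed

text \<open>A first mark above 1/2 is added to the front and moves it by more than 1/2, so the speed
  is at least \<open>half_prob / 2\<close>. Positivity is what yields linearly many points above an
  older record.\<close>

lemma speed_pos: "0 < speed"
proof -
  interpret P: prob_space P by (rule prob_space_P)
  interpret Q: prob_space Q by (rule prob_space_Q)
  define B where "B = {v :: nat \<Rightarrow> ereal. ereal (1/2) < v 0}"
  have B_compl: "B = space Q - {v. \<forall>k<1. v k \<le> ereal (1/2)}" by (auto simp: B_def not_le)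
  have B_sets: "B \<in> sets Q" unfolding B_compl by (intro sets.Diff sets.top sets_all_le_half)
  have B_prob: "Q.prob B = half_prob"
    unfolding B_compl using Q.prob_compl[OF sets_all_le_half[of 1]] prob_all_le_half[of 1] by simp
  define E where "E = {z \<in> space P. \<forall>t\<in>{0::int}. z t \<in> B}"
  have E_prob: "P.prob E = half_prob"
    unfolding E_def using measure_PiM_Collect[OF prob_space_Q, of "{0::int}" "\<lambda>_. B"] B_sets B_prob by simp
  have E_sets: "E \<in> P.events"
  proof -
    have "(\<lambda>z. z 0) -` B \<inter> space P \<in> P.events"
      by (intro measurable_sets[OF measurable_component_singleton] B_sets) auto
    also have "(\<lambda>z. z 0) -` B \<inter> space P = E" by (auto simp: E_def)
    finally show ?thesis .
  qed
  have "AE z in P. 1/2 * indicator E z \<le> growth_plus z" using AE_recurrent_driving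
  proof eventually_elim
    case (elim z)
    show ?case
    proof (cases "z \<in> E")
      case True
      then have z0: "ereal (1/2) < z 0 0" by (simp add: E_def B_def)
      obtain u where u: "u \<le> -1" "renovation (future u z)" using elim unfolding recurrent_def by blast
      have "stat_growth (time_shift 0 z) = incr (future u z) (nat (0 - u))"
        by (rule stat_growth_eq[OF elim u(2)]) (use u in simp)
      moreover have "future u z (nat (0 - u)) 0 \<le> incr (future u z) (nat (0 - u))"
        by (rule incr_ge) (use elim u in \<open>auto simp: recurrent_def\<close>)
      ultimately have "z 0 0 \<le> stat_growth z" using u by simp
      then have "ereal (1/2) \<le> stat_growth z" using z0 by simp
      then show ?thesis using stat_growth_le[of z] True unfolding growth_plus_def
        by (cases "stat_growth z") (auto simp: max_def)
    qed (simp add: growth_plus_nonneg)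
  qed
  then have "(\<integral>z. 1/2 * indicator E z \<partial>P) \<le> speed"
    unfolding speed_def using E_sets
    by (intro integral_mono_AE integrable_growth_plus)
      (auto simp: integrable_indicator_iff P.emeasure_eq_measure)
  then have "half_prob / 2 \<le> speed" using E_sets E_prob by simp
  then show ?thesis using half_prob_pos by simp
qed

lemma AE_pos_limit: "AE x in P1. (\<lambda>n. pos x n / ereal (real n)) \<longlonglongrightarrow> ereal speed"
  using AE_max_pos_limit AE_marks AE_P1_driving
proof eventually_elim
  case (elim x)
  show ?case by (rule pos_tendsto) (use elim speed_pos in auto)
qed

end

section \<open>Last passage percolation\<close>

lemma increasing_paths_same: "increasing_paths i i = {[i]}"
proof (intro equalityI subsetI)
  fix p assume p: "p \<in> increasing_paths i i"
  then obtain q where q: "p = i # q" by (cases p) (auto simp: increasing_paths_def)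
  have "q = []"
  proof (rule ccontr)
    assume "q \<noteq> []"
    then have "last q \<in> set q" "last q = i" using p q by (auto simp: increasing_paths_def)
    then show False using p q by (auto simp: increasing_paths_def)
  qed
  then show "p \<in> {[i]}" using q by simp
qed (auto simp: increasing_paths_def)

lemma increasing_paths_snoc:
  assumes "i < j"
  shows "increasing_paths i j = (\<Union>l\<in>{i..<j}. (\<lambda>p. p @ [j]) ` increasing_paths i l)"
proof (intro equalityI subsetI)
  fix p assume p: "p \<in> increasing_paths i j"
  define q where "q = butlast p"
  have pq: "p = q @ [j]" using p append_butlast_last_id[of p] by (simp add: increasing_paths_def q_def)
  have "q \<noteq> []" using p pq assms by (auto simp: increasing_paths_def)
  then have q: "q \<in> increasing_paths i (last q)"
    using p pq by (auto simp: increasing_paths_def sorted_wrt_append)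
  have "last q < j" using p pq \<open>q \<noteq> []\<close> by (auto simp: increasing_paths_def sorted_wrt_append)
  moreover have "i \<le> last q"
  proof (cases q)
    case (Cons a r)
    then show ?thesis using q by (auto simp: increasing_paths_def less_imp_le)
  qed (use \<open>q \<noteq> []\<close> in simp)
  ultimately show "p \<in> (\<Union>l\<in>{i..<j}. (\<lambda>p. p @ [j]) ` increasing_paths i l)" using q pq by auto
next
  fix p assume "p \<in> (\<Union>l\<in>{i..<j}. (\<lambda>p. p @ [j]) ` increasing_paths i l)"
  then obtain l q where l: "l < j" and q: "q \<in> increasing_paths i l" and p: "p = q @ [j]" by auto
  have "x \<le> l" if "x \<in> set q" for x
  proof -
    have "q = butlast q @ [l]" using q append_butlast_last_id[of q] by (simp add: increasing_paths_def)
    moreover have "sorted_wrt (<) q" using q by (simp add: increasing_paths_def)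
    ultimately have "\<forall>y\<in>set (butlast q). y < l" "set q = insert l (set (butlast q))"
      by (metis sorted_wrt_append list.set_intros(1), metis set_append list.simps(15) empty_set Un_insert_right sup_bot.right_neutral)
    then show ?thesis using that by auto
  qed
  then show "p \<in> increasing_paths i j"
    using q l unfolding p by (fastforce simp: increasing_paths_def sorted_wrt_append)
qed

lemma increasing_paths_finite_nonempty:
  assumes "i \<le> j" shows "finite (increasing_paths i j) \<and> increasing_paths i j \<noteq> {}"
proof -
  have "finite (increasing_paths i (i + int n)) \<and> increasing_paths i (i + int n) \<noteq> {}" for n
  proof (induction n rule: less_induct)
    case (less n)
    show ?case
    proof (cases "n = 0")
      case False
      have IH: "finite (increasing_paths i l) \<and> increasing_paths i l \<noteq> {}" if "l \<in> {i..<i + int n}" for l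
      proof -
        have "nat (l - i) < n" "i + int (nat (l - i)) = l" using that by (auto simp: nat_less_iff)
        then show ?thesis using less.IH[of "nat (l - i)"] by simp
      qed
      have "i \<in> {i..<i + int n}" using False by simp
      then show ?thesis using IH False by (subst (1 2) increasing_paths_snoc) auto
    qed (simp add: increasing_paths_same)
  qed
  from this[of "nat (j - i)"] show ?thesis using assms by simp
qed

lemma path_charge_snoc: "p \<noteq> [] \<Longrightarrow> path_charge c (p @ [j]) = path_charge c p + c (last p, j)"
proof -
  assume p: "p \<noteq> []"
  then obtain m where m: "length p = Suc m" by (cases p) auto
  have "(\<Sum>k<Suc m. c ((p @ [j]) ! k, (p @ [j]) ! Suc k)) = (\<Sum>k<m. c (p ! k, p ! Suc k)) + c (p ! m, j)"
    using m by (simp add: nth_append)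
  then show ?thesis using p m by (simp add: path_charge_def last_conv_nth)
qed

lemma max_charge_same: "max_charge c i i = 0"
  by (simp add: max_charge_def increasing_paths_same path_charge_def)

text \<open>Split a path at its last vertex before \<open>j\<close>. Addition is monotone, so an
  optimal path may be taken optimal up to that vertex; this is the recursion of
  \<open>new_point\<close> before sorting.\<close>

lemma max_charge_rec:
  assumes "i < j"
  shows "max_charge c i j = Max ((\<lambda>l. max_charge c i l + c (l, j)) ` {i..<j})"
  unfolding max_charge_def[of c i j]
proof (rule Max_eqI)
  let ?R = "Max ((\<lambda>l. max_charge c i l + c (l, j)) ` {i..<j})"
  show "finite (path_charge c ` increasing_paths i j)"
    using increasing_paths_finite_nonempty assms by simp
  fix a assume "a \<in> path_charge c ` increasing_paths i j"
  then obtain l p where l: "l \<in> {i..<j}" and p: "p \<in> increasing_paths i l" and a: "a = path_charge c (p @ [j])"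
    using increasing_paths_snoc[OF assms] by auto
  have "path_charge c p \<le> max_charge c i l"
    unfolding max_charge_def using increasing_paths_finite_nonempty[of i l] l p by (intro Max_ge) auto
  then have "a \<le> max_charge c i l + c (l, j)"
    unfolding a using p by (subst path_charge_snoc) (auto simp: increasing_paths_def intro: add_right_mono)
  also have "\<dots> \<le> ?R" using l by (intro Max_ge) auto
  finally show "a \<le> ?R" .
next
  let ?R = "Max ((\<lambda>l. max_charge c i l + c (l, j)) ` {i..<j})"
  have "?R \<in> (\<lambda>l. max_charge c i l + c (l, j)) ` {i..<j}"
    using assms by (intro Max_in) auto
  then obtain l where l: "l \<in> {i..<j}" "?R = max_charge c i l + c (l, j)" by blast
  have "max_charge c i l \<in> path_charge c ` increasing_paths i l"
    unfolding max_charge_def using increasing_paths_finite_nonempty[of i l] l by (intro Max_in) auto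
  then obtain p where p: "p \<in> increasing_paths i l" "max_charge c i l = path_charge c p" by blast
  have "?R = path_charge c (p @ [j])"
    unfolding l(2) p(2) using p(1) by (subst path_charge_snoc) (auto simp: increasing_paths_def)
  moreover have "p @ [j] \<in> increasing_paths i j"
    using increasing_paths_snoc[OF assms] l(1) p(1) by blast
  ultimately show "?R \<in> path_charge c ` increasing_paths i j" by blast
qed

lemma max_charge_rec_nat:
  assumes "0 < n"
  shows "max_charge c 0 (int n) = Max ((\<lambda>i. max_charge c 0 (int i) + c (int i, int n)) ` {..<n})"
proof -
  have "{0..<int n} = int ` {..<n}" by (simp add: image_int_atLeastLessThan lessThan_atLeast0)
  then show ?thesis using assms by (subst max_charge_rec) (simp_all add: image_image)
qed

abbreviation nat_edges :: "(int \<times> int) set" where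
  "nat_edges \<equiv> {(i, j). 0 \<le> i \<and> i < j}"

text \<open>Paths from 0 use only edges between nonnegative vertices, so it suffices to know the
  charges on \<open>nat_edges\<close>.\<close>

lemma max_charge_cong:
  assumes "\<And>e. e \<in> nat_edges \<Longrightarrow> c e = c' e"
  shows "max_charge c 0 (int n) = max_charge c' 0 (int n)"
proof (induction n rule: less_induct)
  case (less n)
  show ?case
  proof (cases "n = 0")
    case False
    then show ?thesis using less assms
      by (subst (1 2) max_charge_rec_nat) (auto intro!: arg_cong[where f = Max] image_cong)
  qed (simp add: max_charge_same)
qed

lemma borel_measurable_max_charge:
  assumes "sets F = sets borel"
  shows "(\<lambda>q. max_charge q 0 (int n)) \<in> borel_measurable (PiM nat_edges (\<lambda>_. F))"
proof (induction n rule: less_induct)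
  case (less n)
  show ?case
  proof (cases "n = 0")
    case False
    have "(\<lambda>q. q (int i, int n)) \<in> borel_measurable (PiM nat_edges (\<lambda>_. F))" if "i < n" for i
    proof -
      have "(\<lambda>q. q (int i, int n)) \<in> measurable (PiM nat_edges (\<lambda>_. F)) F"
        by (rule measurable_component_singleton) (use that in simp)
      then show ?thesis unfolding measurable_cong_sets[OF refl assms] .
    qed
    note q = this
    have "(\<lambda>q. max_charge q 0 (int i) + q (int i, int n)) \<in> borel_measurable (PiM nat_edges (\<lambda>_. F))" if "i < n" for i
      by (rule borel_measurable_ereal_add[OF less.IH[OF that] q[OF that]])
    note add = this
    have "(\<lambda>q. Max ((\<lambda>i. max_charge q 0 (int i) + q (int i, int n)) ` {..<n})) \<in> borel_measurable (PiM nat_edges (\<lambda>_. F))"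
    proof (rule borel_measurable_Max)
      fix i assume "i \<in> {..<n}"
      then show "(\<lambda>q. max_charge q 0 (int i) + q (int i, int n)) \<in> borel_measurable (PiM nat_edges (\<lambda>_. F))"
        unfolding lessThan_iff by (rule add)
    qed simp
    then show ?thesis using False by (simp only: max_charge_rec_nat neq0_conv)
  qed (simp add: max_charge_same)
qed

section \<open>Marks of the system as independent edge charges\<close>

definition place :: "(nat \<Rightarrow> ereal) \<Rightarrow> nat \<Rightarrow> nat \<Rightarrow> nat" where
  "place y n = inv_into {..<n} ((!) (ranking y n))"

text \<open>The mark \<open>x j k\<close> is given to the edge from the \<open>k\<close>-th highest point to \<open>j\<close>; the MGS then computes
  maximal charges.\<close>
definition edge_charge :: "(nat \<Rightarrow> nat \<Rightarrow> ereal) \<Rightarrow> nat \<Rightarrow> nat \<Rightarrow> ereal" where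
  "edge_charge x i j = x j (place (pos x) j i)"

lemma place_ranking: "k < n \<Longrightarrow> place y n (ranking y n ! k) = k"
  unfolding place_def by (rule inv_into_f_f) (use bij_betw_ranking[of y n] in \<open>auto simp: bij_betw_def\<close>)

definition charges :: "(nat \<Rightarrow> nat \<Rightarrow> ereal) \<Rightarrow> int \<times> int \<Rightarrow> ereal" where
  "charges x = (\<lambda>e\<in>nat_edges. edge_charge x (nat (fst e)) (nat (snd e)))"

text \<open>Running through the earlier vertices by rank turns the recursion for maximal charges
  into the one for \<open>pos\<close>.\<close>

lemma max_charge_charges: "max_charge (charges x) 0 (int n) = pos x n"
proof (induction n rule: less_induct)
  case (less n)
  show ?case
  proof (cases "n = 0")
    case False
    let ?r = "ranking (pos x) n"
    have "max_charge (charges x) 0 (int n)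
        = Max ((\<lambda>i. max_charge (charges x) 0 (int i) + charges x (int i, int n)) ` {..<n})"
      by (rule max_charge_rec_nat) (use False in simp)
    also have "(\<lambda>i. max_charge (charges x) 0 (int i) + charges x (int i, int n)) ` {..<n}
        = (\<lambda>i. pos x i + edge_charge x i n) ` {..<n}"
    proof (intro image_cong refl)
      fix i assume "i \<in> {..<n}"
      then have "charges x (int i, int n) = edge_charge x i n" "i < n" by (simp_all add: charges_def)
      then show "max_charge (charges x) 0 (int i) + charges x (int i, int n) = pos x i + edge_charge x i n"
        by (simp add: less.IH)
    qed
    also have "{..<n} = (!) ?r ` {..<n}"
      using bij_betw_ranking[of "pos x" n] by (simp add: bij_betw_def)
    also have "(\<lambda>i. pos x i + edge_charge x i n) ` (!) ?r ` {..<n} = (\<lambda>k. pos x (?r ! k) + x n k) ` {..<n}"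
      by (auto simp: image_image edge_charge_def place_ranking intro!: image_cong)
    also have "Max \<dots> = pos x n" using False by (simp add: pos_rec new_point_def)
    finally show ?thesis .
  qed (simp add: max_charge_same)
qed

lemma pos_cong:
  "(\<And>m. 0 < m \<Longrightarrow> m \<le> n \<Longrightarrow> x m = x' m) \<Longrightarrow> pos x n = pos x' n"
proof (induction n rule: less_induct)
  case (less n)
  show ?case
  proof (cases "n = 0")
    case False
    have "new_point (pos x) n (x n) = new_point (pos x') n (x n)"
      by (rule new_point_cong) (use less in auto)
    then show ?thesis using False less.prems[of n] by (simp add: pos_rec)
  qed simp
qed

text \<open>Adaptedness: the ranking used at time \<open>j\<close> involves driving sequences before
  \<open>j\<close> only, so resampling one at time \<open>m \<ge> j\<close> leaves it alone.\<close>

lemma ranking_pos_upd: "j \<le> m \<Longrightarrow> ranking (pos (x(m := v))) j = ranking (pos x) j"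
  by (rule ranking_cong) (auto intro!: pos_cong)

lemma edge_charge_upd: "j < m \<Longrightarrow> edge_charge (x(m := v)) i j = edge_charge x i j"
  by (simp add: edge_charge_def place_def ranking_pos_upd)

lemma measurable_ranking_pos: "(\<lambda>x. ranking (pos x) n) \<in> measurable driving_space (count_space UNIV)"
  by (rule measurable_ranking) (rule borel_measurable_pos)

lemma borel_measurable_edge_charge: "(\<lambda>x. edge_charge x i j) \<in> borel_measurable driving_space"
proof -
  have "(\<lambda>x. inv_into {..<j} ((!) (ranking (pos x) j)) i) \<in> measurable driving_space (count_space UNIV)"
    by (rule measurable_compose[OF measurable_ranking_pos]) simp
  then show ?thesis unfolding edge_charge_def place_def
    by (rule measurable_compose_countable[OF measurable_driving_component])
qed

context charge_distribution
begin

text \<open>Replacing coordinate \<open>m\<close> by an independent copy preserves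
  \<open>P1\<close>. Under this replacement the event pulls back to the rectangle
  \<open>C \<times> U\<close>, because \<open>U\<close> ignores that coordinate.\<close>

lemma measure_fresh_coordinate:
  assumes U: "U \<in> sets P1" and C: "C \<in> sets Q" and upd: "\<And>x v. x(m := v) \<in> U \<longleftrightarrow> x \<in> U"
  shows "measure P1 (U \<inter> {x. x m \<in> C}) = measure P1 U * measure Q C"
proof -
  interpret Q: prob_space Q by (rule prob_space_Q)
  interpret P1: prob_space P1 by (rule prob_space_P1)
  interpret pair: pair_prob_space Q P1 ..
  let ?f = "\<lambda>(v, x). x(m := v)"
  have d: "distr (Q \<Otimes>\<^sub>M P1) P1 ?f = P1"
    using distr_pair_PiM_eq_PiM[of UNIV "\<lambda>_. Q" m] prob_space_Q by simp
  have f: "?f \<in> measurable (Q \<Otimes>\<^sub>M P1) P1"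
  proof -
    have "(\<lambda>y. (snd y)(m := fst y)) \<in> measurable (Q \<Otimes>\<^sub>M P1) (PiM (insert m UNIV) (\<lambda>_. Q))"
      by (rule measurable_fun_upd[where J = UNIV]) auto
    then show ?thesis by (simp add: case_prod_beta')
  qed
  have UC: "U \<inter> {x. x m \<in> C} \<in> sets P1"
  proof -
    have "(\<lambda>x. x m) -` C \<inter> space P1 \<in> sets P1"
      by (intro measurable_sets[OF measurable_component_singleton] C) auto
    then have "U \<inter> ((\<lambda>x. x m) -` C \<inter> space P1) \<in> sets P1" using U by blast
    then show ?thesis by (simp add: vimage_def)
  qed
  have "emeasure P1 (U \<inter> {x. x m \<in> C}) = emeasure (distr (Q \<Otimes>\<^sub>M P1) P1 ?f) (U \<inter> {x. x m \<in> C})"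
    by (simp only: d)
  also have "\<dots> = emeasure (Q \<Otimes>\<^sub>M P1) (?f -` (U \<inter> {x. x m \<in> C}) \<inter> space (Q \<Otimes>\<^sub>M P1))"
    by (rule emeasure_distr[OF f UC])
  also have "?f -` (U \<inter> {x. x m \<in> C}) \<inter> space (Q \<Otimes>\<^sub>M P1) = C \<times> U"
    by (auto simp: space_pair_measure upd)
  also have "emeasure (Q \<Otimes>\<^sub>M P1) (C \<times> U) = emeasure Q C * emeasure P1 U"
    by (rule P1.emeasure_pair_measure_Times[OF C U])
  finally show ?thesis
    by (simp add: P1.emeasure_eq_measure Q.emeasure_eq_measure ennreal_mult[symmetric] mult.commute)
qed

lemma measure_Q_Collect:
  assumes "\<And>k. k < n \<Longrightarrow> B k \<in> sets borel"
  shows "{v. \<forall>k<n. v k \<in> B k} \<in> sets Q" "measure Q {v. \<forall>k<n. v k \<in> B k} = (\<Prod>k<n. prob (B k))"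
proof -
  have "measure Q {v \<in> space Q. \<forall>k\<in>{..<n}. v k \<in> B k} = (\<Prod>k<n. prob (B k))"
    unfolding iid_law_def using assms by (intro measure_PiM_Collect) (auto simp: sets_F prob_space_axioms)
  then show "measure Q {v. \<forall>k<n. v k \<in> B k} = (\<Prod>k<n. prob (B k))" by (simp add: Ball_def)
  have "{v \<in> space seq_space. \<forall>k\<in>{..<n}. v k \<in> B k} \<in> sets seq_space"
    using assms by (intro sets.sets_Collect_finite_All sets_Collect_single') auto
  then show "{v. \<forall>k<n. v k \<in> B k} \<in> sets Q" unfolding sets_Q by (simp add: Ball_def space_PiM)
qed

text \<open>Given the first \<open>n\<close> driving sequences, the marks of the edges into \<open>Suc n\<close> are a
  permutation of the fresh i.i.d. marks \<open>x (Suc n) 0, \<dots>, x (Suc n) n\<close>.\<close>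
lemma measure_edge_charges:
  assumes A: "\<And>i j. A i j \<in> sets borel"
  shows "measure P1 {x. \<forall>j\<le>n. \<forall>i<j. edge_charge x i j \<in> A i j} = (\<Prod>j\<le>n. \<Prod>i<j. prob (A i j))"
proof (induction n)
  case 0
  interpret P1: prob_space P1 by (rule prob_space_P1)
  show ?case using P1.prob_space by simp
next
  case (Suc n)
  interpret P1: prob_space P1 by (rule prob_space_P1)
  let ?E = "{x. \<forall>j\<le>n. \<forall>i<j. edge_charge x i j \<in> A i j}"
  let ?r = "\<lambda>x. ranking (pos x) (Suc n)"
  \<comment> \<open>The permutations of the first n + 1 points; they index a finite partition by the
    ranking at time \<open>Suc n\<close>.\<close>
  define R where "R = {\<pi>. set \<pi> = {..<Suc n} \<and> distinct \<pi> \<and> length \<pi> = Suc n}"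
  have "finite {\<pi>. set \<pi> \<subseteq> {..<Suc n} \<and> length \<pi> = Suc n}" by (rule finite_lists_length_eq) simp
  then have R_fin: "finite R" by (rule rev_finite_subset) (auto simp: R_def)
  have r_R: "?r x \<in> R" for x by (simp add: R_def)
  define C where "C \<pi> = {v. \<forall>k<Suc n. v k \<in> A (\<pi> ! k) (Suc n)}" for \<pi> :: "nat list"
  define U where "U \<pi> = ?E \<inter> {x. ?r x = \<pi>}" for \<pi>
  have E_sets: "?E \<in> sets P1"
  proof -
    have "(\<lambda>x. edge_charge x i j) -` A i j \<inter> space driving_space \<in> sets driving_space" for i j
      by (rule measurable_sets[OF borel_measurable_edge_charge A])
    then have *: "{x \<in> space driving_space. edge_charge x i j \<in> A i j} \<in> sets driving_space" for i j
      by (simp add: vimage_def Int_def conj_commute)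
    have "{x \<in> space driving_space. \<forall>j\<in>{..n}. \<forall>i\<in>{..<j}. edge_charge x i j \<in> A i j} \<in> sets driving_space"
      by (intro sets.sets_Collect_finite_All *) auto
    then show ?thesis unfolding sets_P1 by (simp add: Ball_def space_PiM)
  qed
  have U_sets: "U \<pi> \<in> sets P1" for \<pi>
  proof -
    have "?r -` {\<pi>} \<inter> space driving_space \<in> sets driving_space"
      by (rule measurable_sets[OF measurable_ranking_pos]) simp
    then have "{x. ?r x = \<pi>} \<in> sets P1" unfolding sets_P1 by (simp add: vimage_def space_PiM)
    then show ?thesis unfolding U_def using E_sets by (rule sets.Int[rotated])
  qed
  have C_sets: "C \<pi> \<in> sets Q" for \<pi> unfolding C_def by (rule measure_Q_Collect) (rule A)
  \<comment> \<open>The marks are identically distributed, so permuting the constraints only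
    reorders the factors. As the value is the same for all rankings, conditioning on the ranking
    does not change it.\<close>
  have C_prob: "measure Q (C \<pi>) = (\<Prod>i<Suc n. prob (A i (Suc n)))" if "\<pi> \<in> R" for \<pi>
  proof -
    have "measure Q (C \<pi>) = (\<Prod>k<Suc n. prob (A (\<pi> ! k) (Suc n)))"
      unfolding C_def by (rule measure_Q_Collect) (rule A)
    also have "\<dots> = (\<Prod>i<Suc n. prob (A i (Suc n)))"
      by (rule prod.reindex_bij_betw[OF bij_betw_nth]) (use that in \<open>auto simp: R_def\<close>)
    finally show ?thesis .
  qed
  have UC_prob: "P1.prob (U \<pi> \<inter> {x. x (Suc n) \<in> C \<pi>}) = P1.prob (U \<pi>) * (\<Prod>i<Suc n. prob (A i (Suc n)))"
    if "\<pi> \<in> R" for \<pi>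
  proof -
    have "x(Suc n := v) \<in> U \<pi> \<longleftrightarrow> x \<in> U \<pi>" for x v
      by (auto simp: U_def edge_charge_upd ranking_pos_upd)
    from measure_fresh_coordinate[OF U_sets C_sets this] show ?thesis using C_prob[OF that] by simp
  qed
  have UC_sets: "U \<pi> \<inter> {x. x (Suc n) \<in> C \<pi>} \<in> sets P1" for \<pi>
  proof -
    have "(\<lambda>x. x (Suc n)) -` C \<pi> \<inter> space P1 \<in> sets P1"
      by (intro measurable_sets[OF measurable_component_singleton] C_sets) auto
    then have "U \<pi> \<inter> ((\<lambda>x. x (Suc n)) -` C \<pi> \<inter> space P1) \<in> sets P1" using U_sets by blast
    then show ?thesis by (simp add: vimage_def)
  qed
  have C_iff: "(\<forall>i<Suc n. edge_charge x i (Suc n) \<in> A i (Suc n)) \<longleftrightarrow> x (Suc n) \<in> C (?r x)" for x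
  proof
    assume *: "\<forall>i<Suc n. edge_charge x i (Suc n) \<in> A i (Suc n)"
    show "x (Suc n) \<in> C (?r x)" unfolding C_def
    proof (intro CollectI allI impI)
      fix k assume k: "k < Suc n"
      show "x (Suc n) k \<in> A (?r x ! k) (Suc n)"
        using *[rule_format, OF ranking_less[OF k, of "pos x"]] by (simp add: edge_charge_def place_ranking[OF k])
    qed
  next
    assume *: "x (Suc n) \<in> C (?r x)"
    show "\<forall>i<Suc n. edge_charge x i (Suc n) \<in> A i (Suc n)"
    proof (intro allI impI)
      fix i assume "i < Suc n"
      then obtain k where k: "k < Suc n" "i = ?r x ! k" by (rule ranking_surj)
      then show "edge_charge x i (Suc n) \<in> A i (Suc n)"
        using * by (simp add: C_def edge_charge_def place_ranking)
    qed
  qed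
  have split: "{x. \<forall>j\<le>Suc n. \<forall>i<j. edge_charge x i j \<in> A i j} = (\<Union>\<pi>\<in>R. U \<pi> \<inter> {x. x (Suc n) \<in> C \<pi>})"
  proof -
    have 1: "(\<forall>j\<le>Suc n. \<forall>i<j. edge_charge x i j \<in> A i j) \<longleftrightarrow> x \<in> ?E \<and> x (Suc n) \<in> C (?r x)" for x
      unfolding C_iff[symmetric] by (auto simp: le_Suc_eq)
    show ?thesis
    proof (intro equalityI subsetI)
      fix x assume "x \<in> {x. \<forall>j\<le>Suc n. \<forall>i<j. edge_charge x i j \<in> A i j}"
      then have "x \<in> ?E" "x (Suc n) \<in> C (?r x)" unfolding mem_Collect_eq 1 by simp_all
      then have "x \<in> U (?r x) \<inter> {x. x (Suc n) \<in> C (?r x)}"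
        by (simp add: U_def)
      then show "x \<in> (\<Union>\<pi>\<in>R. U \<pi> \<inter> {x. x (Suc n) \<in> C \<pi>})"
        using UN_I[where B = "\<lambda>\<pi>. U \<pi> \<inter> {x. x (Suc n) \<in> C \<pi>}", OF r_R[of x]] by simp
    next
      fix x assume "x \<in> (\<Union>\<pi>\<in>R. U \<pi> \<inter> {x. x (Suc n) \<in> C \<pi>})"
      then obtain \<pi> where "x \<in> U \<pi>" "x (Suc n) \<in> C \<pi>" by blast
      then have "x \<in> ?E" "x (Suc n) \<in> C (?r x)" by (simp_all add: U_def)
      then show "x \<in> {x. \<forall>j\<le>Suc n. \<forall>i<j. edge_charge x i j \<in> A i j}"
        unfolding mem_Collect_eq 1 by simp
    qed
  qed
  have disj: "disjoint_family_on U R"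
    unfolding disjoint_family_on_def U_def by blast
  then have disj': "disjoint_family_on (\<lambda>\<pi>. U \<pi> \<inter> {x. x (Suc n) \<in> C \<pi>}) R"
    unfolding disjoint_family_on_def by blast
  have "P1.prob (\<Union>\<pi>\<in>R. U \<pi> \<inter> {x. x (Suc n) \<in> C \<pi>}) = (\<Sum>\<pi>\<in>R. P1.prob (U \<pi> \<inter> {x. x (Suc n) \<in> C \<pi>}))"
    by (rule P1.finite_measure_finite_Union[OF R_fin _ disj']) (use UC_sets in blast)
  also have "\<dots> = (\<Sum>\<pi>\<in>R. P1.prob (U \<pi>)) * (\<Prod>i<Suc n. prob (A i (Suc n)))"
    by (simp only: UC_prob sum_distrib_right cong: sum.cong)
  also have "(\<Sum>\<pi>\<in>R. P1.prob (U \<pi>)) = P1.prob (\<Union>\<pi>\<in>R. U \<pi>)"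
    by (rule P1.finite_measure_finite_Union[OF R_fin _ disj, symmetric]) (use U_sets in blast)
  also have "(\<Union>\<pi>\<in>R. U \<pi>) = ?E" unfolding U_def using r_R by blast
  also have "P1.prob ?E = (\<Prod>j\<le>n. \<Prod>i<j. prob (A i j))" by (rule Suc)
  finally show ?case unfolding split by (simp add: atMost_Suc mult.commute)
qed

lemma measurable_charges: "charges \<in> measurable P1 (PiM nat_edges (\<lambda>_. F))"
  unfolding charges_def[abs_def]
proof (rule measurable_restrict)
  fix e
  show "(\<lambda>x. edge_charge x (nat (fst e)) (nat (snd e))) \<in> measurable P1 F"
    by (simp add: measurable_P1_iff measurable_cong_sets[OF refl sets_F] borel_measurable_edge_charge)
qed

lemma distr_charges: "distr P1 (PiM nat_edges (\<lambda>_. F)) charges = PiM nat_edges (\<lambda>_. F)"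
proof (rule measure_eqI_PiM_infinite)
  interpret P1: prob_space P1 by (rule prob_space_P1)
  show "finite_measure (distr P1 (PiM nat_edges (\<lambda>_. F)) charges)"
    using P1.prob_space_distr[OF measurable_charges] by (simp add: prob_space_def)
  fix A :: "int \<times> int \<Rightarrow> ereal set" and J :: "(int \<times> int) set"
  assume J: "finite J" "J \<subseteq> nat_edges" and A: "\<And>e. e \<in> J \<Longrightarrow> A e \<in> events"
  \<comment> \<open>Padding with \<open>UNIV\<close> completes the finite set \<open>J\<close> to a
    full triangle of edges, the shape treated by \<open>measure_edge_charges\<close>; the added
    factors are 1.\<close>
  define A' where "A' i j = (if (int i, int j) \<in> J then A (int i, int j) else UNIV)" for i j
  have A'_sets: "A' i j \<in> sets borel" for i j using A by (auto simp: A'_def sets_F)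
  obtain n where n: "\<And>e. e \<in> J \<Longrightarrow> nat (snd e) \<le> n"
    using finite_nat_set_iff_bounded_le[of "(\<lambda>e. nat (snd e)) ` J"] J(1) by auto
  let ?S = "Sigma {..n} (\<lambda>j. {..<j})"
  have S: "(int i, int j) \<in> J \<Longrightarrow> j \<le> n \<and> i < j" for i j
    using n[of "(int i, int j)"] J(2) by auto
  have "distr P1 (PiM nat_edges (\<lambda>_. F)) charges (prod_emb nat_edges (\<lambda>_. F) J (Pi\<^sub>E J A))
      = emeasure P1 (charges -` prod_emb nat_edges (\<lambda>_. F) J (Pi\<^sub>E J A) \<inter> space P1)"
    using J A by (intro emeasure_distr[OF measurable_charges] sets_PiM_I) auto
  also have "charges -` prod_emb nat_edges (\<lambda>_. F) J (Pi\<^sub>E J A) \<inter> space P1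
      = {x. \<forall>j\<le>n. \<forall>i<j. edge_charge x i j \<in> A' i j}"
  proof -
    have "charges x \<in> prod_emb nat_edges (\<lambda>_. F) J (Pi\<^sub>E J A) \<longleftrightarrow> (\<forall>e\<in>J. charges x e \<in> A e)" for x
    proof -
      have "charges x \<in> extensional nat_edges" by (simp add: charges_def)
      then show ?thesis by (auto simp: prod_emb_def PiE_iff)
    qed
    moreover have "(\<forall>e\<in>J. charges x e \<in> A e) \<longleftrightarrow> (\<forall>j\<le>n. \<forall>i<j. edge_charge x i j \<in> A' i j)" for x
    proof
      assume *: "\<forall>e\<in>J. charges x e \<in> A e"
      show "\<forall>j\<le>n. \<forall>i<j. edge_charge x i j \<in> A' i j"
      proof (intro allI impI)
        fix j i :: nat assume "j \<le> n" "i < j"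
        then show "edge_charge x i j \<in> A' i j"
          using *[rule_format, of "(int i, int j)"] by (auto simp: A'_def charges_def)
      qed
    next
      assume *: "\<forall>j\<le>n. \<forall>i<j. edge_charge x i j \<in> A' i j"
      show "\<forall>e\<in>J. charges x e \<in> A e"
      proof
        fix e assume e: "e \<in> J"
        then obtain i j where ij: "e = (int i, int j)"
          using J(2) by (cases e) (auto dest!: subsetD intro: that[of "nat (fst e)" "nat (snd e)"])
        then show "charges x e \<in> A e"
          using *[rule_format, of j i] S[of i j] e J(2) by (auto simp: A'_def charges_def)
      qed
    qed
    ultimately show ?thesis by auto
  qed
  also have "emeasure P1 \<dots> = ennreal (\<Prod>j\<le>n. \<Prod>i<j. prob (A' i j))"
    using measure_edge_charges[OF A'_sets] by (simp add: P1.emeasure_eq_measure)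
  also have "(\<Prod>j\<le>n. \<Prod>i<j. prob (A' i j)) = (\<Prod>(j, i)\<in>?S. prob (A' i j))"
    by (subst prod.Sigma) auto
  also have "\<dots> = (\<Prod>(j, i)\<in>{(j, i). (int i, int j) \<in> J}. prob (A' i j))"
  proof (rule prod.mono_neutral_right)
    show "{(j, i). (int i, int j) \<in> J} \<subseteq> ?S" using S by auto
    show "\<forall>p\<in>?S - {(j, i). (int i, int j) \<in> J}. (case p of (j, i) \<Rightarrow> prob (A' i j)) = 1"
    proof
      fix p assume p: "p \<in> ?S - {(j, i). (int i, int j) \<in> J}"
      obtain j i where ji: "p = (j, i)" by (cases p)
      then have "A' i j = UNIV" using p by (simp add: A'_def)
      then show "(case p of (j, i) \<Rightarrow> prob (A' i j)) = 1" using prob_space ji by simp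
    qed
  qed auto
  also have "\<dots> = (\<Prod>e\<in>J. prob (A e))"
  proof (rule prod.reindex_bij_witness[where i = "\<lambda>e. (nat (snd e), nat (fst e))" and j = "\<lambda>(j, i). (int i, int j)"])
    fix e assume "e \<in> J"
    then show "(\<lambda>(j, i). (int i, int j)) (nat (snd e), nat (fst e)) = e"
      "(nat (snd e), nat (fst e)) \<in> {(j, i). (int i, int j) \<in> J}"
      using J(2) by (auto dest!: subsetD)
  qed (auto simp: A'_def)
  also have "ennreal \<dots> = (\<Prod>e\<in>J. emeasure F (A e))"
    by (simp add: emeasure_eq_measure prod_ennreal)
  also have "\<dots> = emeasure (PiM nat_edges (\<lambda>_. F)) (prod_emb nat_edges (\<lambda>_. F) J (Pi\<^sub>E J A))"
    by (rule emeasure_PiM_emb[symmetric]) (use J A prob_space_axioms in auto)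
  finally show "distr P1 (PiM nat_edges (\<lambda>_. F)) charges (prod_emb nat_edges (\<lambda>_. F) J (Pi\<^sub>E J A))
      = emeasure (PiM nat_edges (\<lambda>_. F)) (prod_emb nat_edges (\<lambda>_. F) J (Pi\<^sub>E J A))" .
qed auto

text \<open>The limit for \<open>pos\<close> holds under \<open>P1\<close>, \<open>charges\<close>
  carries it to independent charges on \<open>nat_edges\<close>, and the law on all edges restricts
  to that one.\<close>

lemma AE_charge_limit:
  "AE q in charge_law F. (\<lambda>n. max_charge q 0 (int n) / ereal (real n)) \<longlonglongrightarrow> ereal speed"
proof -
  let ?N = "PiM nat_edges (\<lambda>_. F)"
  let ?L = "\<lambda>q. (\<lambda>n. max_charge q 0 (int n) / ereal (real n)) \<longlonglongrightarrow> ereal speed"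
  have div: "(\<lambda>q. max_charge q 0 (int n) / ereal (real n)) \<in> borel_measurable ?N" for n
    by (intro borel_measurable_ereal_divide borel_measurable_max_charge sets_F borel_measurable_const)
  \<comment> \<open>Measurability of the convergence event is required to pass to the image measure;
    equality of the lower and upper limits with the constant provides it.\<close>
  have "{q \<in> space ?N. ?L q} = {q \<in> space ?N. liminf (\<lambda>n. max_charge q 0 (int n) / ereal (real n)) = ereal speed
      \<and> limsup (\<lambda>n. max_charge q 0 (int n) / ereal (real n)) = ereal speed}"
    by (simp add: tendsto_iff_Liminf_eq_Limsup)
  also have "\<dots> \<in> sets ?N"
    by (intro sets.sets_Collect_conj borel_measurable_eq borel_measurable_liminf borel_measurable_limsup div borel_measurable_const)
  finally have meas: "{q \<in> space ?N. ?L q} \<in> sets ?N" .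
  have "AE x in P1. ?L (charges x)"
    using AE_pos_limit by (simp add: max_charge_charges)
  then have "AE q in distr P1 ?N charges. ?L q"
    by (subst AE_distr_iff[OF measurable_charges meas])
  then have AE_N: "AE q in ?N. ?L q" by (simp only: distr_charges)
  have restr: "(\<lambda>q. \<lambda>e\<in>nat_edges. q e) \<in> measurable (charge_law F) ?N"
    unfolding charge_law_def by (rule measurable_restrict) auto
  have "distr (charge_law F) ?N (\<lambda>q. \<lambda>e\<in>nat_edges. q e) = ?N"
    unfolding charge_law_def
    using distr_PiM_reindex[of "{(i, j). i < j}" "\<lambda>_. F" "\<lambda>e. e" nat_edges] prob_space_axioms by auto
  then have "AE q in distr (charge_law F) ?N (\<lambda>q. \<lambda>e\<in>nat_edges. q e). ?L q"
    by (simp only: AE_N)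
  then have "AE q in charge_law F. ?L (\<lambda>e\<in>nat_edges. q e)" by (rule AE_distrD[OF restr])
  moreover have "max_charge (\<lambda>e\<in>nat_edges. q e) 0 (int n) = max_charge q 0 (int n)" for q n
    by (rule max_charge_cong) simp
  ultimately show ?thesis by simp
qed

lemma lpp_constant_eq: "lpp_constant F = speed"
  unfolding lpp_constant_def
proof (rule the_equality)
  show "AE q in charge_law F. (\<lambda>n. max_charge q 0 (int n) / ereal (real n)) \<longlonglongrightarrow> ereal speed"
    by (rule AE_charge_limit)
  fix c assume c: "AE q in charge_law F. (\<lambda>n. max_charge q 0 (int n) / ereal (real n)) \<longlonglongrightarrow> ereal c"
  interpret C: prob_space "charge_law F"
    unfolding charge_law_def by (intro prob_space_PiM) (rule prob_space_axioms)
  from c AE_charge_limit have "AE q in charge_law F. c = speed"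
    by eventually_elim (use LIMSEQ_unique in fastforce)
  then show "c = speed" by simp
qed

end

section \<open>Transfer to an arbitrary probability space\<close>

theorem theorem10p6:
  fixes F :: "ereal measure"
    and M :: "'a measure"
    and w :: "int \<Rightarrow> 'a \<Rightarrow> nat \<Rightarrow> ereal"
    and T :: "'a \<Rightarrow> int"
    and \<nu> :: "'a \<Rightarrow> int \<Rightarrow> ereal measure"
  assumes "prob_space F" and "sets F = sets borel" and "emeasure F {\<infinity>} = 0"
    and "Inf {z. emeasure F {z<..<\<infinity>} = 0} = 1"
    and "prob_space M"
    and "random_MGS M (iid_law F) w T \<nu>"
  shows "\<exists>mbar :: int \<Rightarrow> 'a \<Rightarrow> ereal.
           stationary_process M mbar \<and>
           (\<forall>t. \<forall>\<omega>\<in>space M. mbar t \<omega> \<noteq> \<infinity>) \<and>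
           (AE \<omega> in M. \<forall>\<^sub>F t in at_top.
              max_growth (shift_top (\<nu> \<omega> (t - 1))) (w t \<omega>) = mbar t \<omega>) \<and>
           has_bochner_integral M (\<lambda>\<omega>. real_of_ereal (max (mbar 0 \<omega>) 0)) (lpp_constant F)"
proof -
  interpret M: prob_space M by fact
  interpret charge_distribution F
    by (intro charge_distribution.intro charge_distribution_axioms.intro assms)
  have ind: "M.indep_vars (\<lambda>_. seq_space) w UNIV" and law: "\<And>t. distr M seq_space (w t) = Q"
    and mgs: "AE \<omega> in M. is_MGS (T \<omega>) (\<lambda>t. w t \<omega>) (\<nu> \<omega>)"
    using assms(6) by (auto simp: random_MGS_def iid_driving_def)
  define W where "W \<omega> t = w t \<omega>" for \<omega> t
  have w_meas: "w t \<in> measurable M seq_space" for t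
    using ind unfolding M.indep_vars_def2 by blast
  have W_meas: "W \<in> measurable M P"
  proof -
    have "(\<lambda>\<omega> t. w t \<omega>) \<in> measurable M bi_driving_space"
    proof (rule measurable_PiM_single')
      show "(\<lambda>\<omega>. w t \<omega>) \<in> measurable M seq_space" for t by (rule w_meas)
    qed (simp add: space_PiM)
    then show ?thesis unfolding W_def[abs_def] measurable_cong_sets[OF refl sets_P] .
  qed
  have W_law: "distr M P W = P"
  proof -
    have "distr M bi_driving_space (\<lambda>\<omega>. \<lambda>t\<in>UNIV. w t \<omega>) = (\<Pi>\<^sub>M t\<in>UNIV. distr M seq_space (w t))"
      by (rule M.indep_vars_iff_distr_eq_PiM[OF UNIV_not_empty w_meas, THEN iffD1, OF ind])
    then have "distr M bi_driving_space W = P"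
      unfolding law restrict_UNIV W_def[abs_def] .
    moreover have "distr M bi_driving_space W = distr M P W"
      by (rule distr_cong) (simp_all add: sets_P)
    ultimately show ?thesis by simp
  qed
  \<comment> \<open>A function of the driving sequences alone, the same one at every time up to a
    shift; neither the initial state nor the starting time enters.\<close>
  define mbar where "mbar t \<omega> = stat_growth (time_shift t (W \<omega>))" for t \<omega>
  have growth_meas: "(\<lambda>z. stat_growth (time_shift t z)) \<in> borel_measurable P" for t
    by (rule measurable_compose[OF measurable_shift_P measurable_P_iff[THEN iffD2, OF borel_measurable_stat_growth]])
  have "stationary_process M mbar"
    unfolding stationary_process_def
  proof (intro conjI allI)
    show "mbar t \<in> borel_measurable M" for t
      unfolding mbar_def[abs_def] by (rule measurable_compose[OF W_meas growth_meas])
    fix s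
    let ?N = "\<Pi>\<^sub>M t\<in>UNIV. borel"
    define h where "h z t = stat_growth (time_shift t z)" for z t
    have h: "h \<in> measurable P ?N"
    proof (rule measurable_PiM_single')
      show "(\<lambda>z. h z t) \<in> borel_measurable P" for t unfolding h_def by (rule growth_meas)
    qed (simp add: space_PiM)
    \<comment> \<open>The map \<open>h\<close> commutes with time shifts, so shifting the process
      amounts to shifting the driving sequences, whose law is invariant.\<close>
    have "distr M ?N (\<lambda>\<omega> t. mbar (t + s) \<omega>) = distr M ?N (h \<circ> (time_shift s \<circ> W))"
      by (rule distr_cong) (auto simp: mbar_def h_def fun_eq_iff add.assoc)
    also have "\<dots> = distr (distr (distr M P W) P (time_shift s)) ?N h"
      by (simp only: distr_distr[OF measurable_shift_P W_meas]
          distr_distr[OF h measurable_comp[OF W_meas measurable_shift_P]])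
    also have "\<dots> = distr (distr M P W) ?N h" by (simp only: W_law distr_shift)
    also have "\<dots> = distr M ?N (h \<circ> W)" by (rule distr_distr[OF h W_meas])
    also have "\<dots> = distr M ?N (\<lambda>\<omega> t. mbar t \<omega>)"
      by (rule distr_cong) (auto simp: mbar_def h_def)
    finally show "distr M ?N (\<lambda>\<omega> t. mbar (t + s) \<omega>) = distr M ?N (\<lambda>\<omega> t. mbar t \<omega>)" .
  qed
  moreover have "\<forall>t. \<forall>\<omega>\<in>space M. mbar t \<omega> \<noteq> \<infinity>"
  proof (intro allI ballI)
    show "mbar t \<omega> \<noteq> \<infinity>" for t \<omega>
      unfolding mbar_def using stat_growth_le[of "time_shift t (W \<omega>)"] by auto
  qed
  moreover have "AE \<omega> in M. \<forall>\<^sub>F t in at_top. max_growth (shift_top (\<nu> \<omega> (t - 1))) (w t \<omega>) = mbar t \<omega>"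
  proof -
    have "AE \<omega> in M. recurrent (W \<omega>)"
      by (rule AE_distrD[OF W_meas]) (simp only: W_law AE_recurrent_driving)
    with mgs show ?thesis
    proof eventually_elim
      case (elim \<omega>)
      then show ?case using MGS_eventually_stat_growth[of "W \<omega>" "T \<omega>" "\<nu> \<omega>"]
        by (simp add: W_def[abs_def] mbar_def)
    qed
  qed
  moreover have "has_bochner_integral M (\<lambda>\<omega>. real_of_ereal (max (mbar 0 \<omega>) 0)) (lpp_constant F)"
  proof -
    have eq: "real_of_ereal (max (mbar 0 \<omega>) 0) = growth_plus (W \<omega>)" for \<omega>
      by (simp add: mbar_def growth_plus_def)
    have "integrable (distr M P W) growth_plus" using integrable_growth_plus by (simp only: W_law)
    then have "integrable M (\<lambda>\<omega>. growth_plus (W \<omega>))"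
      by (rule integrable_distr[OF W_meas])
    moreover have "(\<integral>\<omega>. growth_plus (W \<omega>) \<partial>M) = speed"
      using integral_distr[OF W_meas growth_plus_measurable] by (simp only: W_law speed_def)
    ultimately show ?thesis by (simp add: eq lpp_constant_eq has_bochner_integral_iff)
  qed
  ultimately show ?thesis by blast
qed

end
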